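(* Let $L>0$, $k\in\mathbb Z$ and $s\in(0,\pi)$. Let $\alpha\in(0,1)\cup(1,2)$. Then $$ (-\Delta)^{\alpha/2}(e^{iks})=\frac{c_{\alpha}|\sin(s)|^{\alpha-1}}{8L^\alpha\tan(\frac{\pi\alpha}{2})}\sum_{l=-\infty}^\infty e^{i2ls}\left((1-\alpha)k^2-4kl\right)\frac{\Gamma\left(\frac{-1+\alpha}{2}+|l|\right)\Gamma\left(\frac{-1-\alpha}{2}+\left|\frac{k}{2}-l\right|\right)}{\Gamma\left(\frac{3-\alpha}{2}+|l|\right)\Gamma\left(\frac{3+\alpha}{2}+\left|\frac{k}{2}-l\right|\right)} $$ if $k$ is even, and $$ (-\Delta)^{\alpha/2}(e^{iks})=i\frac{c_{\alpha}|\sin(s)|^{\alpha-1}}{8L^\alpha}\sum_{l=-\infty}^\infty e^{i2ls}\left((1-\alpha)k^2-4kl\right)\operatorname{sgn}\left(\tfrac{k}{2}-l\right)\frac{\Gamma\left(\frac{-1+\alpha}{2}+|l|\right)\Gamma\left(\frac{-1-\alpha}{2}+\left|\frac{k}{2}-l\right|\right)}{\Gamma\left(\frac{3-\alpha}{2}+|l|\right)\Gamma\left(\frac{3+\alpha}{2}+\left|\frac{k}{2}-l\right|\right)} $$ if $k$ is odd. Moreover, when $\alpha=1$, $$ (-\Delta)^{1/2}(e^{iks})=\frac{|k|\sin^2(s)}{L}e^{iks} $$ if $k$ is even, and $$ (-\Delta)^{1/2}(e^{iks})=\frac{ik}{L\pi}\left(\frac{-2}{k^2-4}-\sum_{l=-\infty}^\infty\frac{4\operatorname{sgn}(l)e^{i2ls}}{(k-2l)((k-2l)^2-4)}\right)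 $$ if $k$ is odd.
   Context: For $\alpha\in(0,2)$ the one-dimensional fractional Laplacian of a bounded regular function $u$ on $\mathbb R$ is $$(-\Delta)^{\alpha/2}u(x)=c_\alpha\int_{-\infty}^\infty\frac{u(x)-u(x+y)}{|y|^{1+\alpha}}\,dy,\qquad c_\alpha=\alpha\frac{2^{\alpha-1}\Gamma(1/2+\alpha/2)}{\sqrt{\pi}\,\Gamma(1-\alpha/2)},$$ where the integral is taken in the principal value sense at $y=0$, i.e. it equals $c_\alpha\int_0^\infty\frac{2u(x)-u(x-y)-u(x+y)}{y^{1+\alpha}}\,dy$. Given $L>0$, the real line is parametrized by $x=L\cot(s)$, $s\in(0,\pi)$, and a function $u$ on $\mathbb R$ is written in the variable $s$ as $u(s)\equiv u(L\cot(s))$. The notation $(-\Delta)^{\alpha/2}(e^{iks})$ means: take the function $u_k:\mathbb R\to\mathbb C$ defined by $u_k(L\cot(s))=e^{iks}$ for $s\in(0,\pi)$ (that is, $u_k(x)=e^{ik\operatorname{arccot}(x/L)}$ with $\operatorname{arccot}$ valued in $(0,\pi)$), apply $(-\Delta)^{\alpha/2}$ in the variable $x$, and evaluate the result at $x=L\cot(s)$. $\Gamma$ is the Gamma function, and $\operatorname{sgn}$ is the sign function with $\operatorname{sgn}(0)=0$. *)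

theory Defs
  imports "HOL-Analysis.Analysis"
begin

definition frac_const :: "real \<Rightarrow> real" where
  "frac_const \<alpha> =
     \<alpha> * (2 powr (\<alpha> - 1) * Gamma (1/2 + \<alpha>/2)) / (sqrt pi * Gamma (1 - \<alpha>/2))"

definition frac_integrand :: "real \<Rightarrow> (real \<Rightarrow> complex) \<Rightarrow> real \<Rightarrow> real \<Rightarrow> complex" where
  "frac_integrand \<alpha> u x y = (u x - u (x + y)) / complex_of_real (\<bar>y\<bar> powr (1 + \<alpha>))"

(* The fractional Laplacian of order \<alpha>/2 of u at x exists and equals v.  It is a relation
   (like has_integral) so that existence of the principal value at y = 0 is part of the
   assertion: the truncated integrals converge absolutely, and they tend to a limit as the
   excised symmetric neighbourhood of 0 shrinks. *)
definition has_frac_laplacian :: "real \<Rightarrow> (real \<Rightarrow> complex) \<Rightarrow> real \<Rightarrow> complex \<Rightarrow> bool" where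
  "has_frac_laplacian \<alpha> u x v \<longleftrightarrow>
     (\<forall>\<epsilon>>0. set_integrable lborel {y. \<epsilon> < \<bar>y\<bar>} (frac_integrand \<alpha> u x)) \<and>
     ((\<lambda>\<epsilon>. complex_of_real (frac_const \<alpha>) *
            set_lebesgue_integral lborel {y. \<epsilon> < \<bar>y\<bar>} (frac_integrand \<alpha> u x))
        \<longlongrightarrow> v) (at_right 0)"

lemma has_frac_laplacian_unique:
  assumes "has_frac_laplacian \<alpha> u x v" "has_frac_laplacian \<alpha> u x w"
  shows "v = w"
  using assms tendsto_unique[OF trivial_limit_at_right_real]
  unfolding has_frac_laplacian_def by blast

(* The branch of the inverse cotangent with values in the open interval from 0 to pi. *)
definition arccot :: "real \<Rightarrow> real" where
  "arccot x = (THE t. 0 < t \<and> t < pi \<and> cot t = x)"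

lemma arccot_unique:
  assumes "0 < t" "t < pi" "cot t = x"
  shows "t = pi/2 - arctan x"
proof -
  have "tan (pi/2 - t) = x"
    using assms by (simp add: tan_cot' cot_def tan_def cos_diff sin_diff)
  then have "arctan x = pi/2 - t"
    using assms by (intro arctan_unique) auto
  then show ?thesis by simp
qed

lemma cot_pi_half_minus_arctan: "cot (pi/2 - arctan x) = x"
  using tan_arctan[of x] by (simp add: cot_def tan_def cos_diff sin_diff)

lemma arccot_eq: "arccot x = pi/2 - arctan x"
  unfolding arccot_def
proof (rule the_equality)
  show "0 < pi/2 - arctan x \<and> pi/2 - arctan x < pi \<and> cot (pi/2 - arctan x) = x"
    using arctan_bounded[of x] cot_pi_half_minus_arctan[of x] by linarith
qed (use arccot_unique in blast)

lemma arccot_cot: "0 < t \<Longrightarrow> t < pi \<Longrightarrow> arccot (cot t) = t"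
  using arccot_unique[of t "cot t"] arccot_eq by simp

definition on_line :: "real \<Rightarrow> (real \<Rightarrow> complex) \<Rightarrow> real \<Rightarrow> complex" where
  "on_line L f x = f (arccot (x / L))"

lemma on_line_cot: "L > 0 \<Longrightarrow> 0 < t \<Longrightarrow> t < pi \<Longrightarrow> on_line L f (L * cot t) = f t"
  by (simp add: on_line_def arccot_cot)

end

theory Submission
  imports Defs
begin

text \<open>
  The proof transports the fractional Laplacian to the interval \<open>(0, \<pi>)\<close>, where it becomes a
  periodic convolution that can be computed by Fourier series.

  Let \<open>u\<close> be the mapped exponential and \<open>K\<close> a kernel on \<open>(0, \<infinity>)\<close> with \<open>K' y = y powr - \<alpha>\<close>, that
  is \<open>K y = y powr (1 - \<alpha>) / (1 - \<alpha>)\<close>, or \<open>K = ln\<close> when \<open>\<alpha> = 1\<close>.  Two integrations by parts on the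
  half lines \<open>\<bar>y\<bar> > \<epsilon>\<close> turn the principal value into the absolutely convergent integral of
  \<open>u'' (x + y) * K \<bar>y\<bar>\<close> (\<open>has_frac_laplacian_kernel\<close>); the boundary terms vanish because symmetric
  second differences of \<open>u\<close> are quadratically small and \<open>u'\<close> decays quadratically.  The substitution
  \<open>x + y = L * cot t\<close> then gives, because \<open>cot t - cot s = sin (s - t) / (sin s * sin t)\<close>,
  an integral of \<open>profile\<close> against \<open>\<bar>sin (t - s)\<bar> powr (1 - \<alpha>)\<close> or \<open>ln \<bar>sin (t - s)\<bar>\<close>
  (\<open>has_frac_laplacian_wave\<close>).

  The profile is a continuous function on \<open>[0, \<pi>]\<close>.  Its Fourier coefficients reduce, by one more
  integration by parts, to the single family of moments
  \<open>sin_moment b m\<close>, the integral of \<open>sin t powr b * cis (m * t)\<close> over \<open>[0, \<pi>]\<close>; it is this reduction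
  that produces the polynomial factor \<open>(1 - \<alpha>) * k\<^sup>2 - 4 * k * l\<close>.  The moments satisfy a two-term
  recurrence in \<open>m\<close>, which they share with a quotient of Gamma functions (\<open>sin_moment_gamma_ratio\<close>), and
  the recurrence also makes the coefficients absolutely summable by telescoping
  (\<open>summable_sin_moment\<close>).  Hence the profile is the sum of its Fourier series
  (\<open>fourier_inversion\<close>), the series may be integrated term by term against the
  integrable kernel, and each exponential is an eigenfunction of a periodic
  convolution (\<open>profile_convolution\<close>).

  For \<open>\<alpha> \<noteq> 1\<close> the eigenvalues are again moments of powers of the sine, and the functional
  equation and the reflection formula of the Gamma function collect all constants (\<open>even_constant\<close>, \<open>odd_constant\<close>).  For \<open>\<alpha> = 1\<close> the logarithm of the
  quotient splits into a sum; the eigenvalues of convolution with \<open>ln \<bar>sin t\<bar>\<close> are \<open>- \<pi> / (2 * \<bar>l\<bar>)\<close>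
  for \<open>l \<noteq> 0\<close>, and the part of the kernel depending on \<open>t\<close> alone contributes the same
  convolution at \<open>s = 0\<close>.  So the answer is a difference of two values of one Fourier series, which is a trigonometric polynomial for even \<open>k\<close>, and
  for odd \<open>k\<close> contains a constant that telescopes (\<open>half_laplacian_odd\<close>).
\<close>

section \<open>Trigonometric moments of powers of the sine\<close>

text \<open>The substitution \<open>x = (1 - cos t) / 2\<close> gives \<open>x * (1 - x) = (sin t / 2)\<^sup>2\<close> and turns
  the integral into a Beta integral with two equal parameters; Legendre's duplication formula
  then brings the value into a form with a single quotient.  The change of
  variables also transfers absolute integrability, which matters for \<open>b < 0\<close>, where the integrand
  is unbounded.\<close>

lemma sin_powr_integral:
  fixes b :: real
  assumes "b > -1"
  shows "(\<lambda>t. sin t powr b) absolutely_integrable_on {0..pi}"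
    and "integral {0..pi} (\<lambda>t. sin t powr b) = sqrt pi * Gamma ((b+1)/2) / Gamma (1 + b/2)"
proof -
  define a where "a = (b+1)/2"
  have a: "a > 0" using assms by (simp add: a_def)
  define f where "f = (\<lambda>t::real. t powr (a-1) * (1-t) powr (a-1))"
  define g where "g = (\<lambda>t::real. (1 - cos t)/2)"
  have hB: "(f has_integral Beta a a) {0..1}"
    unfolding f_def using has_integral_Beta_real[OF a a] by simp
  have fnn: "\<And>t. f t \<ge> 0" by (simp add: f_def)
  have "f absolutely_integrable_on {0..1}"
    using hB fnn by (intro nonnegative_absolutely_integrable_1) (auto simp: integrable_on_def)
  moreover have "g ` {0..pi} = {0..1}"
  proof (intro set_eqI iffI)
    fix x assume "x \<in> {0..1::real}"
    then have "g (arccos (1 - 2*x)) = x" "arccos (1 - 2*x) \<in> {0..pi}"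
      by (auto simp: g_def cos_arccos arccos_lbound arccos_ubound)
    then show "x \<in> g ` {0..pi}" by (metis imageI)
  next
    fix x assume "x \<in> g ` {0..pi}"
    then obtain y where "x = g y" by auto
    moreover have "0 \<le> g y" "g y \<le> 1" using cos_ge_minus_one[of y] by (simp_all add: g_def)
    ultimately show "x \<in> {0..1}" by simp
  qed
  moreover have "inj_on g {0..pi}"
    by (auto simp: g_def inj_on_def cos_inj_pi)
  moreover have "(g has_field_derivative (sin t / 2)) (at t within {0..pi})" for t
    unfolding g_def by (auto intro!: derivative_eq_intros)
  ultimately have *: "(\<lambda>t. \<bar>sin t / 2\<bar> *\<^sub>R f (g t)) absolutely_integrable_on {0..pi} \<and>
      integral {0..pi} (\<lambda>t. \<bar>sin t / 2\<bar> *\<^sub>R f (g t)) = Beta a a"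
    using has_absolute_integral_change_of_variables_real[of "{0..pi}" g "\<lambda>t. sin t / 2" f "Beta a a"] hB
    by (auto simp: integral_unique)
  have eq: "2 powr b * (\<bar>sin t / 2\<bar> *\<^sub>R f (g t)) = sin t powr b" if "t \<in> {0..pi}" for t
  proof (cases "sin t = 0")
    case False
    with that have s: "sin t > 0" using sin_ge_zero[of t] by auto
    have "g t * (1 - g t) = (1 - (cos t)^2) / 4"
      unfolding g_def by (simp add: field_simps power2_eq_square)
    then have "g t * (1 - g t) = (sin t / 2)^2"
      by (simp add: sin_squared_eq power_divide)
    moreover have "0 \<le> g t" "g t \<le> 1" using cos_ge_minus_one[of t] by (simp_all add: g_def)
    ultimately have "f (g t) = ((sin t / 2)^2) powr (a-1)"
      unfolding f_def by (subst powr_mult[symmetric]) auto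
    also have "\<dots> = (sin t / 2) powr (2 * (a-1))"
      using s powr_powr[of "sin t / 2" 2 "a-1"] by simp
    finally have "\<bar>sin t / 2\<bar> *\<^sub>R f (g t) = (sin t / 2) powr 1 * (sin t / 2) powr (2 * (a-1))" using s by simp
    also have "\<dots> = (sin t / 2) powr b" by (subst powr_add[symmetric]) (simp add: a_def field_simps)
    also have "\<dots> = sin t powr b / 2 powr b" using s by (simp add: powr_divide)
    finally show ?thesis by simp
  qed auto
  have "(\<lambda>t. 2 powr b * (\<bar>sin t / 2\<bar> *\<^sub>R f (g t))) absolutely_integrable_on {0..pi}"
    using * by (intro set_integrable_mult_right) auto
  then show "(\<lambda>t. sin t powr b) absolutely_integrable_on {0..pi}"
    by (rule absolutely_integrable_spike[OF _ negligible_empty]) (use eq in auto)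
  have "integral {0..pi} (\<lambda>t. sin t powr b) = integral {0..pi} (\<lambda>t. 2 powr b * (\<bar>sin t / 2\<bar> *\<^sub>R f (g t)))"
    using eq by (intro integral_cong) auto
  also have "\<dots> = 2 powr b * Beta a a" using * by simp
  also have "\<dots> = sqrt pi * Gamma ((b+1)/2) / Gamma (1 + b/2)"
  proof -
    have "complex_of_real (Gamma a * Gamma (a + 1/2)) = of_real (2 powr (1 - 2*a) * sqrt pi * Gamma (2*a))"
    proof -
      have "Gamma (complex_of_real a) * Gamma (of_real a + 1/2) = exp ((1 - 2 * of_real a) * of_real (ln 2)) * of_real (sqrt pi) * Gamma (2 * of_real a)"
        by (rule Gamma_legendre_duplication) (use a in \<open>auto elim!: nonpos_Ints_cases simp: complex_eq_iff\<close>)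
      moreover have "exp ((1 - 2 * complex_of_real a) * of_real (ln 2)) = of_real (2 powr (1-2*a))"
        by (simp add: powr_def exp_of_real[symmetric])
      moreover have "Gamma (of_real a + 1/2 :: complex) = of_real (Gamma (a + 1/2))"
        using Gamma_complex_of_real[of "a + 1/2"] by simp
      moreover have "Gamma (2 * of_real a :: complex) = of_real (Gamma (2*a))"
        using Gamma_complex_of_real[of "2*a"] by simp
      ultimately show ?thesis by (simp add: Gamma_complex_of_real)
    qed
    then have d: "Gamma a * Gamma (a + 1/2) = 2 powr (1 - 2*a) * sqrt pi * Gamma (2*a)"
      using of_real_eq_iff by blast
    have p: "2 powr (1 - 2*a) * 2 powr b = 1" by (subst powr_add[symmetric]) (simp add: a_def field_simps)
    have nz: "Gamma (2*a) \<noteq> 0" "Gamma (a+1/2) \<noteq> 0" using a by (auto intro!: Gamma_real_pos less_imp_neq[symmetric])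
    have "2 powr b * Beta a a = 2 powr b * (Gamma a * Gamma a) / Gamma (2*a)" by (simp add: Beta_def)
    also have "\<dots> = sqrt pi * Gamma a / Gamma (a+1/2)"
    proof -
      have "2 powr b * (Gamma a * Gamma a) * Gamma (a+1/2) = (2 powr (1 - 2*a) * 2 powr b) * sqrt pi * Gamma a * Gamma (2*a)"
        using d by (simp add: algebra_simps)
      then show ?thesis unfolding p using nz by (simp add: frac_eq_eq mult_ac)
    qed
    finally show ?thesis by (simp add: a_def add_divide_distrib add.commute)
  qed
  finally show "integral {0..pi} (\<lambda>t. sin t powr b) = sqrt pi * Gamma ((b+1)/2) / Gamma (1 + b/2)" .
qed


lemma has_vector_derivative_cis_mult:
  "((\<lambda>t. cis (c * t)) has_vector_derivative (\<i> * of_real c * cis (c * t))) (at t within S)"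
  unfolding has_vector_derivative_def
  by (rule derivative_eq_intros refl)+ (auto simp: scaleR_conv_of_real algebra_simps)

lemma absolutely_integrable_mult_continuous:
  fixes f :: "real \<Rightarrow> 'a :: {euclidean_space, real_normed_algebra}"
  assumes "continuous_on {a..b} f" "g absolutely_integrable_on {a..b}"
  shows "(\<lambda>x. f x * g x) absolutely_integrable_on {a..b}"
proof (rule absolutely_integrable_bounded_measurable_product[where h="(*)" and f=f and g=g])
  show "bilinear ((*) :: 'a \<Rightarrow> 'a \<Rightarrow> 'a)" by (rule bilinear_times)
  show "f \<in> borel_measurable (lebesgue_on {a..b})"
    using assms(1) by (intro continuous_imp_measurable_on_sets_lebesgue) auto
  show "bounded (f ` {a..b})"
    using assms(1) by (intro compact_imp_bounded compact_continuous_image) auto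
qed (use assms in auto)

lemma absolutely_integrable_of_real:
  fixes g :: "real \<Rightarrow> real"
  assumes "g absolutely_integrable_on S"
  shows "(\<lambda>x. complex_of_real (g x)) absolutely_integrable_on S"
  using absolutely_integrable_linear[OF assms, of complex_of_real] bounded_linear_of_real
  by (simp add: o_def)

text \<open>The Fourier coefficient of \<open>sin t powr b\<close> on \<open>[0, \<pi>]\<close> at an arbitrary integer frequency.  All
  series coefficients below are built from this family: even frequencies are those of
  \<open>\<pi>\<close>-periodic functions, odd ones appear when \<open>k\<close> is odd.\<close>

definition sin_moment :: "real \<Rightarrow> int \<Rightarrow> complex" where
  "sin_moment b m = integral {0..pi} (\<lambda>t. of_real (sin t powr b) * cis (of_int m * t))"

lemma absolutely_integrable_sin_powr_cis:
  assumes "b > -1"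
  shows "(\<lambda>t. complex_of_real (sin t powr b) * cis (c * t)) absolutely_integrable_on {0..pi}"
proof -
  have "(\<lambda>t. cis (c * t) * complex_of_real (sin t powr b)) absolutely_integrable_on {0..pi}"
    by (intro absolutely_integrable_mult_continuous absolutely_integrable_of_real sin_powr_integral assms continuous_intros)
  then show ?thesis by (simp add: mult.commute)
qed

lemma sin_moment_has_integral:
  assumes "b > -1"
  shows "((\<lambda>t. of_real (sin t powr b) * cis (of_int m * t)) has_integral sin_moment b m) {0..pi}"
  unfolding sin_moment_def
  using absolutely_integrable_sin_powr_cis[OF assms] absolutely_integrable_on_def integrable_integral by blast

lemma has_vector_derivative_sin_powr_cis:
  assumes "t \<in> {0<..<pi}"
  shows "((\<lambda>t. complex_of_real (sin t powr b) * cis (c * t)) has_vector_derivative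
            of_real (b * sin t powr (b-1) * cos t) * cis (c * t) + of_real (sin t powr b) * (\<i> * of_real c * cis (c * t))) (at t within S)"
proof -
  have s: "sin t > 0" using assms by (auto intro: sin_gt_zero)
  have "((\<lambda>t. sin t powr b) has_field_derivative (b * sin t powr (b-1) * cos t)) (at t within S)"
    using s by (auto intro!: derivative_eq_intros simp: field_simps powr_diff)
  then have "((\<lambda>t. complex_of_real (sin t powr b)) has_vector_derivative of_real (b * sin t powr (b-1) * cos t)) (at t within S)"
    unfolding has_real_derivative_iff_has_vector_derivative
    by (rule bounded_linear.has_vector_derivative[OF bounded_linear_of_real])
  from has_vector_derivative_mult[OF this has_vector_derivative_cis_mult]
  show ?thesis by (simp add: add.commute)
qed

lemma continuous_on_sin_powr:
  "b > 0 \<Longrightarrow> continuous_on {0..pi} (\<lambda>t. sin t powr b)"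
  by (intro continuous_on_powr' continuous_intros) (auto intro: sin_ge_zero)

text \<open>The primitive \<open>sin t powr (b + 1) * cis (m * t)\<close> vanishes at both ends because \<open>b + 1 > 0\<close>, so
  there is no boundary term although the integrand itself may blow up there.\<close>

lemma sin_moment_parts:
  assumes "b > -1"
  shows "((\<lambda>t. of_real ((b+1) * sin t powr b * cos t) * cis (of_int m * t)) has_integral
           - \<i> * of_int m * sin_moment (b+1) m) {0..pi}"
proof -
  let ?F = "\<lambda>t. complex_of_real (sin t powr (b+1)) * cis (of_int m * t)"
  have "((\<lambda>t. of_real ((b+1) * sin t powr b * cos t) * cis (of_int m * t) + of_real (sin t powr (b+1)) * (\<i> * of_int m * cis (of_int m * t)))
      has_integral (?F pi - ?F 0)) {0..pi}"
  proof (rule fundamental_theorem_of_calculus_interior)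
    show "continuous_on {0..pi} ?F"
      using assms by (intro continuous_intros continuous_on_sin_powr) auto
    show "(?F has_vector_derivative of_real ((b+1) * sin t powr b * cos t) * cis (of_int m * t) + of_real (sin t powr (b+1)) * (\<i> * of_int m * cis (of_int m * t))) (at t)"
      if "t \<in> {0<..<pi}" for t
      using has_vector_derivative_sin_powr_cis[OF that, of "b+1" "of_int m"] by simp
  qed auto
  moreover have "((\<lambda>t. \<i> * of_int m * (of_real (sin t powr (b+1)) * cis (of_int m * t))) has_integral \<i> * of_int m * sin_moment (b+1) m) {0..pi}"
    by (intro has_integral_mult_right sin_moment_has_integral) (use assms in auto)
  ultimately have "((\<lambda>t. (of_real ((b+1) * sin t powr b * cos t) * cis (of_int m * t) + of_real (sin t powr (b+1)) * (\<i> * of_int m * cis (of_int m * t)))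
       - \<i> * of_int m * (of_real (sin t powr (b+1)) * cis (of_int m * t))) has_integral (?F pi - ?F 0) - \<i> * of_int m * sin_moment (b+1) m) {0..pi}"
    by (rule has_integral_diff)
  then show ?thesis by (simp add: mult_ac)
qed

lemma cos_cis: "complex_of_real (cos t) = (cis t + cis (-t)) / 2"
  and sin_cis: "complex_of_real (sin t) = (cis t - cis (-t)) / (2 * \<i>)"
  by (auto simp: complex_eq_iff)

text \<open>Both \<open>cos\<close> and \<open>sin\<close> shift the frequency by \<open>\<plusminus> 1\<close>.  Writing integration by parts at the
  middle frequency \<open>m + 1\<close> in terms of the two neighbours leaves a two-term recurrence.\<close>

lemma sin_moment_step:
  assumes "b > -1"
  shows "of_real (b + 2 + of_int m) * sin_moment b (m+2) = of_real (of_int m - b) * sin_moment b m"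
proof -
  let ?e = "\<lambda>j t. complex_of_real (sin t powr b) * cis (of_int j * t)"
  have cis_step: "cis (of_int (m+2) * t) = cis t * cis (of_int (m+1) * t)" "cis (of_int m * t) = cis (-t) * cis (of_int (m+1) * t)" for t
    by (simp_all add: cis_mult algebra_simps)
  note I = sin_moment_has_integral[OF assms]
  have A: "((\<lambda>t. of_real (b+1) * ((?e (m+2) t + ?e m t) / 2)) has_integral
          of_real (b+1) * ((sin_moment b (m+2) + sin_moment b m) / 2)) {0..pi}"
    by (intro has_integral_mult_right has_integral_divide has_integral_add I)
  have B: "((\<lambda>t. (?e (m+2) t - ?e m t) / (2*\<i>)) has_integral
          ((sin_moment b (m+2) - sin_moment b m) / (2*\<i>))) {0..pi}"
    by (intro has_integral_divide has_integral_diff I)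
  have "((\<lambda>t. of_real ((b+1) * sin t powr b * cos t) * cis (of_int (m+1) * t)) has_integral
          of_real (b+1) * ((sin_moment b (m+2) + sin_moment b m) / 2)) {0..pi}"
    proof (rule has_integral_eq[OF _ A])
    fix t
    show "of_real (b+1) * ((?e (m+2) t + ?e m t) / 2) = of_real ((b+1) * sin t powr b * cos t) * cis (of_int (m+1) * t)"
      unfolding cis_step by (simp add: cos_cis field_simps)
  qed
  with sin_moment_parts[OF assms, of "m+1"]
  have 1: "- \<i> * of_int (m+1) * sin_moment (b+1) (m+1) = of_real (b+1) * ((sin_moment b (m+2) + sin_moment b m) / 2)"
    by (rule has_integral_unique)
  have "((\<lambda>t. of_real (sin t powr (b+1)) * cis (of_int (m+1) * t)) has_integral
          ((sin_moment b (m+2) - sin_moment b m) / (2*\<i>))) {0..pi}"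
  proof (rule has_integral_eq[OF _ B])
    fix t assume "t \<in> {0..pi}"
    then have "sin t \<ge> 0" by (auto intro: sin_ge_zero)
    then have "sin t powr (b+1) = sin t powr b * sin t" by (simp add: powr_add)
    then show "(?e (m+2) t - ?e m t) / (2*\<i>) = of_real (sin t powr (b+1)) * cis (of_int (m+1) * t)"
      unfolding cis_step by (simp add: sin_cis field_simps)
  qed
  moreover have "((\<lambda>t. of_real (sin t powr (b+1)) * cis (of_int (m+1) * t)) has_integral sin_moment (b+1) (m+1)) {0..pi}"
    by (rule sin_moment_has_integral) (use assms in auto)
  ultimately have 2: "sin_moment (b+1) (m+1) = (sin_moment b (m+2) - sin_moment b m) / (2*\<i>)"
    using has_integral_unique by blast
  have 3: "\<i> * sin_moment (b+1) (m+1) = (sin_moment b (m+2) - sin_moment b m) / 2"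
    unfolding 2 by (simp add: field_simps)
  have "- of_int (m+1) * (\<i> * sin_moment (b+1) (m+1)) = of_real (b+1) * ((sin_moment b (m+2) + sin_moment b m) / 2)"
    using 1 by (simp add: algebra_simps)
  from this[unfolded 3] have "2 * (of_real (b + 2 + of_int m) * sin_moment b (m+2)) = 2 * (of_real (of_int m - b) * sin_moment b m)"
    by (simp add: field_simps)
  then show ?thesis by simp
qed

text \<open>The reflection \<open>t \<mapsto> \<pi> - t\<close> fixes \<open>sin\<close> and maps frequency \<open>m\<close> to \<open>- m\<close> up to the sign
  \<open>cis (m * \<pi>)\<close>.  This is the origin of the absolute values, and for odd \<open>k\<close> of the sign factor, in
  the final series.\<close>

lemma sin_moment_minus:
  assumes "b > -1"
  shows "sin_moment b (-m) = (if even m then 1 else -1) * sin_moment b m"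
proof -
  have "((\<lambda>t. of_real (sin t powr b) * cis (of_int m * t)) has_integral sin_moment b m) {0..pi}"
    by (rule sin_moment_has_integral[OF assms])
  then have "((\<lambda>t. of_real (sin (-t) powr b) * cis (of_int m * -t)) has_integral sin_moment b m) {-pi..-0}"
    by (subst has_integral_reflect_real)
  then have "((\<lambda>t. of_real (sin (-(t + (-pi))) powr b) * cis (of_int m * -(t + (-pi)))) has_integral sin_moment b m) {-pi-(-pi)..-0-(-pi)}"
    by (rule has_integral_shift_real_ivl)
  then have "((\<lambda>t. (if even m then 1 else -1) * (of_real (sin (-(t + (-pi))) powr b) * cis (of_int m * -(t + (-pi))))) has_integral
       (if even m then 1 else -1) * sin_moment b m) {0..pi}"
    by (intro has_integral_mult_right) auto
  moreover have "(if even m then 1 else -1) * (of_real (sin (-(t + (-pi))) powr b) * cis (of_int m * -(t + (-pi)))) =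
      of_real (sin t powr b) * cis (of_int (-m) * t)" for t
  proof -
    have "cis (of_int m * -(t + (-pi))) = cis (of_int (-m) * t) * cis (pi * of_int m)"
      by (simp add: cis_mult algebra_simps)
    moreover have "cis (pi * of_int m) = (if even m then 1 else -1)"
      using cos_npi_int[of m] sin_npi_int[of m] by (auto simp: complex_eq_iff cis.ctr)
    moreover have "sin (-(t + (-pi))) = sin t" by (simp add: sin_diff)
    ultimately show ?thesis by auto
  qed
  ultimately have "((\<lambda>t. of_real (sin t powr b) * cis (of_int (-m) * t)) has_integral (if even m then 1 else -1) * sin_moment b m) {0..pi}"
    by (simp only:)
  with sin_moment_has_integral[OF assms, of "-m"] show ?thesis by (rule has_integral_unique)
qed

lemma sin_moment_0:
  assumes "b > -1"
  shows "sin_moment b 0 = of_real (sqrt pi * Gamma ((b+1)/2) / Gamma (1 + b/2))"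
proof -
  have "((\<lambda>t. sin t powr b) has_integral (sqrt pi * Gamma ((b+1)/2) / Gamma (1 + b/2))) {0..pi}"
    using sin_powr_integral[OF assms] by (metis absolutely_integrable_on_def integrable_integral)
  then have "((\<lambda>t. complex_of_real (sin t powr b)) has_integral of_real (sqrt pi * Gamma ((b+1)/2) / Gamma (1 + b/2))) {0..pi}"
    by (rule has_integral_of_real)
  then show ?thesis
    unfolding sin_moment_def by (simp add: integral_unique)
qed

text \<open>The real part vanishes, being the integral of a derivative, and the imaginary part is the
  zeroth moment of exponent \<open>b + 1\<close>.\<close>

lemma sin_moment_1:
  assumes "b > -1"
  shows "sin_moment b 1 = \<i> * of_real (sqrt pi * Gamma (1 + b/2) / Gamma ((b+3)/2))"
proof -
  have "((\<lambda>t. complex_of_real ((b+1) * sin t powr b * cos t)) has_integral 0) {0..pi}"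
    using sin_moment_parts[OF assms, of 0] by simp
  then have "((\<lambda>t. complex_of_real ((b+1) * sin t powr b * cos t) / of_real (b+1)) has_integral 0 / complex_of_real (b+1)) {0..pi}"
    by (rule has_integral_divide)
  moreover have "complex_of_real (b+1) \<noteq> 0" using assms by (subst of_real_eq_0_iff) auto
  ultimately have c: "((\<lambda>t. complex_of_real (sin t powr b * cos t)) has_integral 0) {0..pi}"
    by (simp add: mult.assoc del: of_real_add)
  have s: "((\<lambda>t. complex_of_real (sin t powr (b+1))) has_integral sin_moment (b+1) 0) {0..pi}"
    using sin_moment_has_integral[of "b+1" 0] assms by simp
  have "((\<lambda>t. complex_of_real (sin t powr b * cos t) + \<i> * complex_of_real (sin t powr (b+1))) has_integral 0 + \<i> * sin_moment (b+1) 0) {0..pi}"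
    by (intro has_integral_add c has_integral_mult_right s)
  moreover have "of_real (sin t powr b) * cis (of_int 1 * t) = complex_of_real (sin t powr b * cos t) + \<i> * complex_of_real (sin t powr (b+1))"
    if "t \<in> {0..pi}" for t
  proof -
    have "sin t \<ge> 0" using that by (auto intro: sin_ge_zero)
    then show ?thesis by (simp add: powr_add complex_eq_iff)
  qed
  ultimately have "((\<lambda>t. of_real (sin t powr b) * cis (of_int 1 * t)) has_integral 0 + \<i> * sin_moment (b+1) 0) {0..pi}"
    using has_integral_eq by (metis (no_types, lifting))
  with sin_moment_has_integral[OF assms, of 1] have "sin_moment b 1 = 0 + \<i> * sin_moment (b+1) 0" by (rule has_integral_unique)
  moreover have "sin_moment (b+1) 0 = of_real (sqrt pi * Gamma (1 + b/2) / Gamma ((b+3)/2))"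
    using sin_moment_0[of "b+1"] assms by (simp add: field_simps)
  ultimately show ?thesis by simp
qed

text \<open>The solution of the recurrence of the moments as a function of the real variable \<open>p = m / 2\<close>;
  half-integers \<open>p\<close> serve the odd frequencies.\<close>

definition gamma_ratio :: "real \<Rightarrow> real \<Rightarrow> real" where
  "gamma_ratio b p = Gamma (p - b/2) / Gamma (p + 1 + b/2)"

lemma gamma_ratio_step:
  assumes "p \<ge> 0" "b > -1" "p - b/2 \<notin> \<int>\<^sub>\<le>\<^sub>0"
  shows "(b + 2 + 2*p) * gamma_ratio b (p+1) = (2*p - b) * gamma_ratio b p"
proof -
  have 1: "Gamma (p + 1 - b/2) = (p - b/2) * Gamma (p - b/2)"
    using Gamma_plus1[OF assms(3)] by (simp add: algebra_simps)
  have pos: "p + 1 + b/2 > 0" using assms by auto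
  then have "p + 1 + b/2 \<notin> \<int>\<^sub>\<le>\<^sub>0" by (auto elim!: nonpos_Ints_cases)
  from Gamma_plus1[OF this] have 2: "Gamma (p + 1 + 1 + b/2) = (p + 1 + b/2) * Gamma (p + 1 + b/2)"
    by (simp add: add_ac)
  have 3: "Gamma (p + 1 + b/2) \<noteq> 0" using Gamma_real_pos[OF pos] by simp
  have "(b + 2 + 2*p) * (X / ((p + 1 + b/2) * Y)) = 2 * (X / Y)" for X Y
  proof -
    have "b + 2 + 2*p = 2 * (p + 1 + b/2)" by simp
    then show ?thesis using pos by (simp only: times_divide_eq_right mult.assoc) simp
  qed
  moreover have "2 * ((p - b/2) * X / Y) = (2*p - b) * (X / Y)" for X Y
    by (simp add: diff_divide_distrib algebra_simps)
  ultimately show ?thesis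
    unfolding gamma_ratio_def 1 2 by simp
qed

text \<open>Moments and Gamma quotients obey the same first-order recurrence in steps of \<open>2\<close>, so they
  are proportional on each parity class \<open>\<delta>\<close>.  Stating the proportionality without division lets the
  induction run before the initial quotient is known to be nonzero.\<close>

lemma sin_moment_gamma_ratio:
  assumes b: "b > -1" and ni: "(of_int \<delta> - b)/2 \<notin> \<int>\<^sub>\<le>\<^sub>0" and d: "\<delta> \<in> {0, 1}"
  shows "sin_moment b (2 * int n + \<delta>) * of_real (gamma_ratio b (of_int \<delta> / 2)) =
         sin_moment b \<delta> * of_real (gamma_ratio b (of_nat n + of_int \<delta> / 2))"
proof (induction n)
  case (Suc n)
  let ?p = "of_nat n + of_int \<delta> / 2 :: real"
  let ?m = "2 * int n + \<delta>"
  have ni': "?p - b/2 \<notin> \<int>\<^sub>\<le>\<^sub>0"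
  proof
    assume "?p - b/2 \<in> \<int>\<^sub>\<le>\<^sub>0"
    then obtain j where "?p - b/2 = - of_nat j" by (elim nonpos_Ints_cases')
    then have "(of_int \<delta> - b)/2 = - of_nat (j + n)" by (simp add: field_simps)
    with ni show False by (metis minus_of_nat_in_nonpos_Ints)
  qed
  have st: "of_real (b + 2 + of_int ?m) * sin_moment b (?m+2) = of_real (of_int ?m - b) * sin_moment b ?m"
    by (rule sin_moment_step[OF b])
  have gr: "(b + 2 + 2 * ?p) * gamma_ratio b (?p+1) = (2 * ?p - b) * gamma_ratio b ?p"
    by (rule gamma_ratio_step) (use b d ni' in auto)
  have e: "2 * ?p = of_int ?m" by simp
  have nz: "b + 2 + of_int ?m \<noteq> 0" using b d by auto
  have "complex_of_real (b + 2 + of_int ?m) * (sin_moment b (?m+2) * of_real (gamma_ratio b (of_int \<delta> / 2)))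
      = of_real (of_int ?m - b) * (sin_moment b ?m * of_real (gamma_ratio b (of_int \<delta> / 2)))"
    using st by (metis mult.assoc)
  also have "\<dots> = sin_moment b \<delta> * of_real ((of_int ?m - b) * gamma_ratio b ?p)"
    unfolding Suc.IH by simp
  also have "(of_int ?m - b) * gamma_ratio b ?p = (b + 2 + of_int ?m) * gamma_ratio b (?p+1)"
    using gr unfolding e by simp
  finally have "complex_of_real (b + 2 + of_int ?m) * (sin_moment b (?m+2) * of_real (gamma_ratio b (of_int \<delta> / 2)))
      = complex_of_real (b + 2 + of_int ?m) * (sin_moment b \<delta> * of_real (gamma_ratio b (?p+1)))" by simp
  with nz have "sin_moment b (?m+2) * of_real (gamma_ratio b (of_int \<delta> / 2)) = sin_moment b \<delta> * of_real (gamma_ratio b (?p+1))"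
    using of_real_eq_0_iff mult_left_cancel by blast
  moreover have "?m + 2 = 2 * int (Suc n) + \<delta>" "?p + 1 = of_nat (Suc n) + of_int \<delta> / 2" by auto
  ultimately show ?case by simp
qed auto

lemma gamma_ratio_nonzero:
  assumes "p \<ge> 0" "b > -1" "p - b/2 \<notin> \<int>\<^sub>\<le>\<^sub>0"
  shows "gamma_ratio b p \<noteq> 0"
proof -
  have "p + 1 + b/2 \<notin> \<int>\<^sub>\<le>\<^sub>0" using assms by (auto elim!: nonpos_Ints_cases)
  then show ?thesis using assms(3) by (simp add: gamma_ratio_def Gamma_eq_zero_iff)
qed

text \<open>The denominator \<open>Gamma (1 + b/2)\<close> of the zeroth moment cancels against that of
  \<open>gamma_ratio b 0\<close>.\<close>

lemma even_sin_moment: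
  assumes b: "b > -1" and n: "- b/2 \<notin> \<int>\<^sub>\<le>\<^sub>0"
  shows "sin_moment b (2 * l) = of_real (sqrt pi * Gamma ((b+1)/2) / Gamma (- b/2) * gamma_ratio b \<bar>of_int l\<bar>)"
proof -
  have nz: "gamma_ratio b 0 \<noteq> 0" by (rule gamma_ratio_nonzero) (use b n in auto)
  have sm: "sin_moment b (2 * l) = sin_moment b (2 * int (nat \<bar>l\<bar>) + 0)"
  proof (cases "l \<ge> 0")
    case False
    then have "2 * l = - (2 * int (nat \<bar>l\<bar>) + 0)" by simp
    then show ?thesis using sin_moment_minus[OF b, of "2 * int (nat \<bar>l\<bar>) + 0"] by (simp only:) simp
  qed simp
  have "sin_moment b (2 * int (nat \<bar>l\<bar>) + 0) * of_real (gamma_ratio b (of_int 0 / 2)) =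
         sin_moment b 0 * of_real (gamma_ratio b (of_nat (nat \<bar>l\<bar>) + of_int 0 / 2))"
    by (rule sin_moment_gamma_ratio[OF b]) (use n in auto)
  then have "sin_moment b (2 * l) * of_real (gamma_ratio b 0) = sin_moment b 0 * of_real (gamma_ratio b \<bar>of_int l\<bar>)"
    unfolding sm by simp
  then have "sin_moment b (2 * l) = sin_moment b 0 * of_real (gamma_ratio b \<bar>of_int l\<bar>) / of_real (gamma_ratio b 0)"
    using nz by (simp add: eq_divide_eq)
  also have "\<dots> = of_real (sqrt pi * Gamma ((b+1)/2) / Gamma (1 + b/2) * gamma_ratio b \<bar>of_int l\<bar> / gamma_ratio b 0)"
    unfolding sin_moment_0[OF b] by simp
  also have "sqrt pi * Gamma ((b+1)/2) / Gamma (1 + b/2) * gamma_ratio b \<bar>of_int l\<bar> / gamma_ratio b 0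
      = sqrt pi * Gamma ((b+1)/2) / Gamma (- b/2) * gamma_ratio b \<bar>of_int l\<bar>"
  proof -
    have "Gamma (1 + b/2) \<noteq> 0" using b by (intro less_imp_neq[symmetric] Gamma_real_pos) auto
    then show ?thesis by (simp add: gamma_ratio_def[of b 0])
  qed
  finally show ?thesis .
qed

lemma odd_sin_moment:
  assumes b: "b > -1" and n: "(1 - b)/2 \<notin> \<int>\<^sub>\<le>\<^sub>0" and m: "odd m"
  shows "sin_moment b m = \<i> * of_real (sqrt pi * Gamma (1 + b/2) / Gamma ((1 - b)/2) * of_int (sgn m) * gamma_ratio b (\<bar>of_int m\<bar> / 2))"
proof -
  define n where "n = nat ((\<bar>m\<bar> - 1) div 2)"
  have mn: "\<bar>m\<bar> = 2 * int n + 1" using m by (simp add: n_def) presburger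
  have e1: "1/2 - b/2 = (1 - b)/2" by (simp add: diff_divide_distrib)
  have e2: "1/2 + 1 + b/2 = (b+3)/2" by (simp add: add_divide_distrib)
  have "1/2 - b/2 \<notin> \<int>\<^sub>\<le>\<^sub>0" unfolding e1 by (rule assms(2))
  then have nz: "gamma_ratio b (1/2) \<noteq> 0" using b by (intro gamma_ratio_nonzero) auto
  have sm: "sin_moment b m = of_int (sgn m) * sin_moment b (2 * int n + 1)"
  proof (cases "m \<ge> 0")
    case True
    then have "sgn m = 1" "m = 2 * int n + 1" using mn m by (auto simp: sgn_if)
    then show ?thesis by simp
  next
    case False
    then have "sgn m = -1" "m = - (2 * int n + 1)" using mn by (auto simp: sgn_if)
    then show ?thesis using sin_moment_minus[OF b, of "2 * int n + 1"] by simp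
  qed
  have "sin_moment b (2 * int n + 1) * of_real (gamma_ratio b (of_int 1 / 2)) =
         sin_moment b 1 * of_real (gamma_ratio b (of_nat n + of_int 1 / 2))"
    by (rule sin_moment_gamma_ratio[OF b]) (use assms(2) in auto)
  moreover have "real n + 1 / 2 = \<bar>of_int m\<bar> / 2"
  proof -
    have "\<bar>of_int m\<bar> = (of_int \<bar>m\<bar> :: real)" by simp
    then show ?thesis unfolding mn by simp
  qed
  ultimately have "sin_moment b (2 * int n + 1) * of_real (gamma_ratio b (1/2)) = sin_moment b 1 * of_real (gamma_ratio b (\<bar>of_int m\<bar> / 2))"
    by (simp only: of_int_1)
  then have "sin_moment b (2 * int n + 1) = sin_moment b 1 * of_real (gamma_ratio b (\<bar>of_int m\<bar> / 2)) / of_real (gamma_ratio b (1/2))"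
    using nz by (simp add: eq_divide_eq)
  also have "\<dots> = \<i> * of_real (sqrt pi * Gamma (1 + b/2) / Gamma ((b+3)/2) * gamma_ratio b (\<bar>of_int m\<bar> / 2) / gamma_ratio b (1/2))"
    unfolding sin_moment_1[OF b] by simp
  also have "sqrt pi * Gamma (1 + b/2) / Gamma ((b+3)/2) * gamma_ratio b (\<bar>of_int m\<bar> / 2) / gamma_ratio b (1/2)
      = sqrt pi * Gamma (1 + b/2) / Gamma ((1 - b)/2) * gamma_ratio b (\<bar>of_int m\<bar> / 2)"
  proof -
    have "Gamma ((b+3)/2) \<noteq> 0" using b by (intro less_imp_neq[symmetric] Gamma_real_pos) auto
    then show ?thesis unfolding gamma_ratio_def[of b "1/2"] e1 e2 by simp
  qed
  finally show ?thesis unfolding sm by simp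
qed

section \<open>Absolutely convergent Fourier series on the interval from 0 to pi\<close>

text \<open>Orthogonality of the exponentials of even frequency on an interval of length \<open>\<pi>\<close>.\<close>

lemma integral_cis_even:
  "((\<lambda>t. cis (of_int (2*l) * t)) has_integral (if l = 0 then of_real pi else 0)) {0..pi}"
proof (cases "l = 0")
  case True
  then show ?thesis using has_integral_const_real[of "1::complex" 0 pi] by (simp add: scaleR_conv_of_real)
next
  case False
  let ?F = "\<lambda>t. cis (of_int (2*l) * t) / (\<i> * of_int (2*l))"
  have "((\<lambda>t. cis (of_int (2*l) * t)) has_integral (?F pi - ?F 0)) {0..pi}"
  proof (rule fundamental_theorem_of_calculus)
    fix t :: real assume "t \<in> {0..pi}"
    show "(?F has_vector_derivative cis (of_int (2*l) * t)) (at t within {0..pi})"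
      unfolding has_vector_derivative_def using False
      by (auto intro!: derivative_eq_intros simp: scaleR_conv_of_real field_simps)
  qed auto
  moreover have "cis (of_int (2*l) * pi) = 1"
    using cis_multiple_2pi[of "of_int l"] by (simp add: mult_ac)
  ultimately show ?thesis using False by simp
qed

text \<open>Not divided by the length \<open>\<pi>\<close> of the interval.  Only even frequencies occur, as \<open>\<pi>\<close> is the period.\<close>

definition fourier_coeff :: "(real \<Rightarrow> complex) \<Rightarrow> int \<Rightarrow> complex" where
  "fourier_coeff g l = integral {0..pi} (\<lambda>t. g t * cis (of_int (2 * - l) * t))"

lemma fourier_coeff_has_integral:
  assumes "continuous_on {0..pi} g"
  shows "((\<lambda>t. g t * cis (of_int (2 * - l) * t)) has_integral fourier_coeff g l) {0..pi}"
  unfolding fourier_coeff_def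
  by (intro integrable_integral integrable_continuous_interval continuous_intros assms)

text \<open>Bessel's inequality: the mean square of \<open>g\<close> minus its orthogonal projection is nonnegative.\<close>

lemma fourier_bessel:
  assumes g: "continuous_on {0..pi} g" and F: "finite F"
  shows "(\<Sum>l\<in>F. (norm (fourier_coeff g l))\<^sup>2) \<le> pi * integral {0..pi} (\<lambda>t. (norm (g t))\<^sup>2)"
proof -
  let ?e = "\<lambda>l t. cis (of_int (2 * l) * t)"
  define b where "b = fourier_coeff g"
  define c where "c = (\<lambda>l. b l / of_real pi)"
  define P where "P = (\<lambda>t. \<Sum>l\<in>F. c l * ?e l t)"
  define G where "G = integral {0..pi} (\<lambda>t. (norm (g t))\<^sup>2)"
  have hG: "((\<lambda>t. (norm (g t))\<^sup>2) has_integral G) {0..pi}"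
    unfolding G_def by (intro integrable_integral integrable_continuous_interval continuous_intros g)
  have hb: "((\<lambda>t. g t * ?e (-l) t) has_integral b l) {0..pi}" for l
    unfolding b_def by (rule fourier_coeff_has_integral[OF g])
  have hbc: "((\<lambda>t. cnj (g t) * ?e l t) has_integral cnj (b l)) {0..pi}" for l
    using hb[of l] has_integral_cnj[of "\<lambda>t. g t * ?e (-l) t"] by (simp add: o_def cis_cnj)
  have "((\<lambda>t. of_real ((norm (g t))\<^sup>2) - (\<Sum>l\<in>F. cnj (c l) * (g t * ?e (-l) t)) - (\<Sum>l\<in>F. c l * (cnj (g t) * ?e l t))
            + (\<Sum>l\<in>F. \<Sum>j\<in>F. c l * cnj (c j) * ?e (l - j) t)) has_integral
         (of_real G - (\<Sum>l\<in>F. cnj (c l) * b l) - (\<Sum>l\<in>F. c l * cnj (b l))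
            + (\<Sum>l\<in>F. \<Sum>j\<in>F. c l * cnj (c j) * (if l - j = 0 then of_real pi else 0)))) {0..pi}"
    by (intro has_integral_add has_integral_diff has_integral_sum F has_integral_mult_right hb hbc has_integral_of_real hG integral_cis_even)
  moreover have "of_real ((norm (g t))\<^sup>2) - (\<Sum>l\<in>F. cnj (c l) * (g t * ?e (-l) t)) - (\<Sum>l\<in>F. c l * (cnj (g t) * ?e l t))
            + (\<Sum>l\<in>F. \<Sum>j\<in>F. c l * cnj (c j) * ?e (l - j) t) = of_real ((norm (g t - P t))\<^sup>2)" for t
  proof -
    have "of_real ((norm (g t - P t))\<^sup>2) = (g t - P t) * cnj (g t - P t)"
      by (rule complex_norm_square)
    also have "\<dots> = g t * cnj (g t) - g t * cnj (P t) - P t * cnj (g t) + P t * cnj (P t)"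
      by (simp add: algebra_simps)
    also have "g t * cnj (g t) = of_real ((norm (g t))\<^sup>2)" by (rule complex_norm_square[symmetric])
    also have "g t * cnj (P t) = (\<Sum>l\<in>F. cnj (c l) * (g t * ?e (-l) t))"
      by (simp add: P_def sum_distrib_left cis_cnj mult_ac)
    also have "P t * cnj (g t) = (\<Sum>l\<in>F. c l * (cnj (g t) * ?e l t))"
      by (simp add: P_def sum_distrib_right sum_distrib_left mult_ac)
    also have "P t * cnj (P t) = (\<Sum>l\<in>F. \<Sum>j\<in>F. c l * cnj (c j) * ?e (l - j) t)"
    proof -
      have "?e (l - j) t = ?e l t * cnj (?e j t)" for l j
        by (simp add: cis_cnj cis_mult algebra_simps)
      then show ?thesis by (simp add: P_def sum_product mult_ac)
    qed
    finally show ?thesis by simp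
  qed
  moreover have "of_real G - (\<Sum>l\<in>F. cnj (c l) * b l) - (\<Sum>l\<in>F. c l * cnj (b l))
            + (\<Sum>l\<in>F. \<Sum>j\<in>F. c l * cnj (c j) * (if l - j = 0 then of_real pi else 0))
        = complex_of_real (G - (\<Sum>l\<in>F. (norm (b l))\<^sup>2) / pi)"
  proof -
    have "(\<Sum>l\<in>F. \<Sum>j\<in>F. c l * cnj (c j) * (if l - j = 0 then of_real pi else 0)) = (\<Sum>l\<in>F. c l * cnj (c l) * of_real pi)"
    proof (intro sum.cong refl)
      fix l assume "l \<in> F"
      have "(\<Sum>j\<in>F. c l * cnj (c j) * (if l - j = 0 then of_real pi else 0)) = (\<Sum>j\<in>F. if l = j then c l * cnj (c j) * of_real pi else 0)"
        by (intro sum.cong refl) auto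
      also have "\<dots> = c l * cnj (c l) * of_real pi"
        using F \<open>l \<in> F\<close> by (simp add: sum.delta')
      finally show "(\<Sum>j\<in>F. c l * cnj (c j) * (if l - j = 0 then of_real pi else 0)) = c l * cnj (c l) * of_real pi" .
    qed
    moreover have "c l * cnj (c l) * of_real pi = c l * cnj (b l)" for l
      by (simp add: c_def)
    moreover have "cnj (c l) * b l = complex_of_real ((norm (b l))\<^sup>2 / pi)" for l
      unfolding c_def of_real_divide complex_norm_square by simp
    ultimately show ?thesis by (simp add: sum_divide_distrib)
  qed
  ultimately have "((\<lambda>t. complex_of_real ((norm (g t - P t))\<^sup>2)) has_integral complex_of_real (G - (\<Sum>l\<in>F. (norm (b l))\<^sup>2) / pi)) {0..pi}"
    by (simp only:)
  from has_integral_Re[OF this]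
  have "((\<lambda>t. (norm (g t - P t))\<^sup>2) has_integral (G - (\<Sum>l\<in>F. (norm (b l))\<^sup>2) / pi)) {0..pi}"
    by (simp only: Re_complex_of_real)
  then have "0 \<le> G - (\<Sum>l\<in>F. (norm (b l))\<^sup>2) / pi"
    by (rule has_integral_nonneg) auto
  then show ?thesis by (simp add: G_def b_def field_simps)
qed

text \<open>The Riemann-Lebesgue lemma for continuous functions, read off from Bessel's inequality along
  an injective enumeration of frequencies.\<close>

lemma fourier_coeff_tendsto_0:
  assumes g: "continuous_on {0..pi} g" and h: "inj (h :: nat \<Rightarrow> int)"
  shows "(\<lambda>n. fourier_coeff g (h n)) \<longlonglongrightarrow> 0"
proof -
  have "summable (\<lambda>n. (norm (fourier_coeff g (h n)))\<^sup>2)"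
  proof (rule summableI_nonneg_bounded)
    fix n
    have "(\<Sum>i<n. (norm (fourier_coeff g (h i)))\<^sup>2) = (\<Sum>l\<in>h ` {..<n}. (norm (fourier_coeff g l))\<^sup>2)"
      using h by (subst sum.reindex) (auto simp: inj_on_def)
    also have "\<dots> \<le> pi * integral {0..pi} (\<lambda>t. (norm (g t))\<^sup>2)"
      by (rule fourier_bessel[OF g]) auto
    finally show "(\<Sum>i<n. (norm (fourier_coeff g (h i)))\<^sup>2) \<le> pi * integral {0..pi} (\<lambda>t. (norm (g t))\<^sup>2)" .
  qed auto
  from tendsto_real_sqrt[OF summable_LIMSEQ_zero[OF this]] show ?thesis
    by (simp add: tendsto_norm_zero_iff)
qed

text \<open>Unconditional sums over the integers can be evaluated along symmetric partial sums.\<close>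

lemma filterlim_symmetric_int_intervals:
  "filterlim (\<lambda>N. {- int N..int N}) (finite_subsets_at_top UNIV) sequentially"
  unfolding filterlim_iff eventually_finite_subsets_at_top
proof safe
  fix P and X :: "int set"
  assume X: "finite X" and P: "\<forall>Y. finite Y \<and> X \<subseteq> Y \<and> Y \<subseteq> UNIV \<longrightarrow> P Y"
  define M where "M = Max (abs ` X)"
  have M: "\<bar>x\<bar> \<le> M" if "x \<in> X" for x
    unfolding M_def by (rule Max_ge) (use X that in auto)
  show "\<forall>\<^sub>F N in sequentially. P {- int N..int N}"
  proof (rule eventually_sequentiallyI)
    fix N assume N: "nat M \<le> N"
    have "x \<in> {- int N..int N}" if "x \<in> X" for x
    proof -
      have "\<bar>x\<bar> \<le> int N" using M[OF that] N by linarith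
      then show ?thesis by (simp add: abs_le_iff)
    qed
    then show "P {- int N..int N}" using P by blast
  qed
qed

lemma has_vector_derivative_imp_quotient_tendsto:
  fixes f :: "real \<Rightarrow> complex"
  assumes "(f has_vector_derivative d) (at s)"
  shows "((\<lambda>t. (f t - f s) / of_real (t - s)) \<longlongrightarrow> d) (at s)"
proof -
  have "((\<lambda>t. Re ((f t - f s) / of_real (t - s))) \<longlongrightarrow> Re d) (at s)"
       "((\<lambda>t. Im ((f t - f s) / of_real (t - s))) \<longlongrightarrow> Im d) (at s)"
    using assms unfolding has_vector_derivative_complex_iff has_field_derivative_iff by simp_all
  then show ?thesis unfolding tendsto_complex_iff by blast
qed

text \<open>Chernoff's argument.  Since \<open>f\<close> is differentiable at the interior point \<open>s\<close>, division by
  \<open>cis (2 * t) - cis (2 * s)\<close>, whose only zero on \<open>[0, \<pi>]\<close> is simple and lies at \<open>s\<close>, gives a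
  continuous function \<open>q\<close> with \<open>f t = f s + (cis (2 * t) - cis (2 * s)) * q t\<close>.  On the level of
  coefficients this is a telescoping identity, so a symmetric partial sum of the series at \<open>s\<close>
  differs from \<open>f s\<close> only by two coefficients of \<open>q\<close>, which tend to \<open>0\<close>.\<close>

theorem fourier_inversion:
  assumes f: "continuous_on {0..pi} f" and d: "(f has_vector_derivative f') (at s)"
      and s: "0 < s" "s < pi" and a: "(\<lambda>l. norm (fourier_coeff f l)) summable_on UNIV"
  shows "((\<lambda>l. fourier_coeff f l / of_real pi * cis (of_int (2*l) * s)) has_sum f s) UNIV"
proof -
  let ?e = "\<lambda>l t. cis (of_int (2 * l) * t)"
  \<comment> \<open>the value at \<open>s\<close> is the limit of the quotient, which makes \<open>q\<close> continuous\<close>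
  define q where "q = (\<lambda>t. if t = s then f' / (2 * \<i> * cis (2 * s)) else (f t - f s) / (cis (2 * t) - cis (2 * s)))"
  have ne: "cis (2 * t) \<noteq> cis (2 * s)" if "t \<in> {0..pi}" "t \<noteq> s" for t
  proof
    assume "cis (2 * t) = cis (2 * s)"
    then have "cis (2 * t - 2 * s) = 1" by (simp add: cis_divide[symmetric])
    then have "cos (2 * (t - s)) = 1" by (simp add: complex_eq_iff algebra_simps)
    then have "sin (t - s) = 0" using cos_double_sin[of "t - s"] by simp
    moreover have "\<bar>t - s\<bar> < pi" "t - s \<noteq> 0" using that s by auto
    ultimately show False using sin_eq_0_pi[of "t - s"] by (simp add: abs_less_iff)
  qed
  have q: "continuous_on {0..pi} q"
    unfolding continuous_on_eq_continuous_within
  proof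
    fix t assume t: "t \<in> {0..pi}"
    show "continuous (at t within {0..pi}) q"
    proof (cases "t = s")
      case False
      have "continuous_on {0..pi} (\<lambda>t. cis (2 * t))" by (intro continuous_intros)
      then have "((\<lambda>t. cis (2 * t)) \<longlongrightarrow> cis (2 * t)) (at t within {0..pi})" "(f \<longlongrightarrow> f t) (at t within {0..pi})"
        using f t by (auto simp: continuous_on_def)
      then have "((\<lambda>t. (f t - f s) / (cis (2 * t) - cis (2 * s))) \<longlongrightarrow> (f t - f s) / (cis (2 * t) - cis (2 * s))) (at t within {0..pi})"
        using ne[OF t False] by (intro tendsto_intros) auto
      moreover have "\<forall>\<^sub>F x in at t within {0..pi}. (f x - f s) / (cis (2 * x) - cis (2 * s)) = q x"
        using eventually_neq_at_within[of s t "{0..pi}"] by eventually_elim (simp add: q_def)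
      ultimately have "(q \<longlongrightarrow> (f t - f s) / (cis (2 * t) - cis (2 * s))) (at t within {0..pi})"
        by (rule Lim_transform_eventually)
      moreover have "q t = (f t - f s) / (cis (2 * t) - cis (2 * s))" using False by (simp add: q_def)
      ultimately show ?thesis
        by (simp add: continuous_within)
    next
      case True
      have "((\<lambda>t. cis (2 * t)) has_vector_derivative (2 * \<i> * cis (2 * s))) (at s)"
        unfolding has_vector_derivative_def by (rule derivative_eq_intros refl)+ (auto simp: scaleR_conv_of_real)
      from has_vector_derivative_imp_quotient_tendsto[OF this]
      have "((\<lambda>t. ((f t - f s) / of_real (t - s)) / ((cis (2 * t) - cis (2 * s)) / of_real (t - s))) \<longlongrightarrow> f' / (2 * \<i> * cis (2 * s))) (at s)"
        by (intro tendsto_divide has_vector_derivative_imp_quotient_tendsto[OF d]) auto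
      moreover have "\<forall>\<^sub>F t in at s. ((f t - f s) / of_real (t - s)) / ((cis (2 * t) - cis (2 * s)) / of_real (t - s)) = q t"
        using eventually_neq_at_within[of s s UNIV] by eventually_elim (simp add: q_def)
      ultimately have "(q \<longlongrightarrow> f' / (2 * \<i> * cis (2 * s))) (at s)"
        by (rule Lim_transform_eventually)
      moreover have "q s = f' / (2 * \<i> * cis (2 * s))" by (simp add: q_def)
      ultimately have "(q \<longlongrightarrow> q s) (at s)" by (simp only:)
      then have "(q \<longlongrightarrow> q s) (at s within {0..pi})" by (rule tendsto_within_subset) auto
      then show ?thesis
        by (simp only: True continuous_within)
    qed
  qed
  have fq: "f t - f s = (cis (2 * t) - cis (2 * s)) * q t" if "t \<in> {0..pi}" for t
    using ne[OF that] by (auto simp: q_def)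
  define Q where "Q = fourier_coeff q"
  \<comment> \<open>the coefficient identity that makes the series telescope\<close>
  have rec: "fourier_coeff f l = (if l = 0 then of_real pi * f s else 0) + Q (l-1) - cis (2 * s) * Q l" for l
  proof -
    have "((\<lambda>t. f s * ?e (-l) t + q t * ?e (-(l-1)) t - cis (2 * s) * (q t * ?e (-l) t)) has_integral
        f s * (if -l = 0 then of_real pi else 0) + Q (l-1) - cis (2 * s) * Q l) {0..pi}"
      unfolding Q_def
      by (intro has_integral_add has_integral_diff has_integral_mult_right fourier_coeff_has_integral q integral_cis_even)
    moreover have "f s * ?e (-l) t + q t * ?e (-(l-1)) t - cis (2 * s) * (q t * ?e (-l) t) = f t * ?e (-l) t" if "t \<in> {0..pi}" for t
    proof -
      have "?e (-(l-1)) t = cis (2 * t) * ?e (-l) t" by (simp add: cis_mult algebra_simps)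
      moreover have "f t = f s + (cis (2 * t) - cis (2 * s)) * q t" using fq[OF that] by (simp add: algebra_simps)
      moreover have "f s * E + q t * (C * E) - D * (q t * E) = (f s + (C - D) * q t) * E" for C D E
        by (simp add: algebra_simps)
      ultimately show ?thesis by (simp only:)
    qed
    ultimately have "((\<lambda>t. f t * ?e (-l) t) has_integral
        f s * (if -l = 0 then of_real pi else 0) + Q (l-1) - cis (2 * s) * Q l) {0..pi}"
      by (rule has_integral_eq[rotated])
    with fourier_coeff_has_integral[OF f, of l] have "fourier_coeff f l = f s * (if -l = 0 then of_real pi else 0) + Q (l-1) - cis (2 * s) * Q l"
      by (rule has_integral_unique)
    then show ?thesis by auto
  qed
  have part: "(\<Sum>l\<in>{- int N..int N}. fourier_coeff f l * ?e l s) = of_real pi * f s + Q (- int N - 1) * ?e (- int N) s - Q (int N) * ?e (int N + 1) s" for N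
  proof (induction N)
    case 0
    show ?case by (simp add: rec)
  next
    case (Suc N)
    have "{- int (Suc N)..int (Suc N)} = insert (- int N - 1) (insert (int N + 1) {- int N..int N})" by auto
    then have "(\<Sum>l\<in>{- int (Suc N)..int (Suc N)}. fourier_coeff f l * ?e l s)
        = fourier_coeff f (- int N - 1) * ?e (- int N - 1) s + (fourier_coeff f (int N + 1) * ?e (int N + 1) s + (\<Sum>l\<in>{- int N..int N}. fourier_coeff f l * ?e l s))"
      by simp
    also have "\<dots> = (Q (- int N - 1 - 1) - cis (2 * s) * Q (- int N - 1)) * ?e (- int N - 1) s
         + ((Q (int N) - cis (2 * s) * Q (int N + 1)) * ?e (int N + 1) s
         + (of_real pi * f s + Q (- int N - 1) * ?e (- int N) s - Q (int N) * ?e (int N + 1) s))"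
      unfolding Suc.IH rec[of "- int N - 1"] rec[of "int N + 1"] by simp
    also have "?e (- int N) s = ?e (- int N - 1) s * cis (2 * s)"
      by (simp add: cis_mult algebra_simps)
    also have "(Q1' - D * Q1) * E1 + ((Q2 - D * Q2') * E2 + (P + Q1 * (E1 * D) - Q2 * E2)) = P + Q1' * E1 - Q2' * (E2 * D)" for Q1 Q1' Q2 Q2' D E1 E2 P :: complex
      by (simp add: algebra_simps)
    also have "?e (int N + 1) s * cis (2 * s) = ?e (int (Suc N) + 1) s"
      by (simp add: cis_mult algebra_simps)
    also have "- int N - 1 - 1 = - int (Suc N) - 1" by simp
    also have "- int N - 1 = - int (Suc N)" by simp
    also have "int N + 1 = int (Suc N)" by simp
    finally show ?case .
  qed
  have Q1: "(\<lambda>N. Q (- int N - 1)) \<longlonglongrightarrow> 0" and Q2: "(\<lambda>N. Q (int N)) \<longlonglongrightarrow> 0"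
    unfolding Q_def by (rule fourier_coeff_tendsto_0[OF q]; simp add: inj_on_def)+
  have bd: "(\<lambda>N. Q (h N) * ?e (h' N) s) \<longlonglongrightarrow> 0" if "(\<lambda>N. Q (h N)) \<longlonglongrightarrow> 0" for h h'
    by (rule tendsto_norm_zero_cancel) (use that in \<open>simp add: norm_mult tendsto_norm_zero\<close>)
  have "(\<lambda>N. of_real pi * f s + Q (- int N - 1) * ?e (- int N) s - Q (int N) * ?e (int N + 1) s) \<longlonglongrightarrow> of_real pi * f s + 0 - 0"
    by (intro tendsto_intros bd Q1 Q2)
  then have lim: "(\<lambda>N. \<Sum>l\<in>{- int N..int N}. fourier_coeff f l * ?e l s) \<longlonglongrightarrow> of_real pi * f s"
    unfolding part add_0_right diff_0_right .
  have "(\<lambda>l. fourier_coeff f l * ?e l s) summable_on UNIV"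
    by (rule abs_summable_summable) (use a in \<open>simp add: norm_mult\<close>)
  then obtain S where S: "((\<lambda>l. fourier_coeff f l * ?e l s) has_sum S) UNIV" by (auto simp: summable_on_def)
  then have "(\<lambda>N. \<Sum>l\<in>{- int N..int N}. fourier_coeff f l * ?e l s) \<longlonglongrightarrow> S"
    unfolding has_sum_def by (rule filterlim_compose[OF _ filterlim_symmetric_int_intervals])
  from LIMSEQ_unique[OF this lim] have "S = of_real pi * f s" .
  with S have "((\<lambda>l. fourier_coeff f l * ?e l s) has_sum of_real pi * f s) UNIV" by simp
  from has_sum_cmult_right[OF this, of "1 / of_real pi"] show ?thesis by simp
qed

text \<open>An absolutely convergent series of bounded functions may be integrated term by term against
  an integrable kernel, since the remainder is bounded uniformly by the tail of the
  coefficient series.\<close>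

lemma has_sum_integral_exchange:
  fixes a c :: "'i \<Rightarrow> complex" and \<kappa> :: "real \<Rightarrow> complex"
  assumes a: "(\<lambda>l. norm (a l)) summable_on UNIV"
      and e: "\<And>l t. t \<in> S \<Longrightarrow> norm (e l t) \<le> 1"
      and \<kappa>: "\<kappa> absolutely_integrable_on S"
      and c: "\<And>l. ((\<lambda>t. e l t * \<kappa> t) has_integral c l) S"
      and f: "\<And>t. t \<in> S \<Longrightarrow> ((\<lambda>l. a l * e l t) has_sum f t) UNIV"
      and I: "((\<lambda>t. f t * \<kappa> t) has_integral I) S"
  shows "((\<lambda>l. a l * c l) has_sum I) UNIV"
proof -
  let ?p = "\<lambda>F. \<Sum>l\<in>F. norm (a l)"
  define A where "A = (\<Sum>\<^sub>\<infinity>l. norm (a l))"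
  define R where "R = integral S (\<lambda>t. norm (\<kappa> t))"
  have A: "((\<lambda>l. norm (a l)) has_sum A) UNIV"
    unfolding A_def using a by simp
  have R: "(\<lambda>t. norm (\<kappa> t)) integrable_on S"
    using \<kappa> by (simp add: absolutely_integrable_on_def)
  have Rc: "(\<lambda>t. x * norm (\<kappa> t)) integrable_on S" for x :: real
    using has_integral_mult_right[OF integrable_integral[OF R], of x] by (rule has_integral_integrable)
  have bound: "norm ((\<Sum>l\<in>F. a l * c l) - I) \<le> (A - ?p F) * R" if F: "finite F" for F
  proof -
    have h: "((\<lambda>t. (\<Sum>l\<in>F. a l * (e l t * \<kappa> t)) - f t * \<kappa> t) has_integral (\<Sum>l\<in>F. a l * c l) - I) S"
      by (intro has_integral_diff has_integral_sum F has_integral_mult_right c I)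
    have tail: "norm ((\<Sum>l\<in>F. a l * (e l t * \<kappa> t)) - f t * \<kappa> t) \<le> (A - ?p F) * norm (\<kappa> t)" if t: "t \<in> S" for t
    proof -
      have 1: "((\<lambda>l. a l * e l t) has_sum (f t - (\<Sum>l\<in>F. a l * e l t))) (UNIV - F)"
        by (intro has_sum_Diff f t has_sum_finite F) auto
      have 2: "((\<lambda>l. norm (a l)) has_sum (A - ?p F)) (UNIV - F)"
        by (intro has_sum_Diff A has_sum_finite F) auto
      have le: "norm (a l * e l t) \<le> norm (a l)" for l
        using e[OF t, of l] by (simp add: norm_mult mult_left_le)
      have 3: "(\<lambda>l. norm (a l * e l t)) summable_on (UNIV - F)"
        using has_sum_imp_summable[OF 2] by (rule Infinite_Sum.abs_summable_on_comparison_test) (use le in simp)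
      then obtain T where T: "((\<lambda>l. norm (a l * e l t)) has_sum T) (UNIV - F)"
        unfolding summable_on_def by blast
      have "norm (f t - (\<Sum>l\<in>F. a l * e l t)) \<le> T" by (rule norm_has_sum_bound[OF T 1])
      also have "T \<le> A - ?p F" by (rule has_sum_mono[OF T 2 le])
      finally have 4: "norm ((\<Sum>l\<in>F. a l * e l t) - f t) \<le> A - ?p F"
        by (simp add: norm_minus_commute)
      have "(\<Sum>l\<in>F. a l * (e l t * \<kappa> t)) - f t * \<kappa> t = ((\<Sum>l\<in>F. a l * e l t) - f t) * \<kappa> t"
        by (simp add: sum_distrib_left algebra_simps)
      then show ?thesis using 4 by (simp add: norm_mult mult_right_mono)
    qed
    show ?thesis
      using Henstock_Kurzweil_Integration.integral_norm_bound_integral[OF has_integral_integrable[OF h] Rc tail]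
      unfolding integral_unique[OF h] integral_mult_right R_def .
  qed
  have "((?p) \<longlongrightarrow> A) (finite_subsets_at_top UNIV)"
    using A by (simp add: has_sum_def)
  then have "((\<lambda>F. (A - ?p F) * R) \<longlongrightarrow> (A - A) * R) (finite_subsets_at_top UNIV)"
    by (intro tendsto_intros)
  then have "((\<lambda>F. (A - ?p F) * R) \<longlongrightarrow> 0) (finite_subsets_at_top UNIV)" by simp
  then have "((\<lambda>F. (\<Sum>l\<in>F. a l * c l) - I) \<longlongrightarrow> 0) (finite_subsets_at_top UNIV)"
    by (rule Lim_null_comparison[rotated]) (intro eventually_finite_subsets_at_top_weakI bound)
  then show ?thesis unfolding has_sum_def by (rule LIM_zero_cancel)
qed

text \<open>The interval is cut at \<open>p - s\<close> and the two pieces are exchanged by translations.\<close>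

lemma has_integral_periodic_shift:
  fixes q :: "real \<Rightarrow> 'a :: banach"
  assumes per: "\<And>t. q (t + p) = q t" and q: "(q has_integral I) {0..p}" and s: "0 \<le> s" "s \<le> p"
  shows "((\<lambda>t. q (t - s)) has_integral I) {0..p}"
proof -
  have "q integrable_on {0..p-s}"
    by (rule integrable_on_subinterval[OF has_integral_integrable[OF q]]) (use s in simp)
  then obtain I1 where I1: "(q has_integral I1) {0..p-s}" unfolding integrable_on_def by blast
  have "q integrable_on {p-s..p}"
    by (rule integrable_on_subinterval[OF has_integral_integrable[OF q]]) (use s in simp)
  then obtain I2 where I2: "(q has_integral I2) {p-s..p}" unfolding integrable_on_def by blast
  have "(q has_integral I1 + I2) {0..p}"
    by (rule has_integral_combine[OF _ _ I1 I2]) (use s in simp_all)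
  from q this have I12: "I = I1 + I2" by (rule has_integral_unique)
  have e1: "(\<lambda>t. q (t + - s)) = (\<lambda>t. q (t - s))" "0 - (- s) = s" "p - s - (- s) = p" by simp_all
  have e2: "q (t + (p - s)) = q (t - s)" for t
  proof -
    have "t + (p - s) = (t - s) + p" by simp
    then show ?thesis by (simp only: per)
  qed
  have e3: "p - s - (p - s) = 0" "p - (p - s) = s" by simp_all
  have 1: "((\<lambda>t. q (t - s)) has_integral I1) {s..p}"
    using has_integral_shift_real_ivl[OF I1, of "- s"] unfolding e1 .
  have 2: "((\<lambda>t. q (t - s)) has_integral I2) {0..s}"
    using has_integral_shift_real_ivl[OF I2, of "p - s"] unfolding e2 e3 .
  show ?thesis
    using has_integral_combine[OF s 2 1] unfolding I12 by (simp only: add.commute)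
qed

lemma absolutely_integrable_periodic_shift:
  fixes q :: "real \<Rightarrow> 'a :: euclidean_space"
  assumes per: "\<And>t. q (t + p) = q t" and q: "q absolutely_integrable_on {0..p}" and s: "0 \<le> s" "s \<le> p"
  shows "(\<lambda>t. q (t - s)) absolutely_integrable_on {0..p}"
proof -
  from q obtain I J where "(q has_integral I) {0..p}" "((\<lambda>t. norm (q t)) has_integral J) {0..p}"
    unfolding absolutely_integrable_on_def integrable_on_def by blast
  then have "((\<lambda>t. q (t - s)) has_integral I) {0..p}" "((\<lambda>t. norm (q (t - s))) has_integral J) {0..p}"
    by (intro has_integral_periodic_shift s; simp add: per)+
  then show ?thesis
    unfolding absolutely_integrable_on_def integrable_on_def by blast
qed

section \<open>The profile and its convolutions\<close>

text \<open>The second derivative of the mapped exponential in the variable \<open>t\<close>, multiplied by the Jacobian of the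
  substitution and, for \<open>a \<noteq> 1\<close>, by the factor \<open>sin t powr (a - 1)\<close> that the kernel contributes;
  powers of \<open>L\<close> are left out.\<close>

definition profile :: "real \<Rightarrow> int \<Rightarrow> real \<Rightarrow> complex" where
  "profile a k t = of_real (sin t powr a) * (2 * \<i> * of_int k * of_real (cos t) - (of_int k)\<^sup>2 * of_real (sin t)) * cis (of_int k * t)"

text \<open>The unnormalised Fourier coefficient of the profile in closed form; the polynomial factor of the final
  series arises here.\<close>

definition profile_coeff :: "real \<Rightarrow> int \<Rightarrow> int \<Rightarrow> complex" where
  "profile_coeff a k l = of_real (((1 - a) * (of_int k)\<^sup>2 - 4 * of_int k * of_int l) / (a + 1)) * sin_moment (a + 1) (k - 2 * l)"

lemma continuous_on_profile:
  assumes "a > 0"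
  shows "continuous_on {0..pi} (profile a k)"
  unfolding profile_def by (intro continuous_intros continuous_on_sin_powr assms)

lemma profile_differentiable:
  assumes "0 < t" "t < pi"
  shows "\<exists>d. (profile a k has_vector_derivative d) (at t)"
proof -
  have t: "t \<in> {0<..<pi}" using assms by simp
  have "((\<lambda>t. of_real (cos t)) has_vector_derivative of_real (- sin t)) (at t)"
       "((\<lambda>t. of_real (sin t)) has_vector_derivative of_real (cos t)) (at t)"
    by (rule bounded_linear.has_vector_derivative[OF bounded_linear_of_real],
        subst has_real_derivative_iff_has_vector_derivative[symmetric], rule DERIV_cos DERIV_sin)+
  then have "((\<lambda>t. 2 * \<i> * of_int k * of_real (cos t) - (of_int k)\<^sup>2 * of_real (sin t)) has_vector_derivative
      (2 * \<i> * of_int k * of_real (- sin t) - (of_int k)\<^sup>2 * of_real (cos t))) (at t)"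
    by (intro has_vector_derivative_diff has_vector_derivative_mult_right)
  from has_vector_derivative_mult[OF has_vector_derivative_sin_powr_cis[OF t, of a "of_int k"] this]
  have "\<exists>d. ((\<lambda>t. (of_real (sin t powr a) * cis (of_int k * t)) * (2 * \<i> * of_int k * of_real (cos t) - (of_int k)\<^sup>2 * of_real (sin t))) has_vector_derivative d) (at t)"
    by blast
  moreover have "(\<lambda>t. (of_real (sin t powr a) * cis (of_int k * t)) * (2 * \<i> * of_int k * of_real (cos t) - (of_int k)\<^sup>2 * of_real (sin t))) = profile a k"
    by (simp add: fun_eq_iff profile_def mult_ac)
  ultimately show ?thesis by simp
qed

text \<open>The cosine term of the profile carries the factor \<open>(sin t powr (a + 1))' / (a + 1)\<close>.  Integrating it
  by parts leaves only moments of exponent \<open>a + 1\<close>, and the two contributions combine to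
  \<open>2 * k * (k - 2 * l) / (a + 1) - k\<^sup>2\<close>.\<close>

lemma fourier_coeff_profile:
  assumes a: "a > 0"
  shows "fourier_coeff (profile a k) l = profile_coeff a k l"
proof -
  let ?m = "k - 2 * l"
  have 1: "((\<lambda>t. of_real ((a+1) * sin t powr a * cos t) * cis (of_int ?m * t)) has_integral
           - \<i> * of_int ?m * sin_moment (a+1) ?m) {0..pi}"
    by (rule sin_moment_parts) (use a in simp)
  have 2: "((\<lambda>t. of_real (sin t powr (a+1)) * cis (of_int ?m * t)) has_integral sin_moment (a+1) ?m) {0..pi}"
    by (rule sin_moment_has_integral) (use a in simp)
  have "((\<lambda>t. (2 * \<i> * of_int k / of_real (a+1)) * (of_real ((a+1) * sin t powr a * cos t) * cis (of_int ?m * t))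
            - (of_int k)\<^sup>2 * (of_real (sin t powr (a+1)) * cis (of_int ?m * t))) has_integral
        (2 * \<i> * of_int k / of_real (a+1)) * (- \<i> * of_int ?m * sin_moment (a+1) ?m) - (of_int k)\<^sup>2 * sin_moment (a+1) ?m) {0..pi}"
    by (intro has_integral_diff has_integral_mult_right 1 2)
  moreover have "(2 * \<i> * of_int k / of_real (a+1)) * (of_real ((a+1) * sin t powr a * cos t) * cis (of_int ?m * t))
            - (of_int k)\<^sup>2 * (of_real (sin t powr (a+1)) * cis (of_int ?m * t)) = profile a k t * cis (of_int (2 * - l) * t)"
    if "t \<in> {0..pi}" for t
  proof -
    have s: "sin t \<ge> 0" using that by (auto intro: sin_ge_zero)
    have c: "cis (of_int ?m * t) = cis (of_int k * t) * cis (of_int (2 * - l) * t)"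
      by (simp add: cis_mult algebra_simps)
    have p: "sin t powr (a+1) = sin t powr a * sin t" using s by (simp add: powr_add)
    have nz: "complex_of_real (a+1) \<noteq> 0" using a by (subst of_real_eq_0_iff) simp
    have "(X / A) * ((A * S * C) * (E * F)) - Y * ((S * T) * (E * F)) = (S * (X * C - Y * T) * E) * F"
      if "A \<noteq> 0" for X Y A S T C E F :: complex using that by (simp add: algebra_simps)
    from this[OF nz] show ?thesis unfolding c p profile_def of_real_mult .
  qed
  ultimately have "((\<lambda>t. profile a k t * cis (of_int (2 * - l) * t)) has_integral
      (2 * \<i> * of_int k / of_real (a+1)) * (- \<i> * of_int ?m * sin_moment (a+1) ?m) - (of_int k)\<^sup>2 * sin_moment (a+1) ?m) {0..pi}"
    by (rule has_integral_eq[rotated])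
  from has_integral_unique[OF fourier_coeff_has_integral[OF continuous_on_profile[OF a]] this]
  have "fourier_coeff (profile a k) l = (2 * \<i> * of_int k / of_real (a+1)) * (- \<i> * of_int ?m * sin_moment (a+1) ?m) - (of_int k)\<^sup>2 * sin_moment (a+1) ?m" .
  also have "\<dots> = of_real (2 * of_int k * of_int ?m / (a+1) - (of_int k)\<^sup>2) * sin_moment (a+1) ?m"
    by (simp add: algebra_simps diff_divide_distrib add_divide_distrib)
  also have "2 * of_int k * of_int ?m / (a+1) - (of_int k)\<^sup>2 = ((1 - a) * (of_int k)\<^sup>2 - 4 * of_int k * of_int l) / (a + 1)"
    using a by (simp add: field_simps power2_eq_square)
  finally show ?thesis by (simp add: profile_coeff_def)
qed

text \<open>With \<open>m = 2 * n + d\<close> and \<open>r n\<close> the norm of the moment at \<open>m\<close>, the recurrence reads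
  \<open>(m + 2 + b) * r (n + 1) = (m - b) * r n\<close>.  The sequence \<open>T n = m * (m + b) * r n\<close> therefore
  decreases by at least \<open>(2 * b - 2) * (m + 1) * r n\<close> in each step, and telescoping bounds the partial
  sums.\<close>

lemma summable_sin_moment:
  assumes b: "1 < b" "b < 3" and d: "d \<in> {0, 1 :: int}"
  shows "summable (\<lambda>n. (2 * real n + of_int d + 1) * norm (sin_moment b (2 * int n + d)))"
proof -
  define r where "r = (\<lambda>n. norm (sin_moment b (2 * int n + d)))"
  define m where "m = (\<lambda>n. 2 * real n + of_int d)"
  define T where "T = (\<lambda>n. m n * (m n + b) * r n)"
  have m: "m n \<ge> 3" if "n \<ge> 2" for n using that d by (auto simp: m_def)
  have r0: "r n \<ge> 0" for n by (simp add: r_def)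
  have step: "(m n + 2 + b) * r (Suc n) = (m n - b) * r n" if "n \<ge> 2" for n
  proof -
    have "of_real (b + 2 + of_int (2 * int n + d)) * sin_moment b (2 * int n + d + 2) = of_real (of_int (2 * int n + d) - b) * sin_moment b (2 * int n + d)"
      by (rule sin_moment_step) (use b in simp)
    then have "norm (of_real (b + 2 + of_int (2 * int n + d)) * sin_moment b (2 * int n + d + 2)) = norm (of_real (of_int (2 * int n + d) - b) * sin_moment b (2 * int n + d))"
      by (simp only:)
    moreover have rS: "r (Suc n) = norm (sin_moment b (2 * int n + d + 2))"
    proof -
      have "2 * int (Suc n) + d = 2 * int n + d + 2" by simp
      then show ?thesis unfolding r_def by (simp only:)
    qed
    moreover have "m n = of_int (2 * int n + d)" by (simp add: m_def)
    ultimately have "\<bar>b + 2 + m n\<bar> * r (Suc n) = \<bar>m n - b\<bar> * r n"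
      unfolding norm_mult norm_of_real r_def by (simp only:)
    moreover have "m n \<ge> 3" by (rule m[OF that])
    ultimately show ?thesis using b by (simp add: algebra_simps)
  qed
  \<comment> \<open>for \<open>n \<ge> 2\<close> the factor \<open>m n - b\<close> of the recurrence is positive, so no modulus is left\<close>
  have tel: "(2 * b - 2) * ((m n + 1) * r n) \<le> T n - T (Suc n)" if n: "n \<ge> 2" for n
  proof -
    have "m (Suc n) = m n + 2" by (simp add: m_def)
    then have "T (Suc n) = (m n + 2) * ((m n + 2 + b) * r (Suc n))" by (simp add: T_def)
    also have "\<dots> = (m n + 2) * ((m n - b) * r n)" using step[OF n] by simp
    finally have "T n - T (Suc n) - (2 * b - 2) * ((m n + 1) * r n) = 2 * r n"
      unfolding T_def by (simp add: algebra_simps)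
    then show ?thesis using r0[of n] by simp
  qed
  have "summable (\<lambda>n. (2 * b - 2) * ((m (n + 2) + 1) * r (n + 2)))"
  proof (rule summableI_nonneg_bounded)
    fix n
    show "0 \<le> (2 * b - 2) * ((m (n + 2) + 1) * r (n + 2))"
      using b m[of "n+2"] r0[of "n+2"] by simp
    have "(\<Sum>i<n. (2 * b - 2) * ((m (i + 2) + 1) * r (i + 2))) \<le> (\<Sum>i<n. T (i + 2) - T (Suc i + 2))"
      by (rule sum_mono) (use tel in simp)
    also have "\<dots> = T (0 + 2) - T (n + 2)"
      by (rule sum_lessThan_telescope'[of "\<lambda>i. T (i + 2)" n])
    also have "\<dots> \<le> T (0 + 2)"
      using m[of "n+2"] r0[of "n+2"] b by (simp add: T_def)
    finally show "(\<Sum>i<n. (2 * b - 2) * ((m (i + 2) + 1) * r (i + 2))) \<le> T (0 + 2)" .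
  qed
  then have "summable (\<lambda>n. (1 / (2 * b - 2)) * ((2 * b - 2) * ((m (n + 2) + 1) * r (n + 2))))"
    by (rule summable_mult)
  then have "summable (\<lambda>n. (m (n + 2) + 1) * r (n + 2))" using b by simp
  then have "summable (\<lambda>n. (m n + 1) * r n)"
    by (subst (asm) summable_iff_shift[of "\<lambda>n. (m n + 1) * r n" 2])
  then show ?thesis unfolding m_def r_def .
qed

lemma summable_on_int:
  fixes f :: "int \<Rightarrow> real"
  assumes nn: "\<And>i. f i \<ge> 0" and p: "summable (\<lambda>n. f (int n))" and q: "summable (\<lambda>n. f (- int n - 1))"
  shows "f summable_on UNIV"
proof -
  have "f \<circ> int summable_on UNIV" "f \<circ> (\<lambda>n. - int n - 1) summable_on UNIV"
    unfolding o_def using nn p q by (auto intro: summable_nonneg_imp_summable_on)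
  then have "f summable_on (range int)" "f summable_on (range (\<lambda>n. - int n - 1))"
    by (subst summable_on_reindex; simp add: inj_on_def)+
  then have "f summable_on (range int \<union> range (\<lambda>n. - int n - 1))"
    by (rule summable_on_Un_disjoint) auto
  moreover have "range int \<union> range (\<lambda>n. - int n - 1) = UNIV"
  proof (intro set_eqI iffI UNIV_I)
    fix x :: int
    show "x \<in> range int \<union> range (\<lambda>n. - int n - 1)"
    proof (cases "x \<ge> 0")
      case True
      then have "x = int (nat x)" by simp
      then show ?thesis by blast
    next
      case False
      then have "x = - int (nat (- x - 1)) - 1" by simp
      then show ?thesis by blast
    qed
  qed
  ultimately show ?thesis by simp
qed

lemma norm_sin_moment_minus:
  "b > -1 \<Longrightarrow> norm (sin_moment b (- m)) = norm (sin_moment b m)"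
  by (simp add: sin_moment_minus norm_mult)

text \<open>The frequencies \<open>k - 2 * l\<close> exhaust a parity class of the integers, and by the reflection
  \<open>m \<mapsto> - m\<close> each half of it is covered by the one-sided series.\<close>

lemma summable_on_sin_moment:
  assumes b: "1 < b" "b < 3"
  shows "(\<lambda>l. (\<bar>of_int (k - 2 * l)\<bar> + 1) * norm (sin_moment b (k - 2 * l))) summable_on UNIV"
proof -
  define \<Phi> where "\<Phi> = (\<lambda>m::int. (\<bar>of_int m\<bar> + 1) * norm (sin_moment b m))"
  define d where "d = k mod 2"
  define j where "j = k div 2"
  have d: "d \<in> {0, 1}" by (auto simp: d_def)
  have k: "k = 2 * j + d" by (simp add: d_def j_def)
  have even: "\<Phi> (- m) = \<Phi> m" for m using norm_sin_moment_minus[of b m] b by (simp add: \<Phi>_def)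
  have s: "summable (\<lambda>n. \<Phi> (2 * int n + e))" if "e \<in> {0, 1}" for e
  proof -
    have "\<Phi> (2 * int n + e) = (2 * real n + of_int e + 1) * norm (sin_moment b (2 * int n + e))" for n
      using that by (auto simp: \<Phi>_def)
    then show ?thesis using summable_sin_moment[OF b that] by simp
  qed
  have "(\<lambda>q. \<Phi> (2 * q + d)) summable_on UNIV"
  proof (rule summable_on_int)
    show "summable (\<lambda>n. \<Phi> (2 * int n + d))" by (rule s[OF d])
    show "summable (\<lambda>n. \<Phi> (2 * (- int n - 1) + d))"
    proof (cases "d = 0")
      case True
      have "\<Phi> (2 * (- int n - 1) + d) = \<Phi> (2 * int (Suc n) + 0)" for n
      proof -
        have "2 * (- int n - 1) + d = - (2 * int (Suc n) + 0)" using True by simp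
        then show ?thesis using even[of "2 * int (Suc n) + 0"] by (simp only:)
      qed
      moreover have "summable (\<lambda>n. \<Phi> (2 * int (Suc n) + 0))"
        using s[of 0] by (subst summable_Suc_iff) simp
      ultimately show ?thesis by simp
    next
      case False
      then have "d = 1" using d by auto
      have "\<Phi> (2 * (- int n - 1) + d) = \<Phi> (2 * int n + 1)" for n
      proof -
        have "2 * (- int n - 1) + d = - (2 * int n + 1)" using \<open>d = 1\<close> by simp
        then show ?thesis using even[of "2 * int n + 1"] by (simp only:)
      qed
      then show ?thesis using s[of 1] by simp
    qed
  qed (simp add: \<Phi>_def)
  moreover have "(\<lambda>q. \<Phi> (2 * q + d)) summable_on ((\<lambda>l. j - l) ` UNIV) \<longleftrightarrow> ((\<lambda>q. \<Phi> (2 * q + d)) \<circ> (\<lambda>l. j - l)) summable_on UNIV"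
    by (rule summable_on_reindex) (simp add: inj_on_def)
  moreover have "range (\<lambda>l. j - l) = UNIV" by (rule surjI[of _ "\<lambda>l. j - l"]) simp
  moreover have "((\<lambda>q. \<Phi> (2 * q + d)) \<circ> (\<lambda>l. j - l)) = (\<lambda>l. \<Phi> (k - 2 * l))"
    by (simp add: fun_eq_iff k algebra_simps)
  ultimately have "(\<lambda>l. \<Phi> (k - 2 * l)) summable_on UNIV" by simp
  then show ?thesis by (simp add: \<Phi>_def)
qed

lemma summable_on_profile_coeff:
  assumes a: "0 < a" "a < 2"
  shows "(\<lambda>l. norm (profile_coeff a k l)) summable_on UNIV"
proof (rule summable_on_comparison_test)
  define C where "C = (\<bar>(1 + a) * (of_int k)\<^sup>2\<bar> + 2 * \<bar>of_int k\<bar>) / (a + 1)"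
  show "(\<lambda>l. C * ((\<bar>of_int (k - 2 * l)\<bar> + 1) * norm (sin_moment (a + 1) (k - 2 * l)))) summable_on UNIV"
    by (intro summable_on_cmult_right summable_on_sin_moment) (use a in auto)
  fix l
  have "\<bar>(1 - a) * (of_int k)\<^sup>2 - 4 * of_int k * of_int l\<bar> = \<bar>2 * of_int k * of_int (k - 2 * l) - (1 + a) * (of_int k)\<^sup>2\<bar>"
    by (simp add: algebra_simps power2_eq_square)
  also have "\<dots> \<le> \<bar>2 * of_int k * of_int (k - 2 * l)\<bar> + \<bar>(1 + a) * (of_int k)\<^sup>2\<bar>"
    by (rule abs_triangle_ineq4)
  also have "\<dots> \<le> (\<bar>(1 + a) * (of_int k)\<^sup>2\<bar> + 2 * \<bar>of_int k\<bar>) * (\<bar>of_int (k - 2 * l)\<bar> + 1)"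
    by (simp add: abs_mult distrib_left distrib_right)
  finally have "\<bar>(1 - a) * (of_int k)\<^sup>2 - 4 * of_int k * of_int l\<bar> / (a + 1) \<le> C * (\<bar>of_int (k - 2 * l)\<bar> + 1)"
    unfolding C_def using a by (simp add: divide_right_mono)
  then have "\<bar>(1 - a) * (of_int k)\<^sup>2 - 4 * of_int k * of_int l\<bar> / (a + 1) * norm (sin_moment (a + 1) (k - 2 * l))
     \<le> C * (\<bar>of_int (k - 2 * l)\<bar> + 1) * norm (sin_moment (a + 1) (k - 2 * l))"
    by (rule mult_right_mono) simp
  then show "norm (profile_coeff a k l) \<le> C * ((\<bar>of_int (k - 2 * l)\<bar> + 1) * norm (sin_moment (a + 1) (k - 2 * l)))"
    using a unfolding profile_coeff_def norm_mult norm_of_real by (simp add: mult.assoc)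
qed simp

text \<open>A convolution with a \<open>\<pi>\<close>-periodic integrable kernel \<open>\<kappa>\<close> multiplies the exponential of frequency
  \<open>2 * l\<close> by the moment \<open>c l\<close> of the kernel.  Because the profile has an absolutely convergent series, the
  kernel may be singular, provided that it is integrable.\<close>

theorem profile_convolution:
  fixes \<kappa> :: "real \<Rightarrow> real"
  assumes a: "0 < a" "a < 2" and s: "0 \<le> s" "s \<le> pi"
    and \<kappa>: "\<kappa> absolutely_integrable_on {0..pi}"
    and per: "\<And>t. \<kappa> (t + pi) = \<kappa> t"
    and m: "\<And>l. ((\<lambda>t. of_real (\<kappa> t) * cis (of_int (2 * l) * t)) has_integral c l) {0..pi}"
  shows "(\<lambda>t. profile a k t * of_real (\<kappa> (t - s))) absolutely_integrable_on {0..pi}"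
    and "((\<lambda>l. profile_coeff a k l / of_real pi * (cis (of_int (2 * l) * s) * c l)) has_sum
           integral {0..pi} (\<lambda>t. profile a k t * of_real (\<kappa> (t - s)))) UNIV"
proof -
  have ks: "(\<lambda>t. complex_of_real (\<kappa> (t - s))) absolutely_integrable_on {0..pi}"
    by (rule absolutely_integrable_periodic_shift[of "\<lambda>t. complex_of_real (\<kappa> t)"])
       (use per s absolutely_integrable_of_real[OF \<kappa>] in auto)
  show I: "(\<lambda>t. profile a k t * of_real (\<kappa> (t - s))) absolutely_integrable_on {0..pi}"
    by (intro absolutely_integrable_mult_continuous continuous_on_profile a ks)
  have perc: "of_real (\<kappa> (t + pi)) * cis (of_int (2 * l) * (t + pi)) = of_real (\<kappa> t) * cis (of_int (2 * l) * t)" for t l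
  proof -
    have "cis (of_int (2 * l) * (t + pi)) = cis (of_int (2 * l) * t) * cis (2 * pi * of_int l)"
      by (simp add: cis_mult algebra_simps)
    also have "cis (2 * pi * of_int l) = 1" by (rule cis_multiple_2pi) simp
    finally show ?thesis by (simp add: per)
  qed
  have ml: "((\<lambda>t. cis (of_int (2 * l) * t) * of_real (\<kappa> (t - s))) has_integral cis (of_int (2 * l) * s) * c l) {0..pi}" for l
  proof -
    have "((\<lambda>t. of_real (\<kappa> (t - s)) * cis (of_int (2 * l) * (t - s))) has_integral c l) {0..pi}"
      by (rule has_integral_periodic_shift[OF perc m s])
    then have "((\<lambda>t. cis (of_int (2 * l) * s) * (of_real (\<kappa> (t - s)) * cis (of_int (2 * l) * (t - s)))) has_integral cis (of_int (2 * l) * s) * c l) {0..pi}"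
      by (rule has_integral_mult_right)
    moreover have "cis (of_int (2 * l) * s) * (of_real (\<kappa> (t - s)) * cis (of_int (2 * l) * (t - s))) = cis (of_int (2 * l) * t) * of_real (\<kappa> (t - s))" for t
    proof -
      have "cis (of_int (2 * l) * t) = cis (of_int (2 * l) * s) * cis (of_int (2 * l) * (t - s))"
        by (simp add: cis_mult algebra_simps)
      then show ?thesis by (simp only: mult_ac)
    qed
    ultimately show ?thesis by (simp only:)
  qed
  have co: "(\<lambda>l. norm (profile_coeff a k l / of_real pi)) summable_on UNIV"
    using summable_on_cmult_right[OF summable_on_profile_coeff[OF a, of k], of "1 / pi"]
    by (simp add: norm_divide)
  show "((\<lambda>l. profile_coeff a k l / of_real pi * (cis (of_int (2 * l) * s) * c l)) has_sum
           integral {0..pi} (\<lambda>t. profile a k t * of_real (\<kappa> (t - s)))) UNIV"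
  proof (rule has_sum_integral_exchange[OF co, where S="{0<..<pi}" and e="\<lambda>l t. cis (of_int (2 * l) * t)"
       and \<kappa>="\<lambda>t. of_real (\<kappa> (t - s))" and f="profile a k"])
    show "(\<lambda>t. complex_of_real (\<kappa> (t - s))) absolutely_integrable_on {0<..<pi}"
      by (rule set_integrable_subset[OF ks]) auto
    show "((\<lambda>t. cis (of_int (2 * l) * t) * of_real (\<kappa> (t - s))) has_integral cis (of_int (2 * l) * s) * c l) {0<..<pi}" for l
      using ml[of l] by (simp only: has_integral_Icc_iff_Ioo)
    show "((\<lambda>t. profile a k t * of_real (\<kappa> (t - s))) has_integral integral {0..pi} (\<lambda>t. profile a k t * of_real (\<kappa> (t - s)))) {0<..<pi}"
      unfolding has_integral_Icc_iff_Ioo[symmetric] using I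
      by (intro integrable_integral) (simp add: absolutely_integrable_on_def)
    fix t assume t: "t \<in> {0<..<pi}"
    then obtain d where "(profile a k has_vector_derivative d) (at t)"
      using profile_differentiable[of t a k] by auto
    from fourier_inversion[OF continuous_on_profile[OF a(1)] this] t
    show "((\<lambda>l. profile_coeff a k l / of_real pi * cis (of_int (2 * l) * t)) has_sum profile a k t) UNIV"
      using summable_on_profile_coeff[OF a, of k] by (simp add: fourier_coeff_profile[OF a(1)])
  qed simp
qed

section \<open>Logarithmic moments\<close>

text \<open>This bound does double duty: it dominates \<open>ln (sin t)\<close> by an integrable power, and it gives the
  continuity of \<open>x * ln x\<close> at \<open>0\<close>.\<close>

lemma abs_ln_le_powr: "0 \<le> x \<Longrightarrow> x \<le> 1 \<Longrightarrow> \<bar>ln x\<bar> \<le> 2 * x powr (- (1/2))" for x :: real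
proof (cases "x = 0")
  case False
  assume x: "0 \<le> x" "x \<le> 1"
  then have p: "x powr (- (1/2)) > 0" using False by simp
  from ln_le_minus_one[OF p] have "- (1/2) * ln x \<le> x powr (- (1/2)) - 1" by simp
  moreover have "ln x \<le> 0" using x False by simp
  ultimately show ?thesis by simp
qed simp

lemma absolutely_integrable_ln_sin: "(\<lambda>t. ln (sin t)) absolutely_integrable_on {0..pi}"
proof (rule measurable_bounded_by_integrable_imp_absolutely_integrable)
  have "(\<lambda>t::real. ln (sin t)) \<in> borel_measurable borel" by measurable
  then show "(\<lambda>t. ln (sin t)) \<in> borel_measurable (lebesgue_on {0..pi})"
    by (intro measurable_restrict_space1 measurable_completion) simp
  have "(\<lambda>t. sin t powr (- (1/2))) absolutely_integrable_on {0..pi}"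
    by (rule sin_powr_integral) simp
  then have "(\<lambda>t. 2 * sin t powr (- (1/2))) absolutely_integrable_on {0..pi}"
    by (rule set_integrable_mult_right)
  then show "(\<lambda>t. 2 * sin t powr (- (1/2))) integrable_on {0..pi}"
    by (simp add: absolutely_integrable_on_def)
  fix t assume "t \<in> {0..pi}"
  then have "0 \<le> sin t" by (auto intro: sin_ge_zero)
  then show "norm (ln (sin t)) \<le> 2 * sin t powr (- (1/2))"
    using abs_ln_le_powr[of "sin t"] by simp
qed auto

text \<open>The product \<open>l * log_moment l\<close> is constant on the positive and on the negative integers.  The
  factor \<open>l\<close> hides the zeroth moment, in accordance with the profile of order one having mean zero.\<close>

definition log_moment :: "int \<Rightarrow> complex" where
  "log_moment l = integral {0..pi} (\<lambda>t. of_real (ln (sin t)) * cis (of_int (2 * l) * t))"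

lemma log_moment_has_integral:
  "((\<lambda>t. of_real (ln (sin t)) * cis (of_int (2 * l) * t)) has_integral log_moment l) {0..pi}"
proof -
  have "(\<lambda>t. cis (of_int (2 * l) * t) * complex_of_real (ln (sin t))) absolutely_integrable_on {0..pi}"
    by (intro absolutely_integrable_mult_continuous absolutely_integrable_of_real absolutely_integrable_ln_sin continuous_intros)
  then have "(\<lambda>t. complex_of_real (ln (sin t)) * cis (of_int (2 * l) * t)) integrable_on {0..pi}"
    by (simp add: absolutely_integrable_on_def mult.commute)
  then show ?thesis unfolding log_moment_def by (rule integrable_integral)
qed

lemma continuous_on_mult_ln: "continuous_on {0..1} (\<lambda>x::real. x * ln x)"
  unfolding continuous_on_def
proof
  fix x :: real assume x: "x \<in> {0..1}"
  show "((\<lambda>x. x * ln x) \<longlongrightarrow> x * ln x) (at x within {0..1})"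
  proof (cases "x = 0")
    case False
    then have "isCont (\<lambda>x. x * ln x) x" using x by (intro continuous_intros) auto
    then show ?thesis unfolding isCont_def by (rule tendsto_within_subset) simp
  next
    case True
    have "((\<lambda>x::real. x * ln x) \<longlongrightarrow> 0) (at 0 within {0..1})"
    proof (rule Lim_null_comparison)
      have "((\<lambda>x. 2 * sqrt x) \<longlongrightarrow> 2 * sqrt 0) (at 0 within {0..1})" by (intro tendsto_intros)
      then show "((\<lambda>x::real. 2 * sqrt x) \<longlongrightarrow> 0) (at 0 within {0..1})" by simp
      show "\<forall>\<^sub>F x in at 0 within {0..1}. norm (x * ln x) \<le> 2 * sqrt x"
        unfolding eventually_at_filter
      proof (intro always_eventually allI impI)
        fix y :: real assume "y \<noteq> 0" and y: "y \<in> {0..1}"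
        then have "y > 0" by simp
        have "norm (y * ln y) = y * \<bar>ln y\<bar>" using \<open>y > 0\<close> by (simp add: abs_mult)
        also have "\<dots> \<le> y * (2 * y powr (- (1/2)))"
          using abs_ln_le_powr[of y] y by (intro mult_left_mono) auto
        also have "\<dots> = 2 * (y powr 1 * y powr (- (1/2)))" using \<open>y > 0\<close> by simp
        also have "\<dots> = 2 * sqrt y" using \<open>y > 0\<close> by (simp only: powr_add[symmetric]) (simp add: powr_half_sqrt)
        finally show "norm (y * ln y) \<le> 2 * sqrt y" .
      qed
    qed
    then show ?thesis using True by simp
  qed
qed

text \<open>Integration of the derivative of \<open>sin t * ln (sin t) * cis ((2 * l + 1) * t)\<close>, which vanishes at
  both ends.  The inhomogeneous terms come from \<open>cos t * cis ((2 * l + 1) * t)\<close>, which has a nonzero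
  mean only for the frequencies \<open>\<plusminus> 1\<close>.\<close>

lemma log_moment_step:
  "of_int (l + 1) * log_moment (l + 1) = of_int l * log_moment l - (if l = 0 then of_real pi / 2 else 0) - (if l + 1 = 0 then of_real pi / 2 else 0)"
proof -
  let ?E = "\<lambda>t. cis (of_int (2 * l + 1) * t)"
  let ?F = "\<lambda>t. complex_of_real (sin t * ln (sin t)) * ?E t"
  let ?D = "\<lambda>t. of_real (sin t * ln (sin t)) * (\<i> * of_int (2 * l + 1) * ?E t) + of_real (cos t * ln (sin t) + cos t) * ?E t"
  have 1: "(?D has_integral (?F pi - ?F 0)) {0..pi}"
  proof (rule fundamental_theorem_of_calculus_interior)
    have c: "continuous_on {0..pi} (\<lambda>t. sin t * ln (sin t))"
      by (rule continuous_on_compose2[OF continuous_on_mult_ln continuous_on_sin]) (auto intro: sin_ge_zero continuous_intros)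
    show "continuous_on {0..pi} ?F"
      by (rule continuous_on_mult[OF continuous_on_of_real[OF c]]) (intro continuous_intros)
    fix t assume "t \<in> {0<..<pi}"
    then have s: "sin t > 0" by (auto intro: sin_gt_zero)
    then have "((\<lambda>t. sin t * ln (sin t)) has_real_derivative (cos t * ln (sin t) + cos t)) (at t)"
      by (auto intro!: derivative_eq_intros)
    then have "((\<lambda>t. complex_of_real (sin t * ln (sin t))) has_vector_derivative of_real (cos t * ln (sin t) + cos t)) (at t)"
      unfolding has_real_derivative_iff_has_vector_derivative
      by (rule bounded_linear.has_vector_derivative[OF bounded_linear_of_real])
    from has_vector_derivative_mult[OF this has_vector_derivative_cis_mult[of "of_int (2 * l + 1)"]]
    show "(?F has_vector_derivative ?D t) (at t)" by simp
  qed simp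
  let ?e = "\<lambda>l t. cis (of_int (2 * l) * t)"
  have 2: "((\<lambda>t. of_int (l+1) * (of_real (ln (sin t)) * ?e (l+1) t) - of_int l * (of_real (ln (sin t)) * ?e l t)
           + (?e (l+1) t + ?e l t) / 2) has_integral
        of_int (l+1) * log_moment (l+1) - of_int l * log_moment l
           + ((if l+1 = 0 then of_real pi else 0) + (if l = 0 then of_real pi else 0)) / 2) {0..pi}"
    by (intro has_integral_add has_integral_diff has_integral_mult_right has_integral_divide log_moment_has_integral integral_cis_even)
  have "of_int (l+1) * (of_real (ln (sin t)) * ?e (l+1) t) - of_int l * (of_real (ln (sin t)) * ?e l t)
           + (?e (l+1) t + ?e l t) / 2 = ?D t" for t
  proof -
    have e: "?e (l+1) t = cis t * ?E t" "?e l t = cis (-t) * ?E t" by (simp_all add: cis_mult algebra_simps)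
    have "(m + 1) * (G * (A * E)) - m * (G * (B * E)) + (A * E + B * E) / 2
        = ((A - B) / (2 * \<i>) * G) * (\<i> * (2 * m + 1) * E) + ((A + B) / 2 * G + (A + B) / 2) * E" for m G A B E :: complex
      by (simp add: field_simps)
    from this[of "of_int l" "of_real (ln (sin t))" "cis t" "?E t" "cis (-t)"]
    show ?thesis unfolding e of_real_mult of_real_add sin_cis cos_cis by simp
  qed
  with 2 have 3: "(?D has_integral
        of_int (l+1) * log_moment (l+1) - of_int l * log_moment l
           + ((if l+1 = 0 then of_real pi else 0) + (if l = 0 then of_real pi else 0)) / 2) {0..pi}"
    by (simp only:)
  from has_integral_unique[OF 1 3]
  have "of_int (l+1) * log_moment (l+1) - of_int l * log_moment l
           + ((if l+1 = 0 then of_real pi else 0) + (if l = 0 then of_real pi else 0)) / 2 = 0" by simp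
  then have "of_int (l+1) * log_moment (l+1) = of_int l * log_moment l
           - ((if l+1 = 0 then of_real pi else 0) + (if l = 0 then of_real pi else 0)) / 2"
    by (simp only: diff_add_eq right_minus_eq eq_diff_eq diff_eq_eq add_0)
  then show ?thesis by (simp split: if_splits)
qed

lemma log_moment: "of_int l * log_moment l = - (of_real pi / 2) * of_int (sgn l)"
proof -
  have pos: "of_int (int n + 1) * log_moment (int n + 1) = - (of_real pi / 2)" for n
  proof (induction n)
    case 0
    show ?case using log_moment_step[of 0] by simp
  next
    case (Suc n)
    have "of_int (int n + 1 + 1) * log_moment (int n + 1 + 1) = of_int (int n + 1) * log_moment (int n + 1)"
      using log_moment_step[of "int n + 1"] by simp
    moreover have "int (Suc n) + 1 = int n + 1 + 1" by simp
    ultimately show ?case using Suc.IH by (simp only:)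
  qed
  have neg: "of_int (- int n - 1) * log_moment (- int n - 1) = of_real pi / 2" for n
  proof (induction n)
    case 0
    show ?case using log_moment_step[of "-1"] by simp
  next
    case (Suc n)
    have "of_int (- int n - 2 + 1) * log_moment (- int n - 2 + 1) = of_int (- int n - 2) * log_moment (- int n - 2)"
      using log_moment_step[of "- int n - 2"] by simp
    moreover have "- int n - 2 + 1 = - int n - 1" "- int (Suc n) - 1 = - int n - 2" by simp_all
    ultimately show ?case using Suc.IH by (simp only:)
  qed
  consider "l = 0" | n where "l = int n + 1" | n where "l = - int n - 1"
  proof -
    have "l = int (nat (l - 1)) + 1" if "l > 0" using that by simp
    moreover have "l = - int (nat (- l - 1)) - 1" if "l < 0" using that by simp
    ultimately show ?thesis using that by (metis linorder_neqE)
  qed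
  then show ?thesis
  proof cases
    case (2 n)
    then have "sgn l = 1" by simp
    then show ?thesis using pos[of n] 2 by (simp only: of_int_1 mult_1_right)
  next
    case (3 n)
    then have "sgn l = -1" by simp
    then show ?thesis using neg[of n] 3 by simp
  qed simp
qed

section \<open>Integration by parts in the fractional Laplacian\<close>

lemma has_vector_derivative_complex_of_real:
  assumes "(f has_real_derivative d) (at x within S)"
  shows "((\<lambda>x. complex_of_real (f x)) has_vector_derivative of_real d) (at x within S)"
  using assms unfolding has_real_derivative_iff_has_vector_derivative
  by (rule bounded_linear.has_vector_derivative[OF bounded_linear_of_real])

lemma set_integrable_powr_to_inf:
  fixes e a :: real
  assumes "e > 0" "a > 0"
  shows "set_integrable lborel {e<..} (\<lambda>y. y powr (- a - 1))"
proof -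
  have "set_integrable lborel (einterval (ereal e) \<infinity>) (\<lambda>y. y powr (- a - 1))"
  proof (rule interval_integral_FTC_nonneg(1)[where F="\<lambda>y. - (y powr - a / a)" and A="- (e powr - a / a)" and B = 0])
    fix y :: real assume "ereal e < ereal y"
    then have y: "y > 0" using assms by simp
    show "((\<lambda>y. - (y powr - a / a)) has_real_derivative y powr (- a - 1)) (at y)"
      using y assms by (auto intro!: derivative_eq_intros has_real_derivative_powr simp: diff_minus_eq_add add.commute)
    show "isCont (\<lambda>y. y powr (- a - 1)) y"
      using y by (intro continuous_intros) auto
  next
    show "(((\<lambda>y. - (y powr - a / a)) \<circ> real_of_ereal) \<longlongrightarrow> - (e powr - a / a)) (at_right (ereal e))"
      unfolding ereal_tendsto_simps using assms by (intro tendsto_intros) auto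
    have "((\<lambda>y. - (y powr - a / a)) \<longlongrightarrow> - (0 / a)) at_top"
      using assms by (intro tendsto_intros tendsto_neg_powr filterlim_ident) auto
    then show "(((\<lambda>y. - (y powr - a / a)) \<circ> real_of_ereal) \<longlongrightarrow> 0) (at_left \<infinity>)"
      unfolding ereal_tendsto_simps by simp
  qed auto
  then show ?thesis by simp
qed

text \<open>Two integrations by parts at once: the derivative of \<open>V1 * K / a - V * y powr - a / a\<close> is
  \<open>V * y powr (- a - 1) + V2 * K / a\<close>, as the mixed terms \<open>V1 * y powr - a / a\<close> cancel.\<close>

lemma half_line_parts:
  fixes V V1 V2 :: "real \<Rightarrow> complex" and K :: "real \<Rightarrow> real"
  assumes a: "a > 0" and e: "e > 0"
    and V: "\<And>y. (V has_vector_derivative V1 y) (at y)"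
    and V1: "\<And>y. (V1 has_vector_derivative V2 y) (at y)"
    and V2: "\<And>y. isCont V2 y"
    and B: "\<And>y. norm (V y) \<le> B"
    and K: "\<And>y. 0 < y \<Longrightarrow> (K has_real_derivative y powr - a) (at y)"
    and lim: "((\<lambda>y. V1 y * of_real (K y)) \<longlongrightarrow> 0) at_top"
    and int: "set_integrable lborel {e<..} (\<lambda>y. V2 y * of_real (K y))"
  shows "set_integrable lborel {e<..} (\<lambda>y. V y * of_real (y powr (- a - 1)))"
    and "(LBINT y:{e<..}. V y * of_real (y powr (- a - 1))) =
           V e * of_real (e powr - a / a) - V1 e * of_real (K e / a)
           - (LBINT y:{e<..}. V2 y * of_real (K y)) / of_real a"
proof -
  let ?P = "\<lambda>y. V y * complex_of_real (y powr (- a - 1))"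
  have cV: "isCont V y" for y using V[of y] by (rule has_vector_derivative_continuous)
  have [measurable]: "V \<in> borel_measurable borel"
    by (intro borel_measurable_continuous_onI continuous_at_imp_continuous_on) (use cV in auto)
  show P: "set_integrable lborel {e<..} ?P"
  proof (rule set_integrable_bound)
    show "set_integrable lborel {e<..} (\<lambda>y. B * y powr (- a - 1))"
      by (intro set_integrable_mult_right set_integrable_powr_to_inf a e)
    show "set_borel_measurable lborel {e<..} ?P"
      unfolding set_borel_measurable_def by measurable
    show "AE y in lborel. y \<in> {e<..} \<longrightarrow> norm (?P y) \<le> norm (B * y powr (- a - 1))"
    proof (intro AE_I2 impI)
      fix y show "norm (?P y) \<le> norm (B * y powr (- a - 1))"
        using B[of y] norm_ge_zero[of "V y"] by (simp add: norm_mult abs_mult mult_right_mono)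
    qed
  qed
  have Q: "set_integrable lborel {e<..} (\<lambda>y. V2 y * of_real (K y) / of_real a)"
    using int by (rule set_integrable_divide)
  define F where "F = (\<lambda>y. V1 y * of_real (K y / a) - V y * of_real (y powr - a / a))"
  have "(LBINT y=ereal e..\<infinity>. ?P y + V2 y * of_real (K y) / of_real a) = 0 - F e"
  proof (rule interval_integral_FTC_integrable)
    fix y :: real assume "ereal e < ereal y"
    then have y: "y > 0" using e by simp
    have "((\<lambda>y. y powr - a / a) has_real_derivative - (y powr (- a - 1))) (at y)"
      using y a by (auto intro!: derivative_eq_intros has_real_derivative_powr simp: diff_minus_eq_add add.commute)
    note d1 = has_vector_derivative_mult[OF V has_vector_derivative_complex_of_real[OF this]]
    have "((\<lambda>y. K y / a) has_real_derivative y powr - a / a) (at y)"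
      by (rule DERIV_cdivide[OF K[OF y]])
    note d2 = has_vector_derivative_mult[OF V1 has_vector_derivative_complex_of_real[OF this]]
    show "(F has_vector_derivative ?P y + V2 y * of_real (K y) / of_real a) (at y)"
      using has_vector_derivative_diff[OF d2 d1] unfolding F_def by (simp add: algebra_simps)
    have "isCont K y" using K[OF y] by (rule DERIV_isCont)
    then show "isCont (\<lambda>y. ?P y + V2 y * of_real (K y) / of_real a) y"
      using y a V2[of y] cV[of y] by (intro continuous_intros) auto
  next
    show "set_integrable lborel (einterval (ereal e) \<infinity>) (\<lambda>y. ?P y + V2 y * of_real (K y) / of_real a)"
      using set_integral_add(1)[OF P Q] by simp
  next
    have cK: "isCont K e" using K[OF e] by (rule DERIV_isCont)
    have cV1: "isCont V1 e" using V1 by (rule has_vector_derivative_continuous)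
    have "isCont F e" unfolding F_def
      using a e cV[of e] cK cV1 by (intro continuous_intros) auto
    then have "(F \<longlongrightarrow> F e) (at_right e)"
      unfolding isCont_def by (rule tendsto_within_subset) simp
    then show "((F \<circ> real_of_ereal) \<longlongrightarrow> F e) (at_right (ereal e))"
      unfolding ereal_tendsto_simps .
  next
    have "((\<lambda>y. V y * of_real (y powr - a / a)) \<longlongrightarrow> 0) at_top"
    proof (rule Lim_null_comparison)
      have "((\<lambda>y. B * (y powr - a / a)) \<longlongrightarrow> B * (0 / a)) at_top"
        using a by (intro tendsto_intros tendsto_neg_powr filterlim_ident) auto
      then show "((\<lambda>y. B * (y powr - a / a)) \<longlongrightarrow> 0) at_top" by simp
      show "\<forall>\<^sub>F y in at_top. norm (V y * of_real (y powr - a / a)) \<le> B * (y powr - a / a)"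
        using B a by (intro always_eventually allI) (simp add: norm_mult norm_divide mult_right_mono divide_right_mono)
    qed
    moreover have "((\<lambda>y. V1 y * of_real (K y) / of_real a) \<longlongrightarrow> 0 / of_real a) at_top"
      by (intro tendsto_divide lim tendsto_const) (use a in auto)
    ultimately have "((\<lambda>y. V1 y * of_real (K y) / of_real a - V y * of_real (y powr - a / a)) \<longlongrightarrow> 0 / of_real a - 0) at_top"
      by (intro tendsto_diff)
    then have "(F \<longlongrightarrow> 0) at_top" by (simp add: F_def)
    then show "((F \<circ> real_of_ereal) \<longlongrightarrow> 0) (at_left \<infinity>)"
      unfolding ereal_tendsto_simps .
  qed auto
  then have "(LBINT y:{e<..}. ?P y + V2 y * of_real (K y) / of_real a) = - F e"
    by (simp add: interval_lebesgue_integral_le_eq)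
  then have "(LBINT y:{e<..}. ?P y) + (LBINT y:{e<..}. V2 y * of_real (K y)) / of_real a = - F e"
    by (subst (asm) set_integral_add(2)[OF P Q]) simp
  then show "(LBINT y:{e<..}. ?P y) = V e * of_real (e powr - a / a) - V1 e * of_real (K e / a)
           - (LBINT y:{e<..}. V2 y * of_real (K y)) / of_real a"
    by (simp add: F_def algebra_simps)
qed

lemma set_integrable_eq_on:
  assumes "set_integrable M A f" "\<And>x. x \<in> A \<Longrightarrow> f x = g x"
  shows "set_integrable M A g"
  using assms set_integrable_cong[of M M A A f g] by auto

lemma set_integrable_reflect:
  fixes f :: "real \<Rightarrow> complex"
  assumes "set_integrable lborel {e<..} (\<lambda>y. f (- y))"
  shows "set_integrable lborel {..<-e} f"
proof -
  have "integrable lborel (\<lambda>y. indicator {e<..} (0 + (-1) * y) *\<^sub>R f (- (0 + (-1) * y)))"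
    using assms unfolding set_integrable_def by (rule lborel_integrable_real_affine) simp
  also have "(\<lambda>y. indicator {e<..} (0 + (-1) * y) *\<^sub>R f (- (0 + (-1) * y))) = (\<lambda>y. indicator {..<-e} y *\<^sub>R f y)"
    by (auto simp: fun_eq_iff indicator_def)
  finally show ?thesis unfolding set_integrable_def .
qed

text \<open>Dominated convergence; the limit integral sees the whole line because a point has measure zero.\<close>

lemma tendsto_integral_outside_0:
  fixes G :: "real \<Rightarrow> complex"
  assumes G: "integrable lborel G"
  shows "((\<lambda>e. LBINT y:{y. e < \<bar>y\<bar>}. G y) \<longlongrightarrow> (LBINT y. G y)) (at_right 0)"
proof (rule tendsto_at_right_sequentially[of 0 1])
  fix S :: "nat \<Rightarrow> real" assume S: "S \<longlonglongrightarrow> 0"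
  have [measurable]: "G \<in> borel_measurable borel" using G by auto
  show "(\<lambda>n. LBINT y:{y. S n < \<bar>y\<bar>}. G y) \<longlonglongrightarrow> (LBINT y. G y)"
    unfolding set_lebesgue_integral_def
  proof (rule integral_dominated_convergence[where w="\<lambda>y. norm (G y)"])
    show "integrable lborel (\<lambda>y. norm (G y))" using G by simp
    have "AE y in lborel. y \<noteq> (0::real)" by (rule AE_lborel_singleton)
    then show "AE y in lborel. (\<lambda>n. indicat_real {y. S n < \<bar>y\<bar>} y *\<^sub>R G y) \<longlonglongrightarrow> G y"
    proof eventually_elim
      fix y :: real assume "y \<noteq> 0"
      then have "\<forall>\<^sub>F n in sequentially. S n < \<bar>y\<bar>" using order_tendstoD(2)[OF S] by simp
      then have "\<forall>\<^sub>F n in sequentially. indicat_real {y. S n < \<bar>y\<bar>} y *\<^sub>R G y = G y"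
        by eventually_elim simp
      then show "(\<lambda>n. indicat_real {y. S n < \<bar>y\<bar>} y *\<^sub>R G y) \<longlonglongrightarrow> G y"
        by (rule tendsto_eventually)
    qed
    show "AE y in lborel. norm (indicat_real {y. S n < \<bar>y\<bar>} y *\<^sub>R G y) \<le> norm (G y)" for n
      by (intro AE_I2) (simp add: indicator_def)
  qed measurable
qed simp

text \<open>On each half line the truncated integral is rewritten by \<open>half_line_parts\<close>.  Adding the two
  contributions, the boundary terms contain \<open>2 * u x - u (x + e) - u (x - e)\<close> and
  \<open>u1 (x + e) - u1 (x - e)\<close>.  These are \<open>O(e\<^sup>2)\<close> and \<open>O(e)\<close> because \<open>u2\<close> is bounded, which beats the
  singularities of \<open>e powr - a\<close> and \<open>K e\<close> since \<open>a < 2\<close>.  This cancellation is where the principal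
  value is used.\<close>

theorem has_frac_laplacian_kernel:
  fixes u u1 u2 :: "real \<Rightarrow> complex" and K :: "real \<Rightarrow> real"
  assumes a: "0 < a" "a < 2"
    and u: "\<And>y. (u has_vector_derivative u1 y) (at y)"
    and u1: "\<And>y. (u1 has_vector_derivative u2 y) (at y)"
    and u2: "\<And>y. isCont u2 y"
    and B: "\<And>y. norm (u y) \<le> B" and M: "\<And>y. norm (u2 y) \<le> M"
    and K: "\<And>y. 0 < y \<Longrightarrow> (K has_real_derivative y powr - a) (at y)"
    and K0: "((\<lambda>e. e * K e) \<longlongrightarrow> 0) (at_right 0)"
    and lim1: "((\<lambda>y. u1 (x + y) * of_real (K y)) \<longlongrightarrow> 0) at_top"
    and lim2: "((\<lambda>y. u1 (x - y) * of_real (K y)) \<longlongrightarrow> 0) at_top"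
    and int: "integrable lborel (\<lambda>y. u2 (x + y) * of_real (K \<bar>y\<bar>))"
  shows "has_frac_laplacian a u x (of_real (frac_const a / a) * (LBINT y. u2 (x + y) * of_real (K \<bar>y\<bar>)))"
proof -
  define G where "G = (\<lambda>y. u2 (x + y) * complex_of_real (K \<bar>y\<bar>))"
  have G: "integrable lborel G" using int by (simp add: G_def)
  define w where "w = (\<lambda>y. 2 * u x - u (x + y) - u (x - y))"
  define E where "E = (\<lambda>e. w e * of_real (e powr - a / a) + (u1 (x + e) - u1 (x - e)) * of_real (K e / a))"
  let ?\<phi> = "frac_integrand a u x"
  have up: "((\<lambda>y. f (x + y)) has_vector_derivative f' (x + y)) (at y)"
   and um: "((\<lambda>y. f (x - y)) has_vector_derivative - f' (x - y)) (at y)"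
    if "\<And>y. (f has_vector_derivative f' y) (at y)" for f f' :: "real \<Rightarrow> complex" and y
  proof -
    have "((+) x has_vector_derivative 1) (at y)" "((-) x has_vector_derivative -1) (at y)"
      by (auto intro!: derivative_eq_intros)
    from vector_diff_chain_at[OF this(1) that] vector_diff_chain_at[OF this(2) that]
    show "((\<lambda>y. f (x + y)) has_vector_derivative f' (x + y)) (at y)"
         "((\<lambda>y. f (x - y)) has_vector_derivative - f' (x - y)) (at y)" by (simp_all add: o_def)
  qed
  have c2: "isCont (\<lambda>y. - u2 (x + y)) y" "isCont (\<lambda>y. - u2 (x - y)) y" for y
    by (rule isCont_minus, rule isCont_o2[OF _ u2], intro continuous_intros)+
  have main: "set_integrable lborel {y. e < \<bar>y\<bar>} ?\<phi> \<and>
      (LBINT y:{y. e < \<bar>y\<bar>}. ?\<phi> y) = E e + (LBINT y:{y. e < \<bar>y\<bar>}. G y) / of_real a" if e: "e > 0" for e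
  proof -
    have Gset: "set_integrable lborel S G" if "S \<in> sets lborel" for S
      using integrable_mult_indicator[OF that G] unfolding set_integrable_def .
    have sets: "{e<..} \<in> sets lborel" "{..<-e} \<in> sets lborel" by auto
    have "integrable lborel (\<lambda>y. G (0 + (-1) * y))"
      using G by (rule lborel_integrable_real_affine) simp
    then have Gm: "set_integrable lborel {e<..} (\<lambda>y. G (- y))"
      using integrable_mult_indicator[OF sets(1)] unfolding set_integrable_def by simp
    have eqp: "-1 * G y = - u2 (x + y) * of_real (K y)" if "y \<in> {e<..}" for y using that e by (simp add: G_def)
    have eqm: "-1 * G (- y) = - u2 (x - y) * of_real (K y)" if "y \<in> {e<..}" for y using that e by (simp add: G_def)
    have ip: "set_integrable lborel {e<..} (\<lambda>y. - u2 (x + y) * of_real (K y))"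
      by (rule set_integrable_eq_on[OF _ eqp], rule set_integrable_mult_right, rule Gset[OF sets(1)])
    have im: "set_integrable lborel {e<..} (\<lambda>y. - u2 (x - y) * of_real (K y))"
      by (rule set_integrable_eq_on[OF _ eqm], rule set_integrable_mult_right, rule Gm)
    have Bp: "norm (u x - u z) \<le> B + B" for z
      using norm_triangle_ineq4[of "u x" "u z"] B[of x] B[of z] by linarith
    have dp: "((\<lambda>y. u x - u (x + y)) has_vector_derivative - u1 (x + y)) (at y)" for y
      using has_vector_derivative_diff[OF has_vector_derivative_const up[OF u]] by simp
    have dm: "((\<lambda>y. u x - u (x - y)) has_vector_derivative u1 (x - y)) (at y)" for y
      using has_vector_derivative_diff[OF has_vector_derivative_const um[OF u]] by simp
    have lim1': "((\<lambda>y. - u1 (x + y) * of_real (K y)) \<longlongrightarrow> 0) at_top"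
      using tendsto_minus[OF lim1] by simp
    note dp1 = has_vector_derivative_minus[OF up[OF u1]] and dm1 = um[OF u1]
    have R: "set_integrable lborel {e<..} (\<lambda>y. (u x - u (x + y)) * of_real (y powr (- a - 1)))"
      "(LBINT y:{e<..}. (u x - u (x + y)) * of_real (y powr (- a - 1))) =
        (u x - u (x + e)) * of_real (e powr - a / a) - (- u1 (x + e)) * of_real (K e / a)
           - (LBINT y:{e<..}. - u2 (x + y) * of_real (K y)) / of_real a"
      by (rule half_line_parts[OF a(1) e dp dp1 c2(1) Bp _ lim1' ip]; rule K; assumption)+
    have L: "set_integrable lborel {e<..} (\<lambda>y. (u x - u (x - y)) * of_real (y powr (- a - 1)))"
      "(LBINT y:{e<..}. (u x - u (x - y)) * of_real (y powr (- a - 1))) =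
        (u x - u (x - e)) * of_real (e powr - a / a) - u1 (x - e) * of_real (K e / a)
           - (LBINT y:{e<..}. - u2 (x - y) * of_real (K y)) / of_real a"
      by (rule half_line_parts[OF a(1) e dm dm1 c2(2) Bp _ lim2 im]; rule K; assumption)+
    have pe: "\<And>y. y \<in> {e<..} \<Longrightarrow> (u x - u (x + y)) * of_real (y powr (- a - 1)) = ?\<phi> y"
      and me: "\<And>y. y \<in> {e<..} \<Longrightarrow> (u x - u (x - y)) * of_real (y powr (- a - 1)) = ?\<phi> (- y)"
    proof -
      fix y assume "y \<in> {e<..}"
      then have y: "y > 0" using e by simp
      have "- a - 1 = - (1 + a)" by simp
      then have "y powr (- a - 1) = 1 / y powr (1 + a)" by (simp only: powr_minus_divide)
      then show "(u x - u (x + y)) * of_real (y powr (- a - 1)) = ?\<phi> y"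
        "(u x - u (x - y)) * of_real (y powr (- a - 1)) = ?\<phi> (- y)"
        using y by (simp_all add: frac_integrand_def)
    qed
    have Ip: "set_integrable lborel {e<..} ?\<phi>"
      by (rule set_integrable_eq_on[OF R(1) pe])
    have Im': "set_integrable lborel {e<..} (\<lambda>y. ?\<phi> (- y))"
      by (rule set_integrable_eq_on[OF L(1) me])
    then have Im: "set_integrable lborel {..<-e} ?\<phi>" by (rule set_integrable_reflect)
    have U: "{y. e < \<bar>y\<bar>} = {e<..} \<union> {..<-e}" "{e<..} \<inter> {..<-e} = {}" using e by auto
    have refl: "{y. - y \<in> {..<-e}} = {e<..}" by auto
    have "(LBINT y:{y. e < \<bar>y\<bar>}. ?\<phi> y) = (LBINT y:{e<..}. ?\<phi> y) + (LBINT y:{..<-e}. ?\<phi> y)"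
      unfolding U(1) by (rule set_integral_Un[OF U(2) Ip Im])
    also have "(LBINT y:{..<-e}. ?\<phi> y) = (LBINT y:{e<..}. ?\<phi> (- y))"
      by (subst set_integral_reflect) (simp only: refl)
    also have "\<dots> = (LBINT y:{e<..}. (u x - u (x - y)) * of_real (y powr (- a - 1)))"
      by (rule set_lebesgue_integral_cong) (use me in auto)
    also have "\<dots> = (u x - u (x - e)) * of_real (e powr - a / a) - u1 (x - e) * of_real (K e / a)
           - (LBINT y:{e<..}. - u2 (x - y) * of_real (K y)) / of_real a"
      by (rule L(2))
    also have "(LBINT y:{e<..}. ?\<phi> y) = (LBINT y:{e<..}. (u x - u (x + y)) * of_real (y powr (- a - 1)))"
      by (rule set_lebesgue_integral_cong) (use pe in auto)
    also have "\<dots> = (u x - u (x + e)) * of_real (e powr - a / a) - (- u1 (x + e)) * of_real (K e / a)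
           - (LBINT y:{e<..}. - u2 (x + y) * of_real (K y)) / of_real a"
      by (rule R(2))
    also have "(LBINT y:{e<..}. - u2 (x + y) * of_real (K y)) = (LBINT y:{e<..}. -1 * G y)"
      by (rule set_lebesgue_integral_cong) (use eqp in auto)
    also have "\<dots> = - (LBINT y:{e<..}. G y)"
      unfolding set_lebesgue_integral_def by simp
    also have "(LBINT y:{e<..}. - u2 (x - y) * of_real (K y)) = (LBINT y:{e<..}. -1 * G (- y))"
      by (rule set_lebesgue_integral_cong) (use eqm in auto)
    also have "\<dots> = - (LBINT y:{e<..}. G (- y))"
      unfolding set_lebesgue_integral_def by simp
    also have "(LBINT y:{e<..}. G (- y)) = (LBINT y:{..<-e}. G y)"
      by (subst (2) set_integral_reflect) (simp only: refl)
    finally have 1: "(LBINT y:{y. e < \<bar>y\<bar>}. ?\<phi> y) =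
         (u x - u (x + e)) * of_real (e powr - a / a) - (- u1 (x + e)) * of_real (K e / a)
           - (- (LBINT y:{e<..}. G y)) / of_real a
       + ((u x - u (x - e)) * of_real (e powr - a / a) - u1 (x - e) * of_real (K e / a)
           - (- (LBINT y:{..<-e}. G y)) / of_real a)" .
    have "(LBINT y:{y. e < \<bar>y\<bar>}. G y) = (LBINT y:{e<..}. G y) + (LBINT y:{..<-e}. G y)"
      unfolding U(1) by (rule set_integral_Un[OF U(2) Gset[OF sets(1)] Gset[OF sets(2)]])
    note 2 = this
    have ring: "A * P - (- B) * Q - (- g) / c + (C * P - D * Q - (- h) / c) = (A + C) * P + (B - D) * Q + (g + h) / c"
      for A B C D P Q g h c :: complex by (simp add: algebra_simps add_divide_distrib)
    have "w e = (u x - u (x + e)) + (u x - u (x - e))" by (simp add: w_def)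
    then have "(LBINT y:{y. e < \<bar>y\<bar>}. ?\<phi> y) = E e + (LBINT y:{y. e < \<bar>y\<bar>}. G y) / of_real a"
      unfolding E_def 1 2 ring by (simp only:)
    moreover have "set_integrable lborel {y. e < \<bar>y\<bar>} ?\<phi>"
      unfolding U(1) by (rule set_integrable_Un[OF Ip Im]) auto
    ultimately show ?thesis by blast
  qed
  have M0: "M \<ge> 0" using M[of 0] norm_ge_zero order_trans by blast
  have lip: "norm (u1 p - u1 q) \<le> M * norm (p - q)" for p q
  proof (rule differentiable_bound[where S=UNIV and f'="\<lambda>x h. h *\<^sub>R u2 x"])
    show "(u1 has_derivative (\<lambda>h. h *\<^sub>R u2 z)) (at z within UNIV)" for z
      using u1[of z] by (simp add: has_vector_derivative_def)
    show "onorm (\<lambda>h. h *\<^sub>R u2 z) \<le> M" for z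
    proof (rule onorm_bound[OF M0])
      show "norm (h *\<^sub>R u2 z) \<le> M * norm h" for h :: real
        using mult_right_mono[OF M[of z], of "\<bar>h\<bar>"] by (simp add: mult.commute)
    qed
  qed auto
  have wb: "norm (w e) \<le> M * e^2" if e: "e > 0" for e
  proof -
    have dw: "(w has_vector_derivative (u1 (x - t) - u1 (x + t))) (at t)" for t
      using has_vector_derivative_diff[OF has_vector_derivative_diff[OF has_vector_derivative_const up[OF u]] um[OF u], of "2 * u x"]
      unfolding w_def by simp
    have "norm (w e - w 0) \<le> M * e^2 - M * 0^2"
    proof (rule differentiable_bound_general[where f'="\<lambda>t. u1 (x - t) - u1 (x + t)" and \<phi>="\<lambda>t. M * t^2" and \<phi>'="\<lambda>t. M * (2 * t)"])
      show "continuous_on {0..e} w"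
        using dw by (intro continuous_at_imp_continuous_on ballI has_vector_derivative_continuous)
      show "((\<lambda>t. M * t^2) has_vector_derivative M * (2 * t)) (at t)" for t
        unfolding has_real_derivative_iff_has_vector_derivative[symmetric]
        by (auto intro!: derivative_eq_intros)
      show "norm (u1 (x - t) - u1 (x + t)) \<le> M * (2 * t)" if "0 < t" for t
        using lip[of "x - t" "x + t"] that by simp
    qed (use e dw in \<open>auto intro!: continuous_intros\<close>)
    then show ?thesis by (simp add: w_def)
  qed
  have E: "(E \<longlongrightarrow> 0) (at_right 0)"
  proof (rule Lim_null_comparison)
    have "((\<lambda>e. M / a * e powr (2 - a) + 2 * M / a * \<bar>e * K e\<bar>) \<longlongrightarrow> M / a * 0 + 2 * M / a * \<bar>0\<bar>) (at_right 0)"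
    proof (intro tendsto_intros K0)
      show "((\<lambda>e::real. e powr (2 - a)) \<longlongrightarrow> 0) (at_right 0)"
      proof (rule tendsto_zero_powrI[where b="2 - a"])
        show "((\<lambda>e::real. e) \<longlongrightarrow> 0) (at_right 0)" by (rule tendsto_ident_at)
        show "\<forall>\<^sub>F e in at_right (0::real). 0 \<le> e"
          using eventually_at_right_less[of "0::real"] by (rule eventually_mono) simp
      qed (use a in simp_all)
    qed
    then show "((\<lambda>e. M / a * e powr (2 - a) + 2 * M / a * \<bar>e * K e\<bar>) \<longlongrightarrow> 0) (at_right 0)" by simp
    show "\<forall>\<^sub>F e in at_right 0. norm (E e) \<le> M / a * e powr (2 - a) + 2 * M / a * \<bar>e * K e\<bar>"
      using eventually_at_right_less[of "0::real"]
    proof eventually_elim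
      fix e :: real assume e: "0 < e"
      have "norm (w e * of_real (e powr - a / a)) = norm (w e) * (e powr - a / a)"
        using a by (simp add: norm_mult norm_divide)
      also have "\<dots> \<le> M * e^2 * (e powr - a / a)"
        by (intro mult_right_mono wb e) (use a in auto)
      also have "\<dots> = M / a * e powr (2 - a)"
        using e by (simp add: powr_diff powr_minus_divide)
      finally have t1: "norm (w e * of_real (e powr - a / a)) \<le> M / a * e powr (2 - a)" .
      have "norm ((u1 (x + e) - u1 (x - e)) * of_real (K e / a)) = norm (u1 (x + e) - u1 (x - e)) * (\<bar>K e\<bar> / a)"
        using a by (simp add: norm_mult norm_divide)
      also have "\<dots> \<le> (M * (2 * e)) * (\<bar>K e\<bar> / a)"
        by (intro mult_right_mono) (use lip[of "x + e" "x - e"] e a in auto)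
      also have "\<dots> = 2 * M / a * \<bar>e * K e\<bar>" using e by (simp add: abs_mult)
      finally have t2: "norm ((u1 (x + e) - u1 (x - e)) * of_real (K e / a)) \<le> 2 * M / a * \<bar>e * K e\<bar>" .
      show "norm (E e) \<le> M / a * e powr (2 - a) + 2 * M / a * \<bar>e * K e\<bar>"
        unfolding E_def by (rule norm_triangle_mono[OF t1 t2])
    qed
  qed
  have "((\<lambda>e. of_real (frac_const a) * (E e + (LBINT y:{y. e < \<bar>y\<bar>}. G y) / of_real a))
     \<longlongrightarrow> of_real (frac_const a) * (0 + (LBINT y. G y) / of_real a)) (at_right 0)"
    by (intro tendsto_intros E tendsto_integral_outside_0 G) (use a in auto)
  moreover have "\<forall>\<^sub>F e in at_right 0. of_real (frac_const a) * (E e + (LBINT y:{y. e < \<bar>y\<bar>}. G y) / of_real a)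
      = of_real (frac_const a) * (LBINT y:{y. e < \<bar>y\<bar>}. ?\<phi> y)"
    using eventually_at_right_less[of "0::real"] by eventually_elim (simp add: main)
  ultimately have "((\<lambda>e. of_real (frac_const a) * (LBINT y:{y. e < \<bar>y\<bar>}. ?\<phi> y))
     \<longlongrightarrow> of_real (frac_const a) * (0 + (LBINT y. G y) / of_real a)) (at_right 0)"
    by (rule Lim_transform_eventually)
  then show ?thesis
    unfolding has_frac_laplacian_def using main by (simp add: G_def)
qed

section \<open>The mapped exponentials\<close>

text \<open>The exponential \<open>cis (k * t)\<close> transported to the line by \<open>x = L * cot t\<close>.\<close>

definition wave :: "real \<Rightarrow> int \<Rightarrow> real \<Rightarrow> complex" where
  "wave L k x = cis (of_int k * arccot (x / L))"

text \<open>Minus the derivative of \<open>x \<mapsto> arccot (x / L)\<close>.\<close>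

definition slope :: "real \<Rightarrow> real \<Rightarrow> real" where
  "slope L x = L / (L\<^sup>2 + x\<^sup>2)"

definition slope_deriv :: "real \<Rightarrow> real \<Rightarrow> real" where
  "slope_deriv L x = - (2 * x * L) / (L\<^sup>2 + x\<^sup>2)\<^sup>2"

definition wave_deriv :: "real \<Rightarrow> int \<Rightarrow> real \<Rightarrow> complex" where
  "wave_deriv L k x = of_real (slope L x) * (- (\<i> * of_int k) * wave L k x)"

definition wave_deriv2 :: "real \<Rightarrow> int \<Rightarrow> real \<Rightarrow> complex" where
  "wave_deriv2 L k x = (- (\<i> * of_int k * of_real (slope_deriv L x)) - of_real ((of_int k * slope L x)\<^sup>2)) * wave L k x"

lemma on_line_exp: "on_line L (\<lambda>t. exp (\<i> * of_int k * complex_of_real t)) = wave L k"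
  by (simp add: fun_eq_iff on_line_def wave_def cis_conv_exp mult_ac)

lemma norm_wave: "norm (wave L k x) = 1"
  by (simp add: wave_def)

context
  fixes L :: real assumes L: "L > 0"
begin

lemma denominator_pos: "L\<^sup>2 + x\<^sup>2 > 0"
  using L by (simp add: add_pos_nonneg)

lemma wave_derivative: "(wave L k has_vector_derivative wave_deriv L k x) (at x)"
proof -
  have "((\<lambda>x. arccot (x / L)) has_real_derivative - slope L x) (at x)"
    unfolding arccot_eq slope_def using L denominator_pos[of x]
    by (auto intro!: derivative_eq_intros simp: field_simps power2_eq_square)
  then have "((\<lambda>x. arccot (x / L)) has_vector_derivative - slope L x) (at x)"
    by (simp add: has_real_derivative_iff_has_vector_derivative)
  from vector_diff_chain_at[OF this has_vector_derivative_cis_mult[of "of_int k"]]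
  show ?thesis unfolding wave_deriv_def wave_def o_def
    by (simp add: scaleR_conv_of_real mult_ac)
qed

lemma slope_derivative: "(slope L has_real_derivative slope_deriv L x) (at x)"
  unfolding slope_def slope_deriv_def using denominator_pos[of x]
  by (auto intro!: derivative_eq_intros simp: field_simps power2_eq_square)

lemma wave_deriv_derivative: "(wave_deriv L k has_vector_derivative wave_deriv2 L k x) (at x)"
proof -
  have "((\<lambda>x. of_real (slope L x) * (- (\<i> * of_int k) * wave L k x)) has_vector_derivative
     (of_real (slope L x) * (- (\<i> * of_int k) * wave_deriv L k x) + of_real (slope_deriv L x) * (- (\<i> * of_int k) * wave L k x))) (at x)"
    by (intro has_vector_derivative_mult has_vector_derivative_complex_of_real slope_derivative
          has_vector_derivative_mult_right wave_derivative)
  moreover have "(\<lambda>x. of_real (slope L x) * (- (\<i> * of_int k) * wave L k x)) = wave_deriv L k"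
    by (simp add: fun_eq_iff wave_deriv_def)
  moreover have "of_real (slope L x) * (- (\<i> * of_int k) * wave_deriv L k x) + of_real (slope_deriv L x) * (- (\<i> * of_int k) * wave L k x) = wave_deriv2 L k x"
  proof -
    have ring: "r * (- (\<i> * k) * (r * (- (\<i> * k) * b))) + r' * (- (\<i> * k) * b) = (- (\<i> * k * r') - (k * r)\<^sup>2) * b"
      for r r' k b :: complex
    proof -
      have "r * (- (\<i> * k) * (r * (- (\<i> * k) * b))) = (\<i> * \<i>) * ((k * r)\<^sup>2 * b)" by (simp only: power2_eq_square) (simp add: mult_ac)
      then show ?thesis by (simp add: algebra_simps power2_eq_square)
    qed
    show ?thesis unfolding wave_deriv_def wave_deriv2_def
      using ring[of "of_real (slope L x)" "of_int k" "wave L k x" "of_real (slope_deriv L x)"] by simp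
  qed
  ultimately show ?thesis by simp
qed

lemma isCont_wave_deriv2: "isCont (wave_deriv2 L k) x"
proof -
  have b: "isCont (wave L k) x" using wave_derivative by (rule has_vector_derivative_continuous)
  have k: "isCont (slope L) x" using slope_derivative by (rule DERIV_isCont)
  have k': "isCont (slope_deriv L) x" unfolding slope_deriv_def
    using denominator_pos[of x] by (intro continuous_intros) auto
  show ?thesis unfolding wave_deriv2_def[abs_def]
    by (intro continuous_intros b k k')
qed

lemma slope_bounds: "0 \<le> slope L x" "slope L x \<le> 1 / L" "\<bar>slope_deriv L x\<bar> \<le> 1 / L\<^sup>2"
proof -
  show "0 \<le> slope L x" unfolding slope_def using L denominator_pos[of x] by simp
  have "L / (L\<^sup>2 + x\<^sup>2) \<le> L / L\<^sup>2"
    using L by (intro divide_left_mono) (auto intro: mult_pos_pos denominator_pos)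
  then show "slope L x \<le> 1 / L" using L by (simp add: slope_def power2_eq_square)
  have "2 * \<bar>x\<bar> * L \<le> L\<^sup>2 + x\<^sup>2"
    using sum_squares_bound[of "\<bar>x\<bar>" L] by simp
  then have "\<bar>slope_deriv L x\<bar> \<le> (L\<^sup>2 + x\<^sup>2) / (L\<^sup>2 + x\<^sup>2)\<^sup>2"
    unfolding slope_deriv_def abs_divide using L by (simp add: abs_mult divide_right_mono)
  also have "\<dots> = 1 / (L\<^sup>2 + x\<^sup>2)" using denominator_pos[of x] by (simp add: power2_eq_square)
  also have "\<dots> \<le> 1 / L\<^sup>2"
    using L by (intro divide_left_mono) (auto intro: mult_pos_pos denominator_pos)
  finally show "\<bar>slope_deriv L x\<bar> \<le> 1 / L\<^sup>2" .
qed

lemma norm_wave_deriv2_bound: "norm (wave_deriv2 L k x) \<le> \<bar>of_int k\<bar> * (1 / L\<^sup>2) + (\<bar>of_int k\<bar> * (1 / L))\<^sup>2"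
proof -
  have "norm (wave_deriv2 L k x) = norm (- (\<i> * of_int k * of_real (slope_deriv L x)) - of_real ((of_int k * slope L x)\<^sup>2))"
    by (simp add: wave_deriv2_def norm_mult norm_wave)
  also have "\<dots> \<le> norm (- (\<i> * of_int k * of_real (slope_deriv L x))) + norm (complex_of_real ((of_int k * slope L x)\<^sup>2))"
    by (rule norm_triangle_ineq4)
  also have "\<dots> = \<bar>of_int k\<bar> * \<bar>slope_deriv L x\<bar> + (\<bar>of_int k\<bar> * slope L x)\<^sup>2"
    using slope_bounds(1)[of x] by (simp add: norm_mult power_mult_distrib norm_power)
  also have "\<dots> \<le> \<bar>of_int k\<bar> * (1 / L\<^sup>2) + (\<bar>of_int k\<bar> * (1 / L))\<^sup>2"
    using slope_bounds[of x] by (intro add_mono mult_left_mono power_mono) auto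
  finally show ?thesis .
qed

text \<open>The derivative decays like \<open>y powr - 2\<close>, while \<open>K\<close> grows at most linearly.\<close>

lemma wave_deriv_decay:
  assumes K: "\<forall>\<^sub>F y in at_top. \<bar>K y\<bar> \<le> C * y" and \<sigma>: "\<sigma> = 1 \<or> \<sigma> = -1"
  shows "((\<lambda>y. wave_deriv L k (x + \<sigma> * y) * of_real (K y)) \<longlongrightarrow> 0) at_top"
proof (rule Lim_null_comparison)
  have "((\<lambda>y. \<bar>of_int k\<bar> * 4 * L * C * inverse y) \<longlongrightarrow> \<bar>of_int k\<bar> * 4 * L * C * 0) at_top"
    by (intro tendsto_intros tendsto_inverse_0_at_top filterlim_ident)
  then show "((\<lambda>y. \<bar>of_int k\<bar> * 4 * L * C * inverse y) \<longlongrightarrow> 0) at_top" by simp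
  show "\<forall>\<^sub>F y in at_top. norm (wave_deriv L k (x + \<sigma> * y) * of_real (K y)) \<le> \<bar>of_int k\<bar> * 4 * L * C * inverse y"
    using K eventually_gt_at_top[of "2 * \<bar>x\<bar>"]
  proof eventually_elim
    fix y assume Ky: "\<bar>K y\<bar> \<le> C * y" and y: "2 * \<bar>x\<bar> < y"
    then have y0: "y > 0" by simp
    have "y / 2 \<le> \<bar>x + \<sigma> * y\<bar>" using \<sigma> y by auto
    then have "(y / 2)\<^sup>2 \<le> \<bar>x + \<sigma> * y\<bar>\<^sup>2" using y0 by (intro power_mono) auto
    then have "(y / 2)\<^sup>2 \<le> L\<^sup>2 + (x + \<sigma> * y)\<^sup>2" by (simp add: add_increasing)
    then have "slope L (x + \<sigma> * y) \<le> L / (y / 2)\<^sup>2"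
      unfolding slope_def using L y0 by (intro divide_left_mono) (auto intro!: mult_pos_pos denominator_pos)
    also have "\<dots> = 4 * L * inverse y * inverse y" using y0 by (simp add: field_simps power2_eq_square)
    finally have kb: "slope L (x + \<sigma> * y) \<le> 4 * L * inverse y * inverse y" .
    have "norm (wave_deriv L k (x + \<sigma> * y) * of_real (K y)) = \<bar>of_int k\<bar> * (slope L (x + \<sigma> * y) * \<bar>K y\<bar>)"
      using slope_bounds(1)[of "x + \<sigma> * y"] by (simp add: wave_deriv_def norm_mult norm_wave)
    also have "\<dots> \<le> \<bar>of_int k\<bar> * ((4 * L * inverse y * inverse y) * (C * y))"
      by (intro mult_left_mono mult_mono kb Ky) (use L y0 slope_bounds(1) in auto)
    also have "\<dots> = \<bar>of_int k\<bar> * 4 * L * C * inverse y" using y0 by (simp add: field_simps)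
    finally show "norm (wave_deriv L k (x + \<sigma> * y) * of_real (K y)) \<le> \<bar>of_int k\<bar> * 4 * L * C * inverse y" .
  qed
qed

lemma slope_cot:
  assumes "0 < t" "t < pi"
  shows "slope L (L * cot t) = (sin t)\<^sup>2 / L" "slope_deriv L (L * cot t) = - (2 * cos t * sin t ^ 3) / L\<^sup>2"
proof -
  have s: "sin t > 0" using assms by (intro sin_gt_zero)
  have "A + A * B / C = A * (C + B) / C" if "C \<noteq> 0" for A B C :: real
    using that by (simp add: field_simps)
  from this[of "(sin t)\<^sup>2" "L\<^sup>2" "(cos t)\<^sup>2"]
  have e: "L\<^sup>2 + (L * cot t)\<^sup>2 = L\<^sup>2 / (sin t)\<^sup>2"
    using s by (simp add: cot_def power_mult_distrib power_divide)
  show "slope L (L * cot t) = (sin t)\<^sup>2 / L" unfolding slope_def e using s L by (simp add: field_simps power2_eq_square)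
  have "slope_deriv L (L * cot t) = - (2 * (L * (cos t / sin t)) * L) / (L\<^sup>2 / (sin t)\<^sup>2)\<^sup>2"
    unfolding slope_deriv_def e by (simp add: cot_def)
  also have "\<dots> = - (2 * cos t * sin t ^ 3) / L\<^sup>2"
    using s L by (simp add: field_simps power2_eq_square power3_eq_cube)
  finally show "slope_deriv L (L * cot t) = - (2 * cos t * sin t ^ 3) / L\<^sup>2" .
qed

text \<open>In the variable \<open>t\<close> the second derivative times the Jacobian \<open>L / (sin t)\<^sup>2\<close> is the profile of
  order one divided by \<open>L\<close>.\<close>

lemma wave_deriv2_cot:
  assumes t: "0 < t" "t < pi"
  shows "of_real (L / (sin t)\<^sup>2) * wave_deriv2 L k (L * cot t) = profile 1 k t / of_real L"
proof -
  have s: "sin t > 0" using t by (intro sin_gt_zero)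
  have b: "wave L k (L * cot t) = cis (of_int k * t)"
    using L t by (simp add: wave_def arccot_cot)
  have nz: "complex_of_real (sin t) \<noteq> 0" "complex_of_real L \<noteq> 0" using s L by auto
  have "(l / s\<^sup>2) * ((- (\<i> * k * (- (2 * c * s ^ 3) / l\<^sup>2)) - (k * (s\<^sup>2 / l))\<^sup>2) * E) = (s * (2 * \<i> * k * c - k\<^sup>2 * s) * E) / l"
    if "s \<noteq> 0" "l \<noteq> 0" for s l k c E :: complex
    using that by (simp add: field_simps power2_eq_square power3_eq_cube)
  from this[OF nz, of "of_int k" "of_real (cos t)" "cis (of_int k * t)"] show ?thesis
    unfolding wave_deriv2_def slope_cot[OF t] b profile_def using s by simp
qed

lemma cot_difference:
  assumes s: "0 < s" "s < pi" and t: "0 < t" "t < pi"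
  shows "\<bar>L * cot t - L * cot s\<bar> = L * \<bar>sin (t - s)\<bar> / (sin s * sin t)"
proof -
  have p: "sin t > 0" "sin s > 0" using s t by (auto intro: sin_gt_zero)
  have "L * cot t - L * cot s = L * - sin (t - s) / (sin s * sin t)"
    using p by (simp add: cot_def sin_diff field_simps)
  then have "\<bar>L * cot t - L * cot s\<bar> = \<bar>L * - sin (t - s) / (sin s * sin t)\<bar>" by (simp only:)
  also have "\<dots> = L * \<bar>sin (t - s)\<bar> / (sin s * sin t)" using p L by (simp add: abs_mult)
  finally show ?thesis .
qed

lemma range_cot: "(\<lambda>t. L * cot t - c) ` {0<..<pi} = UNIV"
proof (intro set_eqI iffI UNIV_I)
  fix y
  define t where "t = pi/2 - arctan ((y + c) / L)"
  have "t \<in> {0<..<pi}" using arctan_bounded[of "(y + c) / L"] by (auto simp: t_def)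
  moreover have "L * cot t - c = y" using L unfolding t_def cot_pi_half_minus_arctan by simp
  ultimately show "y \<in> (\<lambda>t. L * cot t - c) ` {0<..<pi}" by (metis image_eqI)
qed

text \<open>Change of variables \<open>x + y = L * cot t\<close> in \<open>has_frac_laplacian_kernel\<close>.  The hypotheses on \<open>K\<close> admit
  both powers and the logarithm, so that every order in \<open>(0, 2)\<close> is covered.\<close>

theorem has_frac_laplacian_wave:
  assumes s: "0 < s" "s < pi" and a: "0 < a" "a < 2"
    and K: "\<And>y. 0 < y \<Longrightarrow> (K has_real_derivative y powr - a) (at y)"
    and K0: "((\<lambda>e. e * K e) \<longlongrightarrow> 0) (at_right 0)"
    and Kinf: "\<forall>\<^sub>F y in at_top. \<bar>K y\<bar> \<le> C * y"
    and Km: "K \<in> borel_measurable borel"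
    and I: "(\<lambda>t. profile 1 k t * of_real (K (L * \<bar>sin (t - s)\<bar> / (sin s * sin t)))) absolutely_integrable_on {0<..<pi}"
  shows "has_frac_laplacian a (wave L k) (L * cot s)
           (of_real (frac_const a / (a * L)) *
              integral {0<..<pi} (\<lambda>t. profile 1 k t * of_real (K (L * \<bar>sin (t - s)\<bar> / (sin s * sin t)))))"
proof -
  define x where "x = L * cot s"
  define G where "G = (\<lambda>y. wave_deriv2 L k (x + y) * complex_of_real (K \<bar>y\<bar>))"
  define g where "g = (\<lambda>t. L * cot t - x)"
  define f where "f = (\<lambda>t. profile 1 k t * complex_of_real (K (L * \<bar>sin (t - s)\<bar> / (sin s * sin t))))"
  have "continuous_on UNIV (wave_deriv2 L k)"
    by (intro continuous_at_imp_continuous_on ballI isCont_wave_deriv2)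
  then have [measurable]: "wave_deriv2 L k \<in> borel_measurable borel" by (rule borel_measurable_continuous_onI)
  note [measurable] = Km
  have Gm: "G \<in> borel_measurable lborel" unfolding G_def by measurable
  have der: "(g has_real_derivative - L / (sin t)\<^sup>2) (at t within {0<..<pi})" if "t \<in> {0<..<pi}" for t
  proof -
    have "sin t \<noteq> 0" using sin_gt_zero[of t] that by auto
    from DERIV_diff[OF DERIV_cmult[OF DERIV_cot[OF this], of L] DERIV_const[of x]]
    have "(g has_real_derivative - L / (sin t)\<^sup>2) (at t)"
      unfolding g_def by (simp add: divide_inverse)
    then show ?thesis by (rule has_field_derivative_at_within)
  qed
  have inj: "inj_on g {0<..<pi}"
  proof (rule inj_onI)
    fix t t' assume t: "t \<in> {0<..<pi}" "t' \<in> {0<..<pi}" and "g t = g t'"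
    then have "arccot (cot t) = arccot (cot t')" using L by (simp add: g_def)
    moreover have "arccot (cot t) = t" "arccot (cot t') = t'"
      using t by (auto intro: arccot_cot)
    ultimately show "t = t'" by (simp only:)
  qed
  have ev: "\<bar>- L / (sin t)\<^sup>2\<bar> *\<^sub>R G (g t) = f t / of_real L" if t: "t \<in> {0<..<pi}" for t
  proof -
    have t': "0 < t" "t < pi" using t by auto
    have "\<bar>- L / (sin t)\<^sup>2\<bar> = L / (sin t)\<^sup>2" using L by simp
    moreover have "x + g t = L * cot t" "\<bar>g t\<bar> = L * \<bar>sin (t - s)\<bar> / (sin s * sin t)"
      using cot_difference[OF s t'] by (simp_all add: g_def x_def)
    ultimately have "\<bar>- L / (sin t)\<^sup>2\<bar> *\<^sub>R G (g t) =
        (of_real (L / (sin t)\<^sup>2) * wave_deriv2 L k (L * cot t)) * of_real (K (L * \<bar>sin (t - s)\<bar> / (sin s * sin t)))"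
      unfolding G_def scaleR_conv_of_real by (simp only: mult.assoc)
    then show ?thesis unfolding wave_deriv2_cot[OF t'] f_def by simp
  qed
  have If: "(\<lambda>t. f t / of_real L) absolutely_integrable_on {0<..<pi}"
    using I unfolding f_def by (rule set_integrable_divide)
  have 1: "(\<lambda>t. \<bar>- L / (sin t)\<^sup>2\<bar> *\<^sub>R G (g t)) absolutely_integrable_on {0<..<pi}"
    by (rule set_integrable_eq_on[OF If]) (simp only: ev)
  have 2: "integral {0<..<pi} (\<lambda>t. \<bar>- L / (sin t)\<^sup>2\<bar> *\<^sub>R G (g t)) = integral {0<..<pi} f / of_real L"
  proof -
    have "integral {0<..<pi} (\<lambda>t. \<bar>- L / (sin t)\<^sup>2\<bar> *\<^sub>R G (g t)) = integral {0<..<pi} (\<lambda>t. f t / of_real L)"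
      by (rule integral_cong) (rule ev)
    then show ?thesis by simp
  qed
  have "G absolutely_integrable_on g ` {0<..<pi} \<and> integral (g ` {0<..<pi}) G = integral {0<..<pi} f / of_real L"
    using has_absolute_integral_change_of_variables_real[OF _ der inj, of G "integral {0<..<pi} f / of_real L"] 1 2 by simp
  then have G: "G absolutely_integrable_on UNIV" "integral UNIV G = integral {0<..<pi} f / of_real L"
    unfolding g_def range_cot by auto
  \<comment> \<open>the change of variables is a statement about Lebesgue measure; Borel measurability of \<open>G\<close> leads back\<close>
  have Gi: "integrable lborel G"
    using G(1) Gm by (simp add: set_integrable_def integrable_completion)
  have "(LBINT y. G y) = integral UNIV G"
    using set_borel_integral_eq_integral(2)[of UNIV G] Gi by (simp add: set_integrable_def set_lebesgue_integral_def)
  then have val: "(LBINT y. G y) = integral {0<..<pi} f / of_real L" using G(2) by simp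
  have "has_frac_laplacian a (wave L k) x (of_real (frac_const a / a) * (LBINT y. G y))"
    unfolding G_def
  proof (rule has_frac_laplacian_kernel[OF a wave_derivative wave_deriv_derivative isCont_wave_deriv2 _ norm_wave_deriv2_bound _ K0])
    show "(K has_real_derivative y powr - a) (at y)" if "0 < y" for y by (rule K[OF that])
    show "norm (wave L k y) \<le> 1" for y by (simp add: norm_wave)
    show "((\<lambda>y. wave_deriv L k (x + y) * of_real (K y)) \<longlongrightarrow> 0) at_top"
      using wave_deriv_decay[OF Kinf, of 1 k x] by simp
    show "((\<lambda>y. wave_deriv L k (x - y) * of_real (K y)) \<longlongrightarrow> 0) at_top"
      using wave_deriv_decay[OF Kinf, of "-1" k x] by simp
    show "integrable lborel (\<lambda>y. wave_deriv2 L k (x + y) * complex_of_real (K \<bar>y\<bar>))"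
      using Gi unfolding G_def .
  qed
  then show ?thesis unfolding val x_def f_def by simp
qed

end

section \<open>Orders different from one\<close>

lemma not_nonpos_Ints:
  fixes x :: real
  assumes "of_int n < x" "x < of_int n + 1"
  shows "x \<notin> \<int>\<^sub>\<le>\<^sub>0"
proof
  assume "x \<in> \<int>\<^sub>\<le>\<^sub>0"
  then obtain m where "x = of_int m" by (auto elim: nonpos_Ints_cases)
  with assms have "n < m" "m < n + 1" by linarith+
  then show False by simp
qed

lemma Gamma_reflection_real:
  fixes z :: real
  shows "Gamma z * Gamma (1 - z) = pi / sin (pi * z)"
proof -
  have "complex_of_real (Gamma z * Gamma (1 - z)) = Gamma (of_real z) * Gamma (1 - of_real z)"
    using Gamma_complex_of_real[of z] Gamma_complex_of_real[of "1 - z"] by simp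
  also have "\<dots> = of_real pi / sin (of_real pi * of_real z)"
    by (rule Gamma_reflection_complex)
  also have "\<dots> = complex_of_real (pi / sin (pi * z))"
    by (simp add: sin_of_real[symmetric])
  finally show ?thesis using of_real_eq_iff by blast
qed

text \<open>In terms of \<open>z = a / 2\<close> the Gamma factors pair up to \<open>Gamma z * Gamma (1 - z)\<close> and
  \<open>Gamma (1/2 + z) * Gamma (1/2 - z)\<close>, so that reflection leaves the quotient of \<open>cos (\<pi> * z)\<close> by
  \<open>sin (\<pi> * z)\<close>.\<close>

lemma even_constant:
  fixes a :: real
  assumes a: "0 < a" "a < 2" "a \<noteq> 1"
  shows "(sqrt pi * Gamma ((a + 1 + 1)/2) / Gamma (- (a + 1)/2)) * (sqrt pi * Gamma ((1 - a + 1)/2) / Gamma (- (1 - a)/2))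
          / ((a + 1) * pi * (a * (1 - a))) = 1 / (8 * tan (pi * a / 2))"
proof -
  let ?C = "(sqrt pi * Gamma ((a + 1 + 1)/2) / Gamma (- (a + 1)/2)) * (sqrt pi * Gamma ((1 - a + 1)/2) / Gamma (- (1 - a)/2))"
  define z where "z = a / 2"
  have az: "a = 2 * z" by (simp add: z_def)
  have z: "0 < z" "z < 1" "z \<noteq> 1/2" using a by (auto simp: z_def)
  have ni: "z - 1/2 \<notin> \<int>\<^sub>\<le>\<^sub>0" "-1/2 - z \<notin> \<int>\<^sub>\<le>\<^sub>0" "1/2 - z \<notin> \<int>\<^sub>\<le>\<^sub>0" "z \<notin> \<int>\<^sub>\<le>\<^sub>0" "1/2 + z \<notin> \<int>\<^sub>\<le>\<^sub>0"
  proof -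
    show "z - 1/2 \<notin> \<int>\<^sub>\<le>\<^sub>0" using z not_nonpos_Ints[of 0 "z - 1/2"] not_nonpos_Ints[of "-1" "z - 1/2"] by linarith
    show "-1/2 - z \<notin> \<int>\<^sub>\<le>\<^sub>0" using z not_nonpos_Ints[of "-1" "-1/2 - z"] not_nonpos_Ints[of "-2" "-1/2 - z"] by linarith
    show "1/2 - z \<notin> \<int>\<^sub>\<le>\<^sub>0" using z not_nonpos_Ints[of 0 "1/2 - z"] not_nonpos_Ints[of "-1" "1/2 - z"] by linarith
    show "z \<notin> \<int>\<^sub>\<le>\<^sub>0" using z not_nonpos_Ints[of 0 z] by simp
    show "1/2 + z \<notin> \<int>\<^sub>\<le>\<^sub>0" using z not_nonpos_Ints[of 0 "1/2 + z"] not_nonpos_Ints[of 1 "1/2 + z"] by linarith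
  qed
  have sp: "sin (pi * z) > 0" using z by (intro sin_gt_zero) auto
  have g1: "Gamma (1 + z) = z * Gamma z"
    using Gamma_plus1[OF ni(4)] by (simp add: add.commute)
  have r1: "Gamma z * Gamma (1 - z) = pi / sin (pi * z)" by (rule Gamma_reflection_real)
  have r2: "Gamma (1/2 + z) * Gamma (1/2 - z) = pi / cos (pi * z)"
  proof -
    have "sin (pi * (1/2 + z)) = cos (pi * z)" by (simp add: distrib_left sin_add)
    moreover have "1 - (1/2 + z) = 1/2 - z" by simp
    ultimately show ?thesis using Gamma_reflection_real[of "1/2 + z"] by (simp only:)
  qed
  have "Gamma (1/2 + z) \<noteq> 0" "Gamma (1/2 - z) \<noteq> 0"
    using ni by (simp_all add: Gamma_eq_zero_iff)
  with r2 have cz: "cos (pi * z) \<noteq> 0" by auto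
  have g2: "Gamma (1/2 - z) = (-1/2 - z) * Gamma (-1/2 - z)"
    using Gamma_plus1[OF ni(2)] by simp
  have g3: "Gamma (1/2 + z) = (z - 1/2) * Gamma (z - 1/2)"
    using Gamma_plus1[OF ni(1)] by (simp add: add.commute)
  have r2': "Gamma (-1/2 - z) * Gamma (z - 1/2) = pi / (cos (pi * z) * ((1/2 + z) * (1/2 - z)))"
  proof -
    have "((1/2 + z) * (1/2 - z)) * (Gamma (-1/2 - z) * Gamma (z - 1/2)) = pi / cos (pi * z)"
      unfolding r2[symmetric] g2 g3 by (simp add: algebra_simps)
    moreover have "(1/2 + z) * (1/2 - z) \<noteq> 0" using z by auto
    moreover have "X = P / (C * D)" if "D * X = P / C" "D \<noteq> 0" for X P C D :: real
    proof -
      have "X = (D * X) / D" using that(2) by simp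
      then show ?thesis using that(1) by simp
    qed
    ultimately show ?thesis by blast
  qed
  have "?C
      = pi * (Gamma (1 + z) * Gamma (1 - z)) / (Gamma (-1/2 - z) * Gamma (z - 1/2))"
  proof -
    have "(a + 1 + 1)/2 = 1 + z" "- (a + 1)/2 = -1/2 - z" "(1 - a + 1)/2 = 1 - z" "- (1 - a)/2 = z - 1/2"
      by (simp_all add: az field_simps)
    then show ?thesis by (simp only:) simp
  qed
  also have "\<dots> = pi * (z * (pi / sin (pi * z))) / (pi / (cos (pi * z) * ((1/2 + z) * (1/2 - z))))"
    unfolding g1 r2' r1[symmetric] by (simp add: mult.assoc)
  also have "\<dots> = ((a + 1) * pi * (a * (1 - a))) * (1 / (8 * tan (pi * z)))"
    using sp cz z by (simp add: az tan_def field_simps)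
  finally have e: "?C
     = ((a + 1) * pi * (a * (1 - a))) * (1 / (8 * tan (pi * z)))" .
  have "(a + 1) * pi * (a * (1 - a)) \<noteq> 0" "pi * a / 2 = pi * z" using a by (auto simp: az)
  then show ?thesis unfolding e by simp
qed

text \<open>Here the Gamma factors cancel by the functional equation alone, which is why no tangent appears for
  odd \<open>k\<close>.\<close>

lemma odd_constant:
  fixes a :: real
  assumes a: "0 < a" "a < 2" "a \<noteq> 1"
  shows "(sqrt pi * Gamma (1 + (a + 1)/2) / Gamma ((1 - (a + 1))/2)) * (sqrt pi * Gamma ((1 - a + 1)/2) / Gamma (- (1 - a)/2))
          / ((a + 1) * pi * (a * (1 - a))) = 1 / 8"
proof -
  let ?C = "(sqrt pi * Gamma (1 + (a + 1)/2) / Gamma ((1 - (a + 1))/2)) * (sqrt pi * Gamma ((1 - a + 1)/2) / Gamma (- (1 - a)/2))"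
  define z where "z = a / 2"
  have az: "a = 2 * z" by (simp add: z_def)
  have z: "0 < z" "z < 1" "z \<noteq> 1/2" using a by (auto simp: z_def)
  have ni: "z - 1/2 \<notin> \<int>\<^sub>\<le>\<^sub>0" "- z \<notin> \<int>\<^sub>\<le>\<^sub>0" "1/2 + z \<notin> \<int>\<^sub>\<le>\<^sub>0"
  proof -
    show "z - 1/2 \<notin> \<int>\<^sub>\<le>\<^sub>0" using z not_nonpos_Ints[of 0 "z - 1/2"] not_nonpos_Ints[of "-1" "z - 1/2"] by linarith
    show "- z \<notin> \<int>\<^sub>\<le>\<^sub>0" using z not_nonpos_Ints[of "-1" "- z"] by linarith
    show "1/2 + z \<notin> \<int>\<^sub>\<le>\<^sub>0" using z not_nonpos_Ints[of 0 "1/2 + z"] not_nonpos_Ints[of 1 "1/2 + z"] by linarith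
  qed
  have nz: "Gamma (z - 1/2) \<noteq> 0" "Gamma (- z) \<noteq> 0" using ni by (simp_all add: Gamma_eq_zero_iff)
  have g1: "Gamma (1 - z) = - z * Gamma (- z)"
    using Gamma_plus1[OF ni(2)] by (simp add: add.commute)
  have g2: "Gamma (1/2 + z) = (z - 1/2) * Gamma (z - 1/2)"
    using Gamma_plus1[OF ni(1)] by (simp add: add.commute)
  have g3: "Gamma (3/2 + z) = (1/2 + z) * Gamma (1/2 + z)"
    using Gamma_plus1[OF ni(3)] by (simp add: add.commute add.left_commute)
  have "?C
      = pi * (Gamma (3/2 + z) * Gamma (1 - z)) / (Gamma (- z) * Gamma (z - 1/2))"
  proof -
    have "1 + (a + 1)/2 = 3/2 + z" "(1 - (a + 1))/2 = - z" "(1 - a + 1)/2 = 1 - z" "- (1 - a)/2 = z - 1/2"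
      by (simp_all add: az field_simps)
    then show ?thesis by (simp only:) simp
  qed
  also have "\<dots> = pi * ((1/2 + z) * (z - 1/2) * (- z))"
  proof -
    have "pi * ((X * (Y * H) * (- z * F))) / (F * H) = pi * (X * Y * (- z))" if "F \<noteq> 0" "H \<noteq> 0" for X Y F H :: real
      using that by (simp add: field_simps)
    from this[OF nz(2,1), of "1/2 + z" "z - 1/2"] show ?thesis unfolding g3 g2 g1 by (simp only: mult.assoc)
  qed
  also have "\<dots> = ((a + 1) * pi * (a * (1 - a))) * (1 / 8)"
    by (simp add: az field_simps)
  finally have e: "?C
     = ((a + 1) * pi * (a * (1 - a))) * (1 / 8)" .
  have "(a + 1) * pi * (a * (1 - a)) \<noteq> 0" using a by auto
  then show ?thesis unfolding e by simp
qed

text \<open>For \<open>K y = y powr (1 - a) / (1 - a)\<close> the kernel of the transported integral is a product: the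
  factor depending on \<open>s\<close> leaves the integral, the factor \<open>sin t powr (a - 1)\<close> turns the profile of
  order one into that of order \<open>a\<close>, and a convolution with \<open>\<bar>sin t\<bar> powr (1 - a)\<close> remains.\<close>

theorem fractional_convolution:
  fixes L s a :: real
  assumes L: "L > 0" and s: "0 < s" "s < pi" and a: "0 < a" "a < 2" "a \<noteq> 1"
  obtains H where
    "((\<lambda>l. profile_coeff a k l / of_real pi * (cis (of_int (2 * l) * s) * sin_moment (1 - a) (2 * l))) has_sum H) UNIV"
    "has_frac_laplacian a (wave L k) (L * cot s)
       (of_real (frac_const a * sin s powr (a - 1) / (L powr a * (a * (1 - a)))) * H)"
proof -
  \<comment> \<open>the absolute value makes the kernel \<open>\<pi>\<close>-periodic\<close>
  define \<kappa> where "\<kappa> = (\<lambda>t. \<bar>sin t\<bar> powr (1 - a))"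
  let ?g = "\<lambda>t. profile a k t * complex_of_real (\<kappa> (t - s))"
  define H where "H = integral {0..pi} ?g"
  define K where "K = (\<lambda>y::real. y powr (1 - a) / (1 - a))"
  define c where "c = L powr (1 - a) * sin s powr (a - 1) / (1 - a)"
  let ?f = "\<lambda>t. profile 1 k t * complex_of_real (K (L * \<bar>sin (t - s)\<bar> / (sin s * sin t)))"
  have \<kappa>_sin: "\<kappa> t = sin t powr (1 - a)" if "t \<in> {0..pi}" for t
    using that sin_ge_zero[of t] by (simp add: \<kappa>_def)
  have 1: "\<kappa> absolutely_integrable_on {0..pi}"
    by (rule set_integrable_eq_on[OF sin_powr_integral(1)[of "1 - a"]]) (use a \<kappa>_sin in auto)
  have 2: "\<kappa> (t + pi) = \<kappa> t" for t by (simp add: \<kappa>_def)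
  have 3: "((\<lambda>t. of_real (\<kappa> t) * cis (of_int (2 * l) * t)) has_integral sin_moment (1 - a) (2 * l)) {0..pi}" for l
    by (rule has_integral_eq[OF _ sin_moment_has_integral]) (use a \<kappa>_sin in auto)
  have s': "0 \<le> s" "s \<le> pi" using s by auto
  have I: "?g absolutely_integrable_on {0..pi}"
    by (rule profile_convolution(1)[OF a(1,2) s' 1 2 3])
  have sum: "((\<lambda>l. profile_coeff a k l / of_real pi * (cis (of_int (2 * l) * s) * sin_moment (1 - a) (2 * l))) has_sum H) UNIV"
    unfolding H_def by (rule profile_convolution(2)[OF a(1,2) s' 1 2 3])
  have sp: "sin s > 0" using s by (intro sin_gt_zero)
  have eq: "of_real c * ?g t = ?f t"
    if t: "t \<in> {0<..<pi}" for t
  proof -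
    have tp: "sin t > 0" using t by (auto intro: sin_gt_zero)
    have "(L * \<bar>sin (t - s)\<bar> / (sin s * sin t)) powr (1 - a) = L powr (1 - a) * \<kappa> (t - s) / (sin s powr (1 - a) * sin t powr (1 - a))"
      using L sp tp by (simp add: \<kappa>_def powr_mult powr_divide)
    also have "\<dots> = L powr (1 - a) * \<kappa> (t - s) * (sin s powr (a - 1) * sin t powr (a - 1))"
      using sp tp by (simp add: powr_diff field_simps)
    finally have "K (L * \<bar>sin (t - s)\<bar> / (sin s * sin t)) = c * \<kappa> (t - s) * sin t powr (a - 1)"
      unfolding K_def c_def by simp
    moreover have "sin t powr 1 * sin t powr (a - 1) = sin t powr a"
      by (subst powr_add[symmetric]) simp
    then have "complex_of_real (sin t powr a) = of_real (sin t powr 1) * of_real (sin t powr (a - 1))"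
      by (simp only: of_real_mult[symmetric])
    ultimately show ?thesis unfolding profile_def by (simp only: of_real_mult mult_ac)
  qed
  have sub: "?g absolutely_integrable_on {0<..<pi}"
    by (rule set_integrable_subset[OF I]) auto
  have hI: "(?g has_integral H) {0<..<pi}"
    unfolding has_integral_Icc_iff_Ioo[symmetric] H_def
    using I by (intro integrable_integral) (simp add: absolutely_integrable_on_def)
  have J: "?f absolutely_integrable_on {0<..<pi}"
    by (rule set_integrable_eq_on[OF set_integrable_mult_right[OF sub]]) (rule eq)
  have "(?f has_integral of_real c * H) {0<..<pi}"
    by (rule has_integral_eq[OF eq has_integral_mult_right[OF hI]])
  then have J': "integral {0<..<pi} ?f = of_real c * H"
    by (rule integral_unique)
  have "has_frac_laplacian a (wave L k) (L * cot s)
           (of_real (frac_const a / (a * L)) *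
              integral {0<..<pi} ?f)"
  proof (rule has_frac_laplacian_wave[OF L s a(1,2) _ _ _ _ J])
    show "(K has_real_derivative y powr - a) (at y)" if "0 < y" for y
    proof -
      have "((\<lambda>y. y powr (1 - a) / (1 - a)) has_real_derivative ((1 - a) * y powr (1 - a - 1)) / (1 - a)) (at y)"
        by (intro DERIV_cdivide has_real_derivative_powr that)
      then show ?thesis using a by (simp add: K_def)
    qed
    show "((\<lambda>e. e * K e) \<longlongrightarrow> 0) (at_right 0)"
    proof -
      have "((\<lambda>e::real. e powr (2 - a)) \<longlongrightarrow> 0) (at_right 0)"
      proof (rule tendsto_zero_powrI[where b="2 - a"])
        show "\<forall>\<^sub>F e in at_right (0::real). 0 \<le> e"
          using eventually_at_right_less[of "0::real"] by (rule eventually_mono) simp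
      qed (use a in \<open>simp_all add: tendsto_ident_at\<close>)
      then have "((\<lambda>e::real. e powr (2 - a) / (1 - a)) \<longlongrightarrow> 0 / (1 - a)) (at_right 0)"
        by (rule tendsto_divide) (use a in auto)
      moreover have "\<forall>\<^sub>F e in at_right (0::real). e powr (2 - a) / (1 - a) = e * K e"
        using eventually_at_right_less[of "0::real"]
      proof eventually_elim
        fix e :: real assume "0 < e"
        then have "e * e powr (1 - a) = e powr 1 * e powr (1 - a)" by simp
        also have "\<dots> = e powr (2 - a)" by (subst powr_add[symmetric]) simp
        finally show "e powr (2 - a) / (1 - a) = e * K e" by (simp add: K_def)
      qed
      ultimately show ?thesis by (auto intro: Lim_transform_eventually)
    qed
    show "\<forall>\<^sub>F y in at_top. \<bar>K y\<bar> \<le> (1 / \<bar>1 - a\<bar>) * y"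
      using eventually_ge_at_top[of 1]
    proof eventually_elim
      fix y :: real assume y: "1 \<le> y"
      then have "y powr (1 - a) \<le> y powr 1" using a by (intro powr_mono) auto
      then show "\<bar>K y\<bar> \<le> (1 / \<bar>1 - a\<bar>) * y"
        using y by (simp add: K_def abs_divide divide_right_mono)
    qed
    show "K \<in> borel_measurable borel" unfolding K_def by measurable
  qed
  also have "of_real (frac_const a / (a * L)) *
              integral {0<..<pi} ?f
     = of_real (frac_const a * sin s powr (a - 1) / (L powr a * (a * (1 - a)))) * H"
  proof -
    have "L powr (1 - a) = L / L powr a" using L by (simp add: powr_diff)
    then have "frac_const a / (a * L) * c = frac_const a * sin s powr (a - 1) / (L powr a * (a * (1 - a)))"
      using L by (simp add: c_def)
    then show ?thesis unfolding J' by (metis of_real_mult mult.assoc)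
  qed
  finally show ?thesis using that[OF sum] by blast
qed

lemma tan_pi_half_nonzero:
  assumes "0 < a" "a < 2" "a \<noteq> 1"
  shows "tan (pi * a / 2) \<noteq> 0" "sin (pi * a / 2) > 0"
proof -
  show s: "sin (pi * a / 2) > 0" using assms by (intro sin_gt_zero) (auto simp: field_simps)
  have "cos (pi * a / 2) \<noteq> 0"
  proof (cases "a < 1")
    case True
    have "0 < pi * a / 2" using assms by simp
    moreover have "pi * a / 2 < pi / 2" using True by simp
    ultimately have "cos (pi * a / 2) > 0" using pi_gt_zero by (intro cos_gt_zero_pi) linarith+
    then show ?thesis by simp
  next
    case False
    have "cos (pi - pi * a / 2) > 0" using assms False by (intro cos_gt_zero_pi) (auto simp: field_simps)
    then show ?thesis by simp
  qed
  then show "tan (pi * a / 2) \<noteq> 0" using s by (simp add: tan_def)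
qed

lemma gamma_ratio_exponents:
  "gamma_ratio (1 - a) x = Gamma ((-1 + a)/2 + x) / Gamma ((3 - a)/2 + x)"
  "gamma_ratio (a + 1) x = Gamma ((-1 - a)/2 + x) / Gamma ((3 + a)/2 + x)"
proof -
  have "x - (1 - a)/2 = (-1 + a)/2 + x" "x + 1 + (1 - a)/2 = (3 - a)/2 + x"
       "x - (a + 1)/2 = (-1 - a)/2 + x" "x + 1 + (a + 1)/2 = (3 + a)/2 + x"
    by (simp_all add: field_simps)
  then show "gamma_ratio (1 - a) x = Gamma ((-1 + a)/2 + x) / Gamma ((3 - a)/2 + x)"
    "gamma_ratio (a + 1) x = Gamma ((-1 - a)/2 + x) / Gamma ((3 + a)/2 + x)"
    by (simp_all only: gamma_ratio_def)
qed

lemma not_nonpos_Ints_exponents: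
  fixes a :: real
  assumes a: "0 < a" "a < 2" "a \<noteq> 1"
  shows "- (1 - a)/2 \<notin> \<int>\<^sub>\<le>\<^sub>0" "- (a + 1)/2 \<notin> \<int>\<^sub>\<le>\<^sub>0" "(1 - (a + 1))/2 \<notin> \<int>\<^sub>\<le>\<^sub>0"
proof -
  show "- (1 - a)/2 \<notin> \<int>\<^sub>\<le>\<^sub>0"
    using a not_nonpos_Ints[of 0 "- (1 - a)/2"] not_nonpos_Ints[of "-1" "- (1 - a)/2"] by (cases "a < 1") auto
  show "- (a + 1)/2 \<notin> \<int>\<^sub>\<le>\<^sub>0"
    using a not_nonpos_Ints[of "-1" "- (a + 1)/2"] not_nonpos_Ints[of "-2" "- (a + 1)/2"] by (cases "a < 1") auto
  show "(1 - (a + 1))/2 \<notin> \<int>\<^sub>\<le>\<^sub>0"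
    using a not_nonpos_Ints[of "-1" "(1 - (a + 1))/2"] by auto
qed

lemma exp_eq_cis: "exp (\<i> * 2 * of_int l * complex_of_real s) = cis (of_int (2 * l) * s)"
  by (simp add: cis_conv_exp mult_ac)

text \<open>The parities of \<open>k\<close> differ only in the closed form of the moments \<open>sin_moment (a + 1) (k - 2 * l)\<close>.
  With \<open>\<zeta> = 1\<close>, \<open>\<sigma> l = 1\<close> for even \<open>k\<close> and \<open>\<zeta> = \<i>\<close>, \<open>\<sigma> l = sgn (k / 2 - l)\<close> for odd \<open>k\<close>, the
  comparison of the series of the convolution with the claimed series is the same; \<open>c\<close> collects all
  constants.\<close>

lemma fractional_series:
  fixes L s a c X :: real and \<sigma> :: "int \<Rightarrow> real" and \<zeta> :: complex
  assumes L: "L > 0" and s: "0 < s" "s < pi" and a: "0 < a" "a < 2" "a \<noteq> 1"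
    and moments: "\<And>l. sin_moment (a + 1) (k - 2 * l) =
                    \<zeta> * of_real (X * \<sigma> l * gamma_ratio (a + 1) \<bar>of_int k / 2 - of_int l\<bar>)"
    and c: "X * (sqrt pi * Gamma ((1 - a + 1)/2) / Gamma (- (1 - a)/2)) / ((a + 1) * pi * (a * (1 - a))) = c"
    and nonzero: "c \<noteq> 0" "\<zeta> \<noteq> 0"
  shows "\<exists>S. ((\<lambda>l::int. exp (\<i> * 2 * of_int l * complex_of_real s) *
                 complex_of_real (((1 - a) * (of_int k)^2 - 4 * of_int k * of_int l) * \<sigma> l *
                   (Gamma ((-1 + a)/2 + \<bar>of_int l\<bar>) *
                    Gamma ((-1 - a)/2 + \<bar>of_int k / 2 - of_int l\<bar>)) /
                   (Gamma ((3 - a)/2 + \<bar>of_int l\<bar>) *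
                    Gamma ((3 + a)/2 + \<bar>of_int k / 2 - of_int l\<bar>))))
               has_sum S) UNIV \<and>
             has_frac_laplacian a (wave L k) (L * cot s)
               (\<zeta> * of_real (frac_const a * \<bar>sin s\<bar> powr (a - 1) / L powr a * c) * S)"
    (is "\<exists>S. (?\<tau> has_sum S) UNIV \<and> _ S")
proof -
  obtain H where sum: "((\<lambda>l. profile_coeff a k l / of_real pi * (cis (of_int (2 * l) * s) * sin_moment (1 - a) (2 * l))) has_sum H) UNIV"
    and lap: "has_frac_laplacian a (wave L k) (L * cot s)
       (of_real (frac_const a * sin s powr (a - 1) / (L powr a * (a * (1 - a)))) * H)"
    using fractional_convolution[OF L s a] by blast
  define Y where "Y = sqrt pi * Gamma ((1 - a + 1)/2) / Gamma (- (1 - a)/2)"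
  define d where "d = c * (a * (1 - a))"
  have XY: "X * Y / ((a + 1) * pi) = d"
    using a by (simp add: d_def c[symmetric] Y_def)
  have d: "\<zeta> * complex_of_real d \<noteq> 0" using a nonzero by (simp add: d_def)
  have summand: "profile_coeff a k l / of_real pi * (cis (of_int (2 * l) * s) * sin_moment (1 - a) (2 * l)) = (\<zeta> * of_real d) * ?\<tau> l" for l
  proof -
    define P where "P = (1 - a) * (of_int k)^2 - 4 * of_int k * of_int l"
    define U where "U = gamma_ratio (1 - a) \<bar>of_int l\<bar>"
    define V where "V = gamma_ratio (a + 1) \<bar>of_int k / 2 - of_int l\<bar>"
    have m1: "sin_moment (1 - a) (2 * l) = of_real (Y * U)"
      unfolding Y_def U_def by (rule even_sin_moment) (use a not_nonpos_Ints_exponents[OF a] in auto)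
    have m2: "sin_moment (a + 1) (k - 2 * l) = \<zeta> * of_real (X * \<sigma> l * V)"
      unfolding V_def by (rule moments)
    have "profile_coeff a k l / of_real pi * (cis (of_int (2 * l) * s) * sin_moment (1 - a) (2 * l))
       = \<zeta> * of_real (P / (a + 1) * (X * \<sigma> l * V) / pi * (Y * U)) * cis (of_int (2 * l) * s)"
      unfolding profile_coeff_def m1 m2 P_def[symmetric] by simp
    also have "P / (a + 1) * (X * \<sigma> l * V) / pi * (Y * U) = d * (P * \<sigma> l * (U * V))"
      unfolding XY[symmetric] by simp
    also have "P * \<sigma> l * (U * V) = P * \<sigma> l * (Gamma ((-1 + a)/2 + \<bar>of_int l\<bar>) *
                    Gamma ((-1 - a)/2 + \<bar>of_int k / 2 - of_int l\<bar>)) /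
                   (Gamma ((3 - a)/2 + \<bar>of_int l\<bar>) *
                    Gamma ((3 + a)/2 + \<bar>of_int k / 2 - of_int l\<bar>))"
      unfolding U_def V_def gamma_ratio_exponents by simp
    finally show ?thesis unfolding exp_eq_cis P_def by (simp only: of_real_mult mult_ac)
  qed
  have "(?\<tau> has_sum (H / (\<zeta> * of_real d))) UNIV"
    using sum d unfolding summand by (subst (asm) has_sum_cmult_right_iff) auto
  moreover have "\<zeta> * complex_of_real (frac_const a * \<bar>sin s\<bar> powr (a - 1) / L powr a * c) * (H / (\<zeta> * of_real d))
     = of_real (frac_const a * sin s powr (a - 1) / (L powr a * (a * (1 - a)))) * H"
  proof -
    have "sin s > 0" using s by (intro sin_gt_zero)
    then have "frac_const a * \<bar>sin s\<bar> powr (a - 1) / L powr a * c / d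
        = frac_const a * sin s powr (a - 1) / (L powr a * (a * (1 - a)))"
      using nonzero by (simp add: d_def)
    moreover have "\<zeta> * z * (H / (\<zeta> * w)) = (z / w) * H" for z w :: complex
      using nonzero by simp
    ultimately show ?thesis by (metis (no_types) of_real_divide)
  qed
  ultimately show ?thesis using lap by (metis (no_types, lifting))
qed

lemma fractional_even:
  fixes L s a :: real
  assumes L: "L > 0" and s: "0 < s" "s < pi" and a: "0 < a" "a < 2" "a \<noteq> 1" and k: "even k"
  shows "\<exists>S. ((\<lambda>l::int. exp (\<i> * 2 * of_int l * complex_of_real s) *
                 complex_of_real (((1 - a) * (of_int k)^2 - 4 * of_int k * of_int l) *
                   (Gamma ((-1 + a)/2 + \<bar>of_int l\<bar>) *
                    Gamma ((-1 - a)/2 + \<bar>of_int k / 2 - of_int l\<bar>)) /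
                   (Gamma ((3 - a)/2 + \<bar>of_int l\<bar>) *
                    Gamma ((3 + a)/2 + \<bar>of_int k / 2 - of_int l\<bar>))))
               has_sum S) UNIV \<and>
             has_frac_laplacian a (wave L k) (L * cot s)
               (complex_of_real (frac_const a * \<bar>sin s\<bar> powr (a - 1) /
                   (8 * L powr a * tan (pi * a / 2))) * S)"
proof -
  obtain j where j: "k = 2 * j" using k by blast
  define X where "X = sqrt pi * Gamma ((a + 1 + 1)/2) / Gamma (- (a + 1)/2)"
  have m: "sin_moment (a + 1) (k - 2 * l) = 1 * of_real (X * 1 * gamma_ratio (a + 1) \<bar>of_int k / 2 - of_int l\<bar>)" for l
  proof -
    have "sin_moment (a + 1) (2 * (j - l)) = of_real (X * gamma_ratio (a + 1) \<bar>of_int (j - l)\<bar>)"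
      unfolding X_def by (rule even_sin_moment) (use a not_nonpos_Ints_exponents[OF a] in auto)
    moreover have "2 * (j - l) = k - 2 * l" "\<bar>of_int (j - l)\<bar> = \<bar>of_int k / 2 - of_int l :: real\<bar>"
      by (simp_all add: j)
    ultimately show ?thesis by (simp only: mult_1_left mult_1_right)
  qed
  have "1 / (8 * tan (pi * a / 2)) \<noteq> 0" using tan_pi_half_nonzero[OF a] by simp
  moreover have "frac_const a * \<bar>sin s\<bar> powr (a - 1) / L powr a * (1 / (8 * tan (pi * a / 2)))
     = frac_const a * \<bar>sin s\<bar> powr (a - 1) / (8 * L powr a * tan (pi * a / 2))" by simp
  ultimately show ?thesis
    using fractional_series[OF L s a m even_constant[OF a, folded X_def]]
    by (simp only: mult_1_left mult_1_right one_neq_zero not_False_eq_True simp_thms)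
qed

lemma fractional_odd:
  fixes L s a :: real
  assumes L: "L > 0" and s: "0 < s" "s < pi" and a: "0 < a" "a < 2" "a \<noteq> 1" and k: "odd k"
  shows "\<exists>S. ((\<lambda>l::int. exp (\<i> * 2 * of_int l * complex_of_real s) *
                 complex_of_real (((1 - a) * (of_int k)^2 - 4 * of_int k * of_int l) *
                   sgn (of_int k / 2 - of_int l) *
                   (Gamma ((-1 + a)/2 + \<bar>of_int l\<bar>) *
                    Gamma ((-1 - a)/2 + \<bar>of_int k / 2 - of_int l\<bar>)) /
                   (Gamma ((3 - a)/2 + \<bar>of_int l\<bar>) *
                    Gamma ((3 + a)/2 + \<bar>of_int k / 2 - of_int l\<bar>))))
               has_sum S) UNIV \<and>
             has_frac_laplacian a (wave L k) (L * cot s)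
               (\<i> * complex_of_real (frac_const a * \<bar>sin s\<bar> powr (a - 1) /
                   (8 * L powr a)) * S)"
proof -
  define X where "X = sqrt pi * Gamma (1 + (a + 1)/2) / Gamma ((1 - (a + 1))/2)"
  have m: "sin_moment (a + 1) (k - 2 * l) =
      \<i> * of_real (X * sgn (of_int k / 2 - of_int l) * gamma_ratio (a + 1) \<bar>of_int k / 2 - of_int l\<bar>)" for l
  proof -
    have "sin_moment (a + 1) (k - 2 * l) = \<i> * of_real (X * of_int (sgn (k - 2 * l)) * gamma_ratio (a + 1) (\<bar>of_int (k - 2 * l)\<bar> / 2))"
      unfolding X_def by (rule odd_sin_moment) (use a k not_nonpos_Ints_exponents[OF a] in auto)
    moreover have "of_int (sgn (k - 2 * l)) = sgn (of_int k / 2 - of_int l :: real)"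
    proof -
      have "of_int k / 2 - of_int l = (of_int (k - 2 * l) :: real) / 2" by (simp add: field_simps)
      then show ?thesis by (simp add: sgn_if)
    qed
    moreover have "\<bar>of_int (k - 2 * l)\<bar> / 2 = \<bar>of_int k / 2 - of_int l :: real\<bar>" by (simp add: field_simps abs_if)
    ultimately show ?thesis by (simp only:)
  qed
  have "frac_const a * \<bar>sin s\<bar> powr (a - 1) / L powr a * (1 / 8) = frac_const a * \<bar>sin s\<bar> powr (a - 1) / (8 * L powr a)"
    by simp
  moreover have "(1 / 8 :: real) \<noteq> 0" "\<i> \<noteq> 0" by simp_all
  ultimately show ?thesis
    using fractional_series[OF L s a m odd_constant[OF a, folded X_def]] by (simp only: simp_thms not_False_eq_True)
qed

section \<open>Order one\<close>

lemma frac_const_1: "frac_const 1 = 1 / pi"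
  by (simp add: frac_const_def Gamma_one_half_real)

text \<open>The convolution of the profile of order one with \<open>ln \<bar>sin t\<bar>\<close>; absolute values are implicit, as
  the real logarithm is an even function.\<close>

definition log_conv :: "int \<Rightarrow> real \<Rightarrow> complex" where
  "log_conv k s = integral {0..pi} (\<lambda>t. profile 1 k t * of_real (ln (sin (t - s))))"

lemma log_conv:
  assumes s: "0 \<le> s" "s \<le> pi"
  shows "(\<lambda>t. profile 1 k t * of_real (ln (sin (t - s)))) absolutely_integrable_on {0..pi}"
    and "((\<lambda>l. of_int k * of_int (sgn l) * sin_moment 2 (k - 2 * l) * cis (of_int (2 * l) * s)) has_sum log_conv k s) UNIV"
proof -
  have per: "ln (sin (t + pi)) = ln (sin t)" for t by (simp add: ln_minus)
  show "(\<lambda>t. profile 1 k t * of_real (ln (sin (t - s)))) absolutely_integrable_on {0..pi}"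
    by (rule profile_convolution(1)[OF _ _ s absolutely_integrable_ln_sin per log_moment_has_integral]) auto
  have sum: "((\<lambda>l. profile_coeff 1 k l / of_real pi * (cis (of_int (2 * l) * s) * log_moment l)) has_sum log_conv k s) UNIV"
    unfolding log_conv_def
    by (rule profile_convolution(2)[OF _ _ s absolutely_integrable_ln_sin per log_moment_has_integral]) auto
  have "profile_coeff 1 k l / of_real pi * (cis (of_int (2 * l) * s) * log_moment l)
     = of_int k * of_int (sgn l) * sin_moment 2 (k - 2 * l) * cis (of_int (2 * l) * s)" for l
  proof -
    have "profile_coeff 1 k l / of_real pi * (cis (of_int (2 * l) * s) * log_moment l)
        = - (2 / of_real pi) * of_int k * sin_moment 2 (k - 2 * l) * cis (of_int (2 * l) * s) * (of_int l * log_moment l)"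
      by (simp add: profile_coeff_def)
    also have "\<dots> = of_int k * of_int (sgn l) * sin_moment 2 (k - 2 * l) * cis (of_int (2 * l) * s)"
      unfolding log_moment by simp
    finally show ?thesis .
  qed
  with sum show "((\<lambda>l. of_int k * of_int (sgn l) * sin_moment 2 (k - 2 * l) * cis (of_int (2 * l) * s)) has_sum log_conv k s) UNIV"
    by (simp only:)
qed

text \<open>For \<open>K = ln\<close> the logarithm of \<open>L * \<bar>sin (t - s)\<bar> / (sin s * sin t)\<close> splits into a constant,
  which integrates to \<open>0\<close> against the profile, the convolution kernel at \<open>s\<close>, and minus the convolution kernel at
  \<open>0\<close>.  The splitting fails only at \<open>t = s\<close>.\<close>

theorem half_laplacian_convolution:
  fixes L s :: real
  assumes L: "L > 0" and s: "0 < s" "s < pi"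
  shows "has_frac_laplacian 1 (wave L k) (L * cot s)
           (of_real (1 / (pi * L)) * (log_conv k s - log_conv k 0))"
proof -
  define f where "f = (\<lambda>t. profile 1 k t * complex_of_real (ln (L * \<bar>sin (t - s)\<bar> / (sin s * sin t))))"
  define g where "g = (\<lambda>t. complex_of_real (ln (L / sin s)) * profile 1 k t
      + (profile 1 k t * of_real (ln (sin (t - s))) - profile 1 k t * of_real (ln (sin (t - 0)))))"
  have sp: "sin s > 0" using s by (intro sin_gt_zero)
  have zero: "(profile 1 k has_integral 0) {0..pi}"
    using fourier_coeff_has_integral[OF continuous_on_profile[of 1 k], of 0] fourier_coeff_profile[of 1 k 0]
    by (simp add: profile_coeff_def)
  have abs0: "profile 1 k absolutely_integrable_on {0..pi}"
    by (rule absolutely_integrable_continuous_real[OF continuous_on_profile]) simp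
  have li: "((\<lambda>t. profile 1 k t * of_real (ln (sin (t - r)))) has_integral log_conv k r) {0..pi}"
    if "0 \<le> r" "r \<le> pi" for r
    unfolding log_conv_def using log_conv(1)[OF that, of k]
    by (intro integrable_integral) (simp add: absolutely_integrable_on_def)
  have gi: "(g has_integral (of_real (ln (L / sin s)) * 0 + (log_conv k s - log_conv k 0))) {0..pi}"
    unfolding g_def by (intro has_integral_add has_integral_diff has_integral_mult_right zero li) (use s in auto)
  have ga: "g absolutely_integrable_on {0..pi}"
    unfolding g_def
    by (intro set_integral_add(1) set_integral_diff(1) set_integrable_mult_right abs0 log_conv(1)) (use s in auto)
  have eq: "f t = g t" if t: "t \<in> {0<..<pi} - {s}" for t
  proof -
    have tp: "sin t > 0" using t by (auto intro: sin_gt_zero)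
    have "sin (t - s) \<noteq> 0"
    proof
      assume "sin (t - s) = 0"
      moreover have "- pi < t - s" "t - s < pi" using t s by auto
      ultimately have "t - s = 0" using sin_eq_0_pi by blast
      with t show False by auto
    qed
    moreover have "ln \<bar>x\<bar> = ln x" for x :: real by (cases "x \<ge> 0") (auto simp: ln_minus)
    ultimately have e: "ln (L * \<bar>sin (t - s)\<bar> / (sin s * sin t)) = ln (L / sin s) + (ln (sin (t - s)) - ln (sin (t - 0)))"
      using sp tp L by (simp add: ln_mult ln_div)
    show ?thesis unfolding f_def g_def e by (simp only: of_real_add of_real_diff) (simp add: algebra_simps)
  qed
  have neg: "negligible {s}" by simp
  have "(g has_integral (log_conv k s - log_conv k 0)) {0<..<pi}"
    using gi unfolding has_integral_Icc_iff_Ioo by simp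
  then have "(f has_integral (log_conv k s - log_conv k 0)) {0<..<pi}"
    using has_integral_spike[of "{s}" "{0<..<pi}" f g] neg eq by blast
  then have fi: "integral {0<..<pi} f = log_conv k s - log_conv k 0" by (rule integral_unique)
  have "g absolutely_integrable_on {0<..<pi}" by (rule set_integrable_subset[OF ga]) auto
  then have fa: "f absolutely_integrable_on {0<..<pi}"
    by (rule absolutely_integrable_spike[OF _ neg eq])
  have "has_frac_laplacian 1 (wave L k) (L * cot s) (of_real (frac_const 1 / (1 * L)) * integral {0<..<pi} f)"
    unfolding f_def
  proof (rule has_frac_laplacian_wave[OF L s _ _ _ _ _ _ fa[unfolded f_def]])
    show "(ln has_real_derivative y powr - 1) (at y)" if "0 < y" for y :: real
      using DERIV_ln[OF that] that by (simp add: powr_minus)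
    have "((\<lambda>x::real. x * ln x) \<longlongrightarrow> 0 * ln 0) (at 0 within {0..1})"
      using continuous_on_mult_ln unfolding continuous_on_def by (rule bspec) simp
    then show "((\<lambda>e::real. e * ln e) \<longlongrightarrow> 0) (at_right 0)"
      by (simp add: at_within_Icc_at_right)
    show "\<forall>\<^sub>F y in at_top. \<bar>ln y\<bar> \<le> 1 * (y::real)"
      using eventually_ge_at_top[of 1]
    proof eventually_elim
      fix y :: real assume "1 \<le> y"
      then show "\<bar>ln y\<bar> \<le> 1 * y" using ln_bound[of y] by simp
    qed
  qed auto
  then show ?thesis unfolding fi frac_const_1 by simp
qed

text \<open>For \<open>b = 2\<close> the recurrence is solved by a rational function of the frequency.\<close>

lemma sin_moment_2_odd:
  assumes m: "odd m"
  shows "sin_moment 2 m = - 4 * \<i> / (of_int m * ((of_int m)\<^sup>2 - 4))"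
proof -
  have g: "Gamma ((2 + 3) / 2 :: real) = 3 / 4 * sqrt pi"
  proof -
    have n1: "(1/2::real) \<notin> \<int>\<^sub>\<le>\<^sub>0" "(3/2::real) \<notin> \<int>\<^sub>\<le>\<^sub>0" by (auto elim!: nonpos_Ints_cases)
    have "Gamma (3/2 :: real) = 1/2 * sqrt pi"
      using Gamma_plus1[OF n1(1)] by (simp add: Gamma_one_half_real)
    then have "Gamma (5/2 :: real) = 3/2 * (1/2 * sqrt pi)"
      using Gamma_plus1[OF n1(2)] by simp
    then show ?thesis by simp
  qed
  have 1: "sin_moment 2 1 = \<i> * (4 / 3)"
    using sin_moment_1[of 2] unfolding g by (simp add: Gamma_numeral)
  have nat: "of_int (2 * int n + 1) * ((of_int (2 * int n + 1))\<^sup>2 - 4) * sin_moment 2 (2 * int n + 1) = - 4 * \<i>" for n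
  proof (induction n)
    case 0
    show ?case by (simp add: 1)
  next
    case (Suc n)
    define M where "M = (of_int (2 * int n + 1) :: complex)"
    have st: "(M + 4) * sin_moment 2 (2 * int n + 1 + 2) = (M - 2) * sin_moment 2 (2 * int n + 1)"
      using sin_moment_step[of 2 "2 * int n + 1"] by (simp add: M_def algebra_simps)
    have e: "2 * int (Suc n) + 1 = 2 * int n + 1 + 2" "of_int (2 * int n + 1 + 2) = M + 2" by (simp_all add: M_def)
    have "(M + 2) * ((M + 2)\<^sup>2 - 4) * X = M * (M + 2) * ((M + 4) * X)" for X
      by (simp add: algebra_simps power2_eq_square)
    moreover have "M * (M + 2) * ((M - 2) * X) = M * (M\<^sup>2 - 4) * X" for X
      by (simp add: algebra_simps power2_eq_square)
    ultimately show ?case using Suc.IH unfolding e st M_def[symmetric] by (simp only: st)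
  qed
  have nz: "of_int (2 * int n + 1) * ((of_int (2 * int n + 1))\<^sup>2 - 4) \<noteq> (0 :: complex)" for n
    using nat[of n] by auto
  have pos: "sin_moment 2 (2 * int n + 1) = - 4 * \<i> / (of_int (2 * int n + 1) * ((of_int (2 * int n + 1))\<^sup>2 - 4))" for n
    using nat[of n] by (intro eq_divide_imp[OF nz]) (simp only: mult_ac)
  from m obtain q where q: "m = 2 * q + 1" by (rule oddE)
  show ?thesis
  proof (cases "q \<ge> 0")
    case True
    then have mn: "m = 2 * int (nat q) + 1" using q by simp
    show ?thesis unfolding mn by (rule pos)
  next
    case False
    then have mn: "m = - (2 * int (nat (- q - 1)) + 1)" using q by simp
    have f: "sin_moment 2 (- (2 * int n + 1)) = - sin_moment 2 (2 * int n + 1)" for n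
      using sin_moment_minus[of 2 "2 * int n + 1"] by simp
    have gen: "- (- 4 * \<i> / (M * (M\<^sup>2 - 4))) = - 4 * \<i> / (- M * ((- M)\<^sup>2 - 4))" for M :: complex by simp
    show ?thesis unfolding mn f pos of_int_minus gen ..
  qed
qed

text \<open>\<open>(sin t)\<^sup>2\<close> is a trigonometric polynomial with frequencies \<open>0\<close> and \<open>\<plusminus> 2\<close>.\<close>

lemma sin_moment_2_even:
  "sin_moment 2 (2 * l) = of_real (if l = 0 then pi / 2 else if \<bar>l\<bar> = 1 then - (pi / 4) else 0)"
proof -
  have n1: "(1/2::real) \<notin> \<int>\<^sub>\<le>\<^sub>0" by (auto elim!: nonpos_Ints_cases)
  have G: "Gamma (3/2 :: real) = sqrt pi / 2"
    using Gamma_plus1[OF n1] by (simp add: Gamma_one_half_real)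
  have "sqrt pi * Gamma ((2 + 1) / 2) / Gamma (1 + 2 / 2) = pi / 2"
    by (simp add: Gamma_numeral G)
  moreover have "sin_moment 2 0 = of_real (sqrt pi * Gamma ((2 + 1) / 2) / Gamma (1 + 2 / 2))"
    by (rule sin_moment_0) simp
  ultimately have 0: "sin_moment 2 0 = of_real (pi / 2)" by (simp only:)
  have "4 * sin_moment 2 2 = - 2 * sin_moment 2 0"
    using sin_moment_step[of 2 0] by simp
  then have "sin_moment 2 2 = - (1/2) * sin_moment 2 0" by (simp add: field_simps)
  then have 1: "sin_moment 2 2 = of_real (- (pi / 4))" unfolding 0 by simp
  have big: "sin_moment 2 (2 * int (n + 2)) = 0" for n
  proof (induction n)
    case 0
    show ?case using sin_moment_step[of 2 2] by simp
  next
    case (Suc n)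
    have "of_real (2 + 2 + of_int (2 * int (n + 2))) * sin_moment 2 (2 * int (n + 2) + 2)
        = of_real (of_int (2 * int (n + 2)) - 2) * sin_moment 2 (2 * int (n + 2))"
      by (rule sin_moment_step) simp
    then have "of_real (2 + 2 + of_int (2 * int (n + 2))) * sin_moment 2 (2 * int (n + 2) + 2) = 0"
      unfolding Suc.IH mult_zero_right .
    moreover have "complex_of_real (2 + 2 + of_int (2 * int (n + 2))) \<noteq> 0"
      by (subst of_real_eq_0_iff) simp
    ultimately have "sin_moment 2 (2 * int (n + 2) + 2) = 0"
      by (simp only: mult_eq_0_iff) simp
    moreover have "2 * int (n + 2) + 2 = 2 * int (Suc n + 2)" by simp
    ultimately show ?case by (simp only:)
  qed
  have nat: "sin_moment 2 (2 * int n) = of_real (if n = 0 then pi / 2 else if n = 1 then - (pi / 4) else 0)" for n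
  proof -
    consider "n = 0" | "n = 1" | "n = (n - 2) + 2" by linarith
    then show ?thesis
    proof cases
      case 3
      then have "n \<noteq> 0" "n \<noteq> 1" "sin_moment 2 (2 * int n) = 0" using big[of "n - 2"] by auto
      then show ?thesis by simp
    qed (use 0 1 in simp_all)
  qed
  have "sin_moment 2 (2 * l) = sin_moment 2 (2 * int (nat \<bar>l\<bar>))"
  proof (cases "l \<ge> 0")
    case False
    then have "2 * l = - (2 * int (nat \<bar>l\<bar>))" by simp
    then show ?thesis using sin_moment_minus[of 2 "2 * int (nat \<bar>l\<bar>)"] by (simp only:) simp
  qed simp
  also have "\<dots> = of_real (if l = 0 then pi / 2 else if \<bar>l\<bar> = 1 then - (pi / 4) else 0)"
    unfolding nat by (auto simp: nat_eq_iff)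
  finally show ?thesis .
qed

text \<open>Only \<open>l = k/2\<close> and its two neighbours contribute.  The sign factors \<open>sgn l\<close> of these three
  terms may all be replaced by \<open>sgn k\<close> in the difference \<open>log_conv k s - log_conv k 0\<close>:
  they can disagree only at \<open>l = 0\<close>, where the exponential equals \<open>1\<close> and the difference vanishes.
  The remaining combination is \<open>2 - cis (2 * s) - cis (- 2 * s) = 4 * (sin s)\<^sup>2\<close>.\<close>

lemma half_laplacian_even:
  fixes L s :: real
  assumes L: "L > 0" and s: "0 < s" "s < pi" and k: "even k"
  shows "has_frac_laplacian 1 (wave L k) (L * cot s)
         (complex_of_real (\<bar>of_int k\<bar> * (sin s)^2 / L) * exp (\<i> * of_int k * complex_of_real s))"
proof -
  obtain j where j: "k = 2 * j" using k by blast
  let ?e = "\<lambda>l r. cis (of_int (2 * l) * r)"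
  define \<Sigma> where "\<Sigma> = (\<lambda>l. complex_of_int (sgn l))"
  have val: "log_conv k r = of_int k * of_real (pi / 4) *
      (2 * \<Sigma> j * ?e j r - \<Sigma> (j - 1) * ?e (j - 1) r - \<Sigma> (j + 1) * ?e (j + 1) r)"
    if r: "0 \<le> r" "r \<le> pi" for r
  proof -
    let ?t = "\<lambda>l. of_int k * \<Sigma> l * sin_moment 2 (k - 2 * l) * ?e l r"
    have sm: "sin_moment 2 (k - 2 * l) = of_real (if l = j then pi / 2 else if l = j - 1 \<or> l = j + 1 then - (pi / 4) else 0)" for l
    proof -
      have "k - 2 * l = 2 * (j - l)" by (simp add: j)
      then have "sin_moment 2 (k - 2 * l) = of_real (if j - l = 0 then pi / 2 else if \<bar>j - l\<bar> = 1 then - (pi / 4) else 0)"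
        by (simp only: sin_moment_2_even)
      moreover have "j - l = 0 \<longleftrightarrow> l = j" "\<bar>j - l\<bar> = 1 \<longleftrightarrow> l = j - 1 \<or> l = j + 1" by auto
      ultimately show ?thesis by (simp only:)
    qed
    have "(?t has_sum (\<Sum>l\<in>{j, j - 1, j + 1}. ?t l)) UNIV"
      by (rule has_sum_finite_neutralI[where B="{j, j - 1, j + 1}"]) (auto simp: sm)
    from has_sum_unique[OF log_conv(2)[OF r, of k] this[unfolded \<Sigma>_def]]
    have "log_conv k r = (\<Sum>l\<in>{j, j - 1, j + 1}. ?t l)" unfolding \<Sigma>_def .
    also have "\<dots> = of_int k * of_real (pi / 4) *
      (2 * \<Sigma> j * ?e j r - \<Sigma> (j - 1) * ?e (j - 1) r - \<Sigma> (j + 1) * ?e (j + 1) r)"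
      unfolding sm by (simp add: algebra_simps)
    finally show ?thesis .
  qed
  have e1: "?e (j + 1) s = ?e j s * cis (2 * s)" "?e (j - 1) s = ?e j s * cis (- (2 * s))"
    by (simp_all add: cis_mult algebra_simps)
  have tr: "2 - cis (2 * s) - cis (- (2 * s)) = of_real (4 * (sin s)\<^sup>2)"
    by (simp add: complex_eq_iff cos_double_sin)
  have ring: "2 * E - E * B - E * A = E * (2 - A - B)" for E A B :: complex by (simp add: algebra_simps)
  have base: "(2 * ?e j s - ?e (j - 1) s - ?e (j + 1) s) = ?e j s * of_real (4 * (sin s)\<^sup>2)"
    unfolding e1 ring tr ..
  have diff: "log_conv k s - log_conv k 0 = of_real (pi * \<bar>of_int k\<bar> * (sin s)\<^sup>2) * ?e j s"
  proof -
    have d1: "log_conv k s - log_conv k 0 = of_real (pi / 4) * (of_int k *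
      (2 * (\<Sigma> j * (?e j s - 1)) - (\<Sigma> (j - 1) * (?e (j - 1) s - 1)) - (\<Sigma> (j + 1) * (?e (j + 1) s - 1))))"
      using s by (simp add: val algebra_simps)
    consider "j = 0" | "j \<ge> 1" | "j \<le> -1" by linarith
    then have d2: "of_int k * (2 * (\<Sigma> j * (?e j s - 1)) - (\<Sigma> (j - 1) * (?e (j - 1) s - 1)) - (\<Sigma> (j + 1) * (?e (j + 1) s - 1)))
        = of_int \<bar>k\<bar> * (2 * ?e j s - ?e (j - 1) s - ?e (j + 1) s)"
    proof cases
      case 2
      have "\<Sigma> (j - 1) * (?e (j - 1) s - 1) = ?e (j - 1) s - 1" using 2 by (cases "j = 1") (auto simp: \<Sigma>_def sgn_if)
      moreover have "\<Sigma> j = 1" "\<Sigma> (j + 1) = 1" using 2 by (auto simp: \<Sigma>_def sgn_if)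
      moreover have "\<bar>k\<bar> = k" using 2 by (simp add: j)
      ultimately show ?thesis by (simp only: mult_1_left) (simp add: algebra_simps)
    next
      case 3
      have "\<Sigma> (j + 1) * (?e (j + 1) s - 1) = - (?e (j + 1) s - 1)" using 3 by (cases "j = -1") (auto simp: \<Sigma>_def sgn_if)
      moreover have "\<Sigma> j = - 1" "\<Sigma> (j - 1) = - 1" using 3 by (auto simp: \<Sigma>_def sgn_if)
      moreover have "\<bar>k\<bar> = - k" using 3 by (simp add: j)
      ultimately show ?thesis by (simp only: of_int_minus) (simp add: algebra_simps)
    qed (simp add: j)
    have "log_conv k s - log_conv k 0 = of_real (pi / 4) * (of_int \<bar>k\<bar> * (?e j s * of_real (4 * (sin s)\<^sup>2)))"
      unfolding d1 d2 base ..
    moreover have "complex_of_int \<bar>k\<bar> = of_real \<bar>of_int k\<bar>" by (metis of_int_abs of_real_of_int_eq)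
    ultimately show ?thesis by (simp add: mult_ac)
  qed
  have "exp (\<i> * of_int k * complex_of_real s) = ?e j s"
    by (simp add: cis_conv_exp j mult_ac)
  then have "complex_of_real (\<bar>of_int k\<bar> * (sin s)^2 / L) * exp (\<i> * of_int k * complex_of_real s)
      = of_real (1 / (pi * L)) * (log_conv k s - log_conv k 0)"
    unfolding diff using L by simp
  then show ?thesis using half_laplacian_convolution[OF L s, of k] by simp
qed

text \<open>The series at \<open>s\<close> is the sum in the statement; the series at \<open>0\<close> has to give the constant
  \<open>- 2 / (k\<^sup>2 - 4)\<close>.  With \<open>n = k - 2 * l\<close>, partial fractions write \<open>4 / (n * (n\<^sup>2 - 4))\<close> as the
  difference of \<open>\<phi> l = 1 / (n * (n + 2))\<close> between \<open>l + 1\<close> and \<open>l\<close>, so each of the two half series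
  telescopes.\<close>

lemma half_laplacian_odd:
  fixes L s :: real
  assumes L: "L > 0" and s: "0 < s" "s < pi" and k: "odd k"
  shows "\<exists>S. ((\<lambda>l::int. 4 * of_int (sgn l) * exp (\<i> * 2 * of_int l * complex_of_real s) /
                (of_int (k - 2 * l) * ((of_int (k - 2 * l))^2 - 4)))
              has_sum S) UNIV \<and>
            has_frac_laplacian 1 (wave L k) (L * cot s)
              (\<i> * of_int k / complex_of_real (L * pi) * (- 2 / ((of_int k)^2 - 4) - S))"
proof -
  have ko: "odd (k - 2 * l)" for l using k by simp
  have k0: "of_int k \<noteq> (0::complex)" using k by auto
  define \<tau> where "\<tau> = (\<lambda>r l. 4 * complex_of_int (sgn l) * cis (of_int (2 * l) * r) /
                (of_int (k - 2 * l) * ((of_int (k - 2 * l))^2 - 4)))"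
  have sum: "(\<tau> r has_sum (log_conv k r / (- \<i> * of_int k))) UNIV" if r: "0 \<le> r" "r \<le> pi" for r
  proof -
    have "of_int k * of_int (sgn l) * sin_moment 2 (k - 2 * l) * cis (of_int (2 * l) * r) = (- \<i> * of_int k) * \<tau> r l" for l
      unfolding sin_moment_2_odd[OF ko] \<tau>_def by (simp add: field_simps)
    then have "((\<lambda>l. (- \<i> * of_int k) * \<tau> r l) has_sum log_conv k r) UNIV"
      using log_conv(2)[OF r, of k] by (simp only:)
    then show ?thesis using k0 by (subst (asm) has_sum_cmult_right_iff) auto
  qed
  define S where "S = log_conv k s / (- \<i> * of_int k)"
  define S0 where "S0 = log_conv k 0 / (- \<i> * of_int k)"
  have S: "(\<tau> s has_sum S) UNIV" and S0: "(\<tau> 0 has_sum S0) UNIV"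
    unfolding S_def S0_def by (rule sum; use s in simp)+
  define \<phi> where "\<phi> = (\<lambda>l. 1 / (complex_of_int (k - 2 * l) * (of_int (k - 2 * l) + 2)))"
  have nz: "complex_of_int (k - 2 * l) + of_int c \<noteq> 0" if "even c" for l c
  proof -
    have "odd (k - 2 * l + c)" using ko[of l] that by simp
    then have "k - 2 * l + c \<noteq> 0" by (metis even_zero)
    then have "complex_of_int (k - 2 * l + c) \<noteq> 0" by (simp only: of_int_eq_0_iff not_False_eq_True)
    then show ?thesis by (simp only: of_int_add not_False_eq_True)
  qed
  have tel: "\<tau> 0 l = of_int (sgn l) * (\<phi> (l + 1) - \<phi> l)" for l
  proof -
    define n where "n = complex_of_int (k - 2 * l)"
    have n: "n \<noteq> 0" "n + 2 \<noteq> 0" "n - 2 \<noteq> 0"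
      using nz[of 0 l] nz[of 2 l] nz[of "-2" l] by (simp_all add: n_def)
    have "complex_of_int (k - 2 * (l + 1)) = n - 2" by (simp add: n_def)
    then have "\<phi> (l + 1) - \<phi> l = 1 / ((n - 2) * n) - 1 / (n * (n + 2))"
      unfolding \<phi>_def n_def[symmetric] by simp
    also have "\<dots> = 4 / (n * (n\<^sup>2 - 4))"
    proof -
      have "n\<^sup>2 - 4 = (n - 2) * (n + 2)" by (simp add: algebra_simps power2_eq_square)
      then show ?thesis using n by (simp add: divide_simps)
    qed
    finally show ?thesis unfolding \<tau>_def n_def[symmetric] by simp
  qed
  have part: "(\<Sum>l\<in>{- int N..int N}. \<tau> 0 l) = \<phi> (int N + 1) + \<phi> (- int N) - \<phi> 1 - \<phi> 0" for N
  proof (induction N)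
    case 0
    show ?case by (simp add: tel)
  next
    case (Suc N)
    have "{- int (Suc N)..int (Suc N)} = insert (- int N - 1) (insert (int N + 1) {- int N..int N})" by auto
    then have "(\<Sum>l\<in>{- int (Suc N)..int (Suc N)}. \<tau> 0 l)
        = \<tau> 0 (- int N - 1) + (\<tau> 0 (int N + 1) + (\<Sum>l\<in>{- int N..int N}. \<tau> 0 l))"
      by simp
    also have "\<tau> 0 (- int N - 1) = - (\<phi> (- int N) - \<phi> (- int N - 1))"
      unfolding tel by simp
    also have "\<tau> 0 (int N + 1) = \<phi> (int N + 1 + 1) - \<phi> (int N + 1)"
      unfolding tel by simp
    also note Suc.IH
    also have "- int N - 1 = - int (Suc N)" by simp
    also have "int N + 1 + 1 = int (Suc N) + 1" by simp
    finally show ?case by simp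
  qed
  have phi_lim: "(\<lambda>N. \<phi> (h N)) \<longlonglongrightarrow> 0" if h: "\<And>N. \<bar>h N\<bar> \<ge> int N" for h
  proof (rule Lim_null_comparison)
    show "(\<lambda>N. inverse (real N)) \<longlonglongrightarrow> 0" by (rule lim_inverse_n)
    show "\<forall>\<^sub>F N in sequentially. norm (\<phi> (h N)) \<le> inverse (real N)"
      using eventually_ge_at_top[of "nat (\<bar>k\<bar> + 3)"]
    proof eventually_elim
      fix N assume N: "nat (\<bar>k\<bar> + 3) \<le> N"
      define n where "n = k - 2 * h N"
      have hN: "\<bar>h N\<bar> \<ge> int N" by (rule h)
      have n1: "\<bar>n\<bar> \<ge> int N" "\<bar>n + 2\<bar> \<ge> 1" using N hN unfolding n_def by linarith+
      have "norm (\<phi> (h N)) = 1 / (real_of_int \<bar>n\<bar> * real_of_int \<bar>n + 2\<bar>)"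
      proof -
        have "\<phi> (h N) = 1 / complex_of_real (real_of_int (n * (n + 2)))" unfolding \<phi>_def n_def by simp
        then have "norm (\<phi> (h N)) = 1 / \<bar>real_of_int (n * (n + 2))\<bar>" by (simp only: norm_divide norm_of_real norm_one)
        then show ?thesis by (simp add: abs_mult)
      qed
      also have "\<dots> \<le> 1 / (real N * 1)"
      proof (intro divide_left_mono mult_mono mult_pos_pos)
        show "real N \<le> real_of_int \<bar>n\<bar>" "1 \<le> real_of_int \<bar>n + 2\<bar>" using n1 by linarith+
        show "0 < real N" using N by linarith
        show "0 < real_of_int \<bar>n\<bar>" "0 < real_of_int \<bar>n + 2\<bar>" using n1 N by linarith+
      qed auto
      finally show "norm (\<phi> (h N)) \<le> inverse (real N)" by (simp add: inverse_eq_divide)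
    qed
  qed
  have "(\<lambda>N. \<phi> (int N + 1) + \<phi> (- int N) - \<phi> 1 - \<phi> 0) \<longlonglongrightarrow> 0 + 0 - \<phi> 1 - \<phi> 0"
    by (intro tendsto_add tendsto_diff tendsto_const phi_lim) auto
  moreover have "(\<lambda>N. \<Sum>l\<in>{- int N..int N}. \<tau> 0 l) \<longlonglongrightarrow> S0"
    using S0 unfolding has_sum_def by (rule filterlim_compose[OF _ filterlim_symmetric_int_intervals])
  ultimately have S0v: "S0 = 0 + 0 - \<phi> 1 - \<phi> 0" unfolding part by (rule LIMSEQ_unique[rotated])
  have "S0 = - 2 / ((of_int k)^2 - 4)"
  proof -
    define n where "n = complex_of_int k"
    have n: "n \<noteq> 0" "n + 2 \<noteq> 0" "n - 2 \<noteq> 0"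
      using nz[of 0 0] nz[of 2 0] nz[of "-2" 0] by (simp_all add: n_def)
    have "S0 = - (1 / ((n - 2) * n)) - 1 / (n * (n + 2))"
      unfolding S0v \<phi>_def n_def by simp
    also have "\<dots> = - 2 / (n\<^sup>2 - 4)"
    proof -
      have "n\<^sup>2 - 4 = (n - 2) * (n + 2)" by (simp add: algebra_simps power2_eq_square)
      then show ?thesis using n by (simp add: divide_simps)
    qed
    finally show ?thesis by (simp add: n_def)
  qed
  then have "\<i> * of_int k / complex_of_real (L * pi) * (- 2 / ((of_int k)^2 - 4) - S)
     = of_real (1 / (pi * L)) * (log_conv k s - log_conv k 0)"
  proof -
    assume e: "S0 = - 2 / ((of_int k)^2 - 4)"
    have "log_conv k s = (- \<i> * of_int k) * S" "log_conv k 0 = (- \<i> * of_int k) * S0"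
      using k0 by (simp_all add: S_def S0_def)
    then show ?thesis unfolding e[symmetric] by (simp add: field_simps)
  qed
  then have "has_frac_laplacian 1 (wave L k) (L * cot s) (\<i> * of_int k / complex_of_real (L * pi) * (- 2 / ((of_int k)^2 - 4) - S))"
    using half_laplacian_convolution[OF L s, of k] by simp
  moreover have "((\<lambda>l::int. 4 * of_int (sgn l) * exp (\<i> * 2 * of_int l * complex_of_real s) /
                (of_int (k - 2 * l) * ((of_int (k - 2 * l))^2 - 4))) has_sum S) UNIV"
  proof -
    have "exp (\<i> * 2 * of_int l * complex_of_real s) = cis (of_int (2 * l) * s)" for l
      by (simp add: cis_conv_exp mult_ac)
    then show ?thesis using S unfolding \<tau>_def by (simp only:)
  qed
  ultimately show ?thesis by blast
qed

section \<open>The fractional Laplacian of the mapped exponentials\<close>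

theorem theorem2p2:
  fixes L s :: real and k :: int
  assumes "L > 0" and "0 < s" and "s < pi"
  shows
   "(\<forall>\<alpha> \<in> {0<..<1} \<union> {1<..<2}.
      (even k \<longrightarrow>
        (\<exists>S. ((\<lambda>l::int. exp (\<i> * 2 * of_int l * complex_of_real s) *
                 complex_of_real (((1 - \<alpha>) * (of_int k)^2 - 4 * of_int k * of_int l) *
                   (Gamma ((-1 + \<alpha>)/2 + \<bar>of_int l\<bar>) *
                    Gamma ((-1 - \<alpha>)/2 + \<bar>of_int k / 2 - of_int l\<bar>)) /
                   (Gamma ((3 - \<alpha>)/2 + \<bar>of_int l\<bar>) *
                    Gamma ((3 + \<alpha>)/2 + \<bar>of_int k / 2 - of_int l\<bar>))))
               has_sum S) UNIV \<and>
             has_frac_laplacian \<alpha>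
               (on_line L (\<lambda>t. exp (\<i> * of_int k * complex_of_real t))) (L * cot s)
               (complex_of_real (frac_const \<alpha> * \<bar>sin s\<bar> powr (\<alpha> - 1) /
                   (8 * L powr \<alpha> * tan (pi * \<alpha> / 2))) * S))) \<and>
      (odd k \<longrightarrow>
        (\<exists>S. ((\<lambda>l::int. exp (\<i> * 2 * of_int l * complex_of_real s) *
                 complex_of_real (((1 - \<alpha>) * (of_int k)^2 - 4 * of_int k * of_int l) *
                   sgn (of_int k / 2 - of_int l) *
                   (Gamma ((-1 + \<alpha>)/2 + \<bar>of_int l\<bar>) *
                    Gamma ((-1 - \<alpha>)/2 + \<bar>of_int k / 2 - of_int l\<bar>)) /
                   (Gamma ((3 - \<alpha>)/2 + \<bar>of_int l\<bar>) *
                    Gamma ((3 + \<alpha>)/2 + \<bar>of_int k / 2 - of_int l\<bar>))))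
               has_sum S) UNIV \<and>
             has_frac_laplacian \<alpha>
               (on_line L (\<lambda>t. exp (\<i> * of_int k * complex_of_real t))) (L * cot s)
               (\<i> * complex_of_real (frac_const \<alpha> * \<bar>sin s\<bar> powr (\<alpha> - 1) /
                   (8 * L powr \<alpha>)) * S)))) \<and>
    (even k \<longrightarrow>
       has_frac_laplacian 1
         (on_line L (\<lambda>t. exp (\<i> * of_int k * complex_of_real t))) (L * cot s)
         (complex_of_real (\<bar>of_int k\<bar> * (sin s)^2 / L) *
           exp (\<i> * of_int k * complex_of_real s))) \<and>
    (odd k \<longrightarrow>
       (\<exists>S. ((\<lambda>l::int. 4 * of_int (sgn l) * exp (\<i> * 2 * of_int l * complex_of_real s) /
                (of_int (k - 2 * l) * ((of_int (k - 2 * l))^2 - 4)))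
              has_sum S) UNIV \<and>
            has_frac_laplacian 1
              (on_line L (\<lambda>t. exp (\<i> * of_int k * complex_of_real t))) (L * cot s)
              (\<i> * of_int k / complex_of_real (L * pi) *
                 (- 2 / ((of_int k)^2 - 4) - S))))"
proof -
  have order: "0 < \<alpha>" "\<alpha> < 2" "\<alpha> \<noteq> 1" if "\<alpha> \<in> {0<..<1} \<union> {1<..<2}" for \<alpha> :: real
    using that by auto
  show ?thesis
    unfolding on_line_exp
    by (intro conjI ballI impI;
        rule fractional_even[OF assms order] fractional_odd[OF assms order]
          half_laplacian_even[OF assms] half_laplacian_odd[OF assms]; assumption)
qed

end
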